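(* Any projectively Anosov flow on $M$ preserving some $C^0$ volume form is Anosov. In particular, any contact projectively Anosov flow (that is, a projectively Anosov flow which preserves a transverse contact structure) is Anosov.
   Context: Standing assumptions: $M$ is a closed connected oriented 3-manifold; the flow $\phi^t$ is generated by a non-vanishing $C^{1+}$ vector field $X$ on $M$ ($C^1$ with Hölder continuous derivatives); the invariant bundles of the flow are transversely orientable. The flow induces a flow $\tilde\phi^t_*$ on $TM/\langle X\rangle$. The flow is projectively Anosov if there is a continuous splitting into line bundles $TM/\langle X\rangle\simeq E^s\oplus E^u$, invariant under $\tilde\phi^t_*$, such that for some constant $C>0$ and some norm $\|\cdot\|$, $\|\tilde\phi^t_*(v)\|/\|\tilde\phi^t_*(u)\|\ge e^{Ct}\|v\|/\|u\|$ for all $t\ge 0$ and all nonzero $u\in E^s$, $v\in E^u$ over the same point. The flow is Anosov if there is a continuous $\phi^t_*$-invariant splitting $TM\simeq E^{ss}\oplus E^{uu}\oplus\langle X\rangle$ (with $E^{ss},E^{uu}$ line bundles) such that for some $C>0$ and some norm, $\|\phi^t_*(u)\|\le e^{-Ct}\|u\|$ and $\|\phi^t_*(v)\|\ge e^{Ct}\|v\|$ for all $t\ge0$, $u\in E^{ss}$, $v\in E^{uu}$. A contact structure is a $C^1$ plane field $\xi=\ker\alpha$, where $\alpha$ is a $C^1$ 1-form with $\alpha\wedge d\alpha$ nowhere vanishing. *)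

theory Defs
  imports "HOL-Analysis.Analysis" "HOL-Library.Function_Algebras" "HOL-Library.Set_Algebras"
begin

text \<open>The pointwise real vector space structure on functions.\<close>

instantiation "fun" :: (type, real_vector) real_vector
begin

definition scaleR_fun_def: "r *\<^sub>R f = (\<lambda>x. r *\<^sub>R f x)"

instance
  by standard
    (simp_all add: scaleR_fun_def plus_fun_def fun_eq_iff scaleR_add_right scaleR_add_left)

end


section \<open>Closed connected oriented 3-manifolds\<close>

text \<open>\<open>Ck_on k f S\<close> is only meant for open \<open>S\<close>.\<close>

primrec Ck_on ::
  "nat \<Rightarrow> ('a::euclidean_space \<Rightarrow> 'b::real_normed_vector) \<Rightarrow> 'a set \<Rightarrow> bool" where
  "Ck_on 0 f S \<longleftrightarrow> continuous_on S f"
| "Ck_on (Suc k) f S \<longleftrightarrow>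
     f differentiable_on S \<and> (\<forall>h. Ck_on k (\<lambda>x. frechet_derivative f (at x) h) S)"

text \<open>
  The manifold is the whole of a type \<open>'m\<close>. A chart is a pair of a domain and a coordinate map; the
  values of the coordinate map outside the domain carry no meaning.
\<close>

type_synonym 'm chart = "'m set \<times> ('m \<Rightarrow> real^3)"

abbreviation cdom :: "'m chart \<Rightarrow> 'm set" where "cdom c \<equiv> fst c"
abbreviation cmap :: "'m chart \<Rightarrow> 'm \<Rightarrow> real^3" where "cmap c \<equiv> snd c"
abbreviation cimg :: "'m chart \<Rightarrow> (real^3) set" where "cimg c \<equiv> cmap c ` cdom c"

definition cinv :: "'m chart \<Rightarrow> real^3 \<Rightarrow> 'm" where
  "cinv c = inv_into (cdom c) (cmap c)"

definition is_chart :: "('m::topological_space) chart \<Rightarrow> bool" where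
  "is_chart c \<longleftrightarrow>
     open (cdom c) \<and> open (cimg c) \<and> homeomorphism (cdom c) (cimg c) (cmap c) (cinv c)"

definition transition :: "'m chart \<Rightarrow> 'm chart \<Rightarrow> real^3 \<Rightarrow> real^3" where
  "transition c c' = cmap c' \<circ> cinv c"

definition oriented_smooth_atlas :: "('m::topological_space) chart set \<Rightarrow> bool" where
  "oriented_smooth_atlas A \<longleftrightarrow>
     (\<forall>c\<in>A. is_chart c) \<and> (\<Union>c\<in>A. cdom c) = UNIV \<and>
     (\<forall>c\<in>A. \<forall>c'\<in>A. \<forall>x\<in>cmap c ` (cdom c \<inter> cdom c').
        0 < det (matrix (frechet_derivative (transition c c') (at x)))) \<and>
     (\<forall>c\<in>A. \<forall>c'\<in>A. \<forall>k. Ck_on k (transition c c') (cmap c ` (cdom c \<inter> cdom c')))"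

text \<open>
  The Hausdorff property is the class constraint; second countability follows from compactness.
\<close>

definition closed_connected_oriented_3_manifold :: "('m::t2_space) chart set \<Rightarrow> bool" where
  "closed_connected_oriented_3_manifold A \<longleftrightarrow>
     oriented_smooth_atlas A \<and> compact (UNIV :: 'm set) \<and> connected (UNIV :: 'm set)"


section \<open>Tangent vectors\<close>

text \<open>
  A tangent vector at \<open>p\<close> is the family of its components in all charts around \<open>p\<close>, related by
  the derivatives of the transition maps, and zero at every other index.
\<close>

type_synonym 'm tvec = "'m chart \<Rightarrow> real^3"

definition tangent_space :: "'m chart set \<Rightarrow> 'm \<Rightarrow> 'm tvec set" where
  "tangent_space A p =
     {v. (\<forall>c\<in>A. \<forall>c'\<in>A. p \<in> cdom c \<longrightarrow> p \<in> cdom c' \<longrightarrow>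
            v c' = frechet_derivative (transition c c') (at (cmap c p)) (v c)) \<and>
         (\<forall>c. \<not> (c \<in> A \<and> p \<in> cdom c) \<longrightarrow> v c = 0)}"

text \<open>
  \<open>coord_vec A c p h\<close> is the tangent vector at \<open>p\<close> with components \<open>h\<close> in the chart \<open>c\<close>; the map
  \<open>(p, h) \<mapsto> coord_vec A c p h\<close> is the local trivialisation of the tangent bundle given by \<open>c\<close>.
\<close>

definition coord_vec :: "'m chart set \<Rightarrow> 'm chart \<Rightarrow> 'm \<Rightarrow> real^3 \<Rightarrow> 'm tvec" where
  "coord_vec A c p h = (\<lambda>c'.
     if c' \<in> A \<and> p \<in> cdom c' then frechet_derivative (transition c c') (at (cmap c p)) h else 0)"

text \<open>By the chain rule the choice of the chart at \<open>p\<close> is immaterial for differentiable \<open>f\<close>.\<close>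

definition chart_at :: "'m chart set \<Rightarrow> 'm \<Rightarrow> 'm chart" where
  "chart_at A p = (SOME c. c \<in> A \<and> p \<in> cdom c)"

definition pushforward :: "'m chart set \<Rightarrow> ('m \<Rightarrow> 'm) \<Rightarrow> 'm \<Rightarrow> 'm tvec \<Rightarrow> 'm tvec" where
  "pushforward A f p v =
     (let c = chart_at A p in
      (\<lambda>c'. if c' \<in> A \<and> f p \<in> cdom c'
            then frechet_derivative (cmap c' \<circ> f \<circ> cinv c) (at (cmap c p)) (v c) else 0))"


section \<open>Vector fields and flows\<close>

definition continuous_vector_field_on ::
  "('m::topological_space) chart set \<Rightarrow> 'm set \<Rightarrow> ('m \<Rightarrow> 'm tvec) \<Rightarrow> bool" where
  "continuous_vector_field_on A U Y \<longleftrightarrow>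
     (\<forall>p\<in>U. Y p \<in> tangent_space A p) \<and>
     (\<forall>c\<in>A. continuous_on (cdom c \<inter> U) (\<lambda>p. Y p c))"

definition local_rep :: "'m chart \<Rightarrow> ('m \<Rightarrow> 'm tvec) \<Rightarrow> real^3 \<Rightarrow> real^3" where
  "local_rep c Y = (\<lambda>x. Y (cinv c x) c)"

definition C1_plus_vector_field ::
  "('m::topological_space) chart set \<Rightarrow> ('m \<Rightarrow> 'm tvec) \<Rightarrow> bool" where
  "C1_plus_vector_field A Y \<longleftrightarrow>
     (\<forall>p. Y p \<in> tangent_space A p) \<and>
     (\<forall>c\<in>A. Ck_on 1 (local_rep c Y) (cimg c)) \<and>
     (\<exists>\<gamma>. 0 < \<gamma> \<and> \<gamma> \<le> 1 \<and>
       (\<forall>c\<in>A. \<forall>x\<in>cimg c. \<exists>L. \<exists>r>0. ball x r \<subseteq> cimg c \<and>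
          (\<forall>y\<in>ball x r. \<forall>z\<in>ball x r.
             onorm (\<lambda>h. frechet_derivative (local_rep c Y) (at y) h
                      - frechet_derivative (local_rep c Y) (at z) h) \<le> L * dist y z powr \<gamma>)))"

text \<open>
  Continuity of the orbits is stated separately: the derivative condition alone would not keep an
  orbit inside the domain of the chart in which it is differentiated.
\<close>

definition flow_generated_by ::
  "('m::topological_space) chart set \<Rightarrow> ('m \<Rightarrow> 'm tvec) \<Rightarrow> (real \<Rightarrow> 'm \<Rightarrow> 'm) \<Rightarrow> bool" where
  "flow_generated_by A X \<phi> \<longleftrightarrow>
     (\<forall>p. \<phi> 0 p = p) \<and> (\<forall>s t p. \<phi> (s + t) p = \<phi> s (\<phi> t p)) \<and>
     (\<forall>p. continuous_on UNIV (\<lambda>t. \<phi> t p)) \<and>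
     (\<forall>p t. \<forall>c\<in>A. \<phi> t p \<in> cdom c \<longrightarrow>
        ((\<lambda>s. cmap c (\<phi> s p)) has_vector_derivative X (\<phi> t p) c) (at t))"


section \<open>Anosov flows\<close>

definition fibre_norm_on :: "'v::real_vector set \<Rightarrow> ('v \<Rightarrow> real) \<Rightarrow> bool" where
  "fibre_norm_on V n \<longleftrightarrow>
     (\<forall>v\<in>V. 0 \<le> n v \<and> (n v = 0 \<longleftrightarrow> v = 0)) \<and>
     (\<forall>v\<in>V. \<forall>a. n (a *\<^sub>R v) = \<bar>a\<bar> * n v) \<and>
     (\<forall>v\<in>V. \<forall>w\<in>V. n (v + w) \<le> n v + n w)"

definition continuous_norm ::
  "('m::topological_space) chart set \<Rightarrow> ('m \<Rightarrow> 'm tvec \<Rightarrow> real) \<Rightarrow> bool" where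
  "continuous_norm A N \<longleftrightarrow>
     (\<forall>p. fibre_norm_on (tangent_space A p) (N p)) \<and>
     (\<forall>c\<in>A. continuous_on (cdom c \<times> UNIV) (\<lambda>(p, h). N p (coord_vec A c p h)))"

definition continuous_line_bundle ::
  "('m::topological_space) chart set \<Rightarrow> ('m \<Rightarrow> 'm tvec set) \<Rightarrow> bool" where
  "continuous_line_bundle A E \<longleftrightarrow>
     (\<forall>p. \<exists>U Y. open U \<and> p \<in> U \<and> continuous_vector_field_on A U Y \<and>
        (\<forall>q\<in>U. Y q \<noteq> 0 \<and> E q = span {Y q}))"

definition invariant_field ::
  "'m chart set \<Rightarrow> (real \<Rightarrow> 'm \<Rightarrow> 'm) \<Rightarrow> ('m \<Rightarrow> 'm tvec set) \<Rightarrow> bool" where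
  "invariant_field A \<phi> E \<longleftrightarrow> (\<forall>t p. pushforward A (\<phi> t) p ` E p = E (\<phi> t p))"

definition anosov ::
  "('m::topological_space) chart set \<Rightarrow> ('m \<Rightarrow> 'm tvec) \<Rightarrow> (real \<Rightarrow> 'm \<Rightarrow> 'm) \<Rightarrow> bool" where
  "anosov A X \<phi> \<longleftrightarrow>
     (\<exists>Ess Euu.
        continuous_line_bundle A Ess \<and> continuous_line_bundle A Euu \<and>
        invariant_field A \<phi> Ess \<and> invariant_field A \<phi> Euu \<and>
        (\<forall>p. tangent_space A p = Ess p + Euu p + span {X p} \<and>
             (\<forall>u\<in>Ess p. \<forall>v\<in>Euu p. \<forall>w\<in>span {X p}.
                u + v + w = 0 \<longrightarrow> u = 0 \<and> v = 0 \<and> w = 0)) \<and>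
        (\<exists>C>0. \<exists>N. continuous_norm A N \<and>
           (\<forall>t\<ge>0. \<forall>p.
              (\<forall>u\<in>Ess p. N (\<phi> t p) (pushforward A (\<phi> t) p u) \<le> exp (- C * t) * N p u) \<and>
              (\<forall>v\<in>Euu p. N (\<phi> t p) (pushforward A (\<phi> t) p v) \<ge> exp (C * t) * N p v))))"


section \<open>Projectively Anosov flows\<close>

text \<open>
  The fibre at \<open>p\<close> of the quotient of the tangent bundle by \<open>X\<close> consists of the cosets of
  \<open>span {X p}\<close>, so \<open>qclass X p v\<close> is the class of \<open>v\<close> and \<open>qclass X p 0\<close> the zero vector.
  Addition of classes is addition of sets. Scalar multiples are always written on representatives,
  because the image of a coset under multiplication by zero is not a coset.
\<close>

definition qclass :: "('m \<Rightarrow> 'm tvec) \<Rightarrow> 'm \<Rightarrow> 'm tvec \<Rightarrow> 'm tvec set" where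
  "qclass X p v = v +o span {X p}"

definition quotient_space ::
  "'m chart set \<Rightarrow> ('m \<Rightarrow> 'm tvec) \<Rightarrow> 'm \<Rightarrow> 'm tvec set set" where
  "quotient_space A X p = qclass X p ` tangent_space A p"

text \<open>The induced map on classes is the image of a coset under the derivative of \<open>f\<close>.\<close>

definition quotient_pushforward ::
  "'m chart set \<Rightarrow> ('m \<Rightarrow> 'm) \<Rightarrow> 'm \<Rightarrow> 'm tvec set \<Rightarrow> 'm tvec set" where
  "quotient_pushforward A f p K = pushforward A f p ` K"

text \<open>
  A section of the quotient bundle is continuous iff it is locally the class of a continuous vector
  field.
\<close>

definition continuous_quotient_line_bundle ::
  "('m::topological_space) chart set \<Rightarrow> ('m \<Rightarrow> 'm tvec) \<Rightarrow> ('m \<Rightarrow> 'm tvec set set) \<Rightarrow> bool" where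
  "continuous_quotient_line_bundle A X E \<longleftrightarrow>
     (\<forall>p. \<exists>U Y. open U \<and> p \<in> U \<and> continuous_vector_field_on A U Y \<and>
        (\<forall>q\<in>U. qclass X q (Y q) \<noteq> qclass X q 0 \<and> E q = {qclass X q (a *\<^sub>R Y q) | a. True}))"

definition continuous_quotient_norm ::
  "('m::topological_space) chart set \<Rightarrow> ('m \<Rightarrow> 'm tvec) \<Rightarrow> ('m \<Rightarrow> 'm tvec set \<Rightarrow> real) \<Rightarrow> bool" where
  "continuous_quotient_norm A X N \<longleftrightarrow>
     (\<forall>p. (\<forall>K\<in>quotient_space A X p. 0 \<le> N p K \<and> (N p K = 0 \<longleftrightarrow> K = qclass X p 0)) \<and>
          (\<forall>v\<in>tangent_space A p. \<forall>a. N p (qclass X p (a *\<^sub>R v)) = \<bar>a\<bar> * N p (qclass X p v)) \<and>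
          (\<forall>K\<in>quotient_space A X p. \<forall>L\<in>quotient_space A X p. N p (K + L) \<le> N p K + N p L)) \<and>
     (\<forall>c\<in>A. continuous_on (cdom c \<times> UNIV) (\<lambda>(p, h). N p (qclass X p (coord_vec A c p h))))"

definition projectively_anosov_splitting ::
  "('m::topological_space) chart set \<Rightarrow> ('m \<Rightarrow> 'm tvec) \<Rightarrow> (real \<Rightarrow> 'm \<Rightarrow> 'm) \<Rightarrow>
   ('m \<Rightarrow> 'm tvec set set) \<Rightarrow> ('m \<Rightarrow> 'm tvec set set) \<Rightarrow> bool" where
  "projectively_anosov_splitting A X \<phi> Es Eu \<longleftrightarrow>
     continuous_quotient_line_bundle A X Es \<and> continuous_quotient_line_bundle A X Eu \<and>
     (\<forall>t p. quotient_pushforward A (\<phi> t) p ` Es p = Es (\<phi> t p) \<and>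
            quotient_pushforward A (\<phi> t) p ` Eu p = Eu (\<phi> t p)) \<and>
     (\<forall>p. quotient_space A X p = Es p + Eu p \<and> Es p \<inter> Eu p = {qclass X p 0}) \<and>
     (\<exists>C>0. \<exists>N. continuous_quotient_norm A X N \<and>
        (\<forall>t\<ge>0. \<forall>p. \<forall>u \<in> Es p - {qclass X p 0}. \<forall>v \<in> Eu p - {qclass X p 0}.
           N (\<phi> t p) (quotient_pushforward A (\<phi> t) p v)
             / N (\<phi> t p) (quotient_pushforward A (\<phi> t) p u)
           \<ge> exp (C * t) * (N p v / N p u)))"

text \<open>
  The plane field in the tangent bundle over a line field of the quotient: the union of the cosets
  that make up the line.
\<close>

definition plane_over :: "('m \<Rightarrow> 'm tvec set set) \<Rightarrow> 'm \<Rightarrow> 'm tvec set" where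
  "plane_over E p = \<Union> (E p)"

definition transversely_orientable ::
  "('m::topological_space) chart set \<Rightarrow> ('m \<Rightarrow> 'm tvec set) \<Rightarrow> bool" where
  "transversely_orientable A F \<longleftrightarrow>
     (\<exists>Y. continuous_vector_field_on A UNIV Y \<and> (\<forall>p. Y p \<notin> F p))"


section \<open>Volume forms and contact structures\<close>

definition linear_form_on :: "'v::real_vector set \<Rightarrow> ('v \<Rightarrow> real) \<Rightarrow> bool" where
  "linear_form_on V f \<longleftrightarrow>
     (\<forall>v\<in>V. \<forall>w\<in>V. \<forall>a b. f (a *\<^sub>R v + b *\<^sub>R w) = a * f v + b * f w)"

definition alternating_3_form_on ::
  "'v::real_vector set \<Rightarrow> ('v \<Rightarrow> 'v \<Rightarrow> 'v \<Rightarrow> real) \<Rightarrow> bool" where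
  "alternating_3_form_on V \<omega> \<longleftrightarrow>
     (\<forall>u\<in>V. \<forall>v\<in>V. linear_form_on V (\<lambda>w. \<omega> w u v) \<and> linear_form_on V (\<lambda>w. \<omega> u w v) \<and>
                  linear_form_on V (\<lambda>w. \<omega> u v w)) \<and>
     (\<forall>u\<in>V. \<forall>v\<in>V. \<omega> u u v = 0 \<and> \<omega> u v u = 0 \<and> \<omega> v u u = 0)"

definition C0_volume_form ::
  "('m::topological_space) chart set \<Rightarrow> ('m \<Rightarrow> 'm tvec \<Rightarrow> 'm tvec \<Rightarrow> 'm tvec \<Rightarrow> real) \<Rightarrow> bool" where
  "C0_volume_form A \<omega> \<longleftrightarrow>
     (\<forall>p. alternating_3_form_on (tangent_space A p) (\<omega> p) \<and>
          (\<exists>u\<in>tangent_space A p. \<exists>v\<in>tangent_space A p. \<exists>w\<in>tangent_space A p. \<omega> p u v w \<noteq> 0)) \<and>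
     (\<forall>c\<in>A. \<forall>h k l. continuous_on (cdom c)
        (\<lambda>p. \<omega> p (coord_vec A c p h) (coord_vec A c p k) (coord_vec A c p l)))"

definition preserves_3_form ::
  "'m chart set \<Rightarrow> (real \<Rightarrow> 'm \<Rightarrow> 'm) \<Rightarrow> ('m \<Rightarrow> 'm tvec \<Rightarrow> 'm tvec \<Rightarrow> 'm tvec \<Rightarrow> real) \<Rightarrow> bool" where
  "preserves_3_form A \<phi> \<omega> \<longleftrightarrow>
     (\<forall>t p. \<forall>u\<in>tangent_space A p. \<forall>v\<in>tangent_space A p. \<forall>w\<in>tangent_space A p.
        \<omega> (\<phi> t p) (pushforward A (\<phi> t) p u) (pushforward A (\<phi> t) p v) (pushforward A (\<phi> t) p w)
        = \<omega> p u v w)"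

definition C1_one_form ::
  "('m::topological_space) chart set \<Rightarrow> ('m \<Rightarrow> 'm tvec \<Rightarrow> real) \<Rightarrow> bool" where
  "C1_one_form A \<alpha> \<longleftrightarrow>
     (\<forall>p. linear_form_on (tangent_space A p) (\<alpha> p)) \<and>
     (\<forall>c\<in>A. \<forall>h. Ck_on 1 (\<lambda>x. \<alpha> (cinv c x) (coord_vec A c (cinv c x) h)) (cimg c))"

text \<open>
  The formula \<open>d\<alpha>(U, V) = U(\<alpha>(V)) - V(\<alpha>(U)) - \<alpha>([U, V])\<close> for the fields with constant components
  in a chart, whose bracket vanishes. The result does not depend on the chart.
\<close>

definition exterior_derivative ::
  "'m chart set \<Rightarrow> ('m \<Rightarrow> 'm tvec \<Rightarrow> real) \<Rightarrow> 'm \<Rightarrow> 'm tvec \<Rightarrow> 'm tvec \<Rightarrow> real" where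
  "exterior_derivative A \<alpha> p u v =
     (let c = chart_at A p;
          coeff = (\<lambda>h x. \<alpha> (cinv c x) (coord_vec A c (cinv c x) h))
      in frechet_derivative (coeff (v c)) (at (cmap c p)) (u c)
         - frechet_derivative (coeff (u c)) (at (cmap c p)) (v c))"

definition wedge_1_2 ::
  "('v \<Rightarrow> real) \<Rightarrow> ('v \<Rightarrow> 'v \<Rightarrow> real) \<Rightarrow> 'v \<Rightarrow> 'v \<Rightarrow> 'v \<Rightarrow> real" where
  "wedge_1_2 \<alpha> \<beta> u v w = \<alpha> u * \<beta> v w - \<alpha> v * \<beta> u w + \<alpha> w * \<beta> u v"

definition contact_structure ::
  "('m::topological_space) chart set \<Rightarrow> ('m \<Rightarrow> 'm tvec set) \<Rightarrow> bool" where
  "contact_structure A \<xi> \<longleftrightarrow>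
     (\<exists>\<alpha>. C1_one_form A \<alpha> \<and>
        (\<forall>p. \<exists>u\<in>tangent_space A p. \<exists>v\<in>tangent_space A p. \<exists>w\<in>tangent_space A p.
           wedge_1_2 (\<alpha> p) (exterior_derivative A \<alpha> p) u v w \<noteq> 0) \<and>
        (\<forall>p. \<xi> p = {v \<in> tangent_space A p. \<alpha> p v = 0}))"

end

theory Submission
  imports Defs
begin

text \<open>
  Contracting a preserved volume form with \<open>X\<close> gives an area form on the quotient of the tangent
  bundle by \<open>X\<close> that is preserved by the induced flow. Measured in generators of the two invariant
  lines that have equal length and span area one, the expansion rates \<open>f\<close> and \<open>g\<close> along the lines
  therefore satisfy \<open>\<bar>f g\<bar> = 1\<close>, while domination says \<open>\<bar>g / f\<bar> \<ge> exp (C t)\<close>. Together they give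
  \<open>\<bar>f\<bar> \<le> exp (- C t / 2)\<close> and \<open>\<bar>g\<bar> \<ge> exp (C t / 2)\<close>, so that the flow on the quotient is uniformly
  hyperbolic (\<open>anosov_if_volume_preserving\<close>).

  Hyperbolicity lifts from the quotient to the tangent bundle. The preimage of each line is an
  invariant plane field containing \<open>X\<close>. In a global continuous frame \<open>X, e\<^sub>1, e\<^sub>2\<close> adapted to the two
  planes, which exists by transverse orientability (\<open>ex_global_lift\<close>), an invariant line in such a
  plane is the graph of a function \<open>h\<close>, and invariance is an affine equation for \<open>h\<close> along the
  orbits. Its linear part contracts in forward time for one plane and in backward time for the
  other, so that it has a continuous solution (\<open>affine_cocycle_invariant_section\<close>,
  \<open>anosov_if_hyperbolic_frame\<close>).

  In the contact case, the contact form \<open>\<alpha>\<close> normalised by \<open>\<alpha> X = 1\<close> is invariant, since the flow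
  preserves its kernel and \<open>X\<close>; hence \<open>\<alpha> \<and> d\<alpha>\<close> is a preserved volume form. As \<open>\<alpha>\<close> and the maps of the
  flow are only \<open>C\<^sup>1\<close>, the usual proof that \<open>d\<close> commutes with pull-back does not apply; at a point
  where \<open>\<alpha>\<close> and its pull-back are differentiable it follows from the symmetry of second derivatives
  (\<open>exterior_derivative_pullback_C1\<close>).

  All of this needs that the maps of the flow are continuously differentiable. For short times this is
  proved in a chart (\<open>C1_dependence_on_initial_value\<close>, \<open>flow_C1_near_short_time\<close>); by compactness of
  the manifold a short time works at all points, and longer times follow by composition.
\<close>

section \<open>Differential calculus of \<open>C\<^sup>1\<close> maps\<close>

lemma C1_on_iff:
  assumes "open S"
  shows "Ck_on 1 f S \<longleftrightarrow> (\<forall>x\<in>S. f differentiable at x) \<and>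
     (\<forall>h. continuous_on S (\<lambda>x. frechet_derivative f (at x) h))"
  using assms by (auto simp: differentiable_on_eq_differentiable_at)

lemma C1_onD:
  assumes "open S" "Ck_on 1 f S"
  shows "x \<in> S \<Longrightarrow> f differentiable at x"
    and "continuous_on S (\<lambda>x. frechet_derivative f (at x) h)"
  using assms(2) unfolding C1_on_iff[OF assms(1)] by blast+

lemma C1_on_has_derivative:
  assumes "open S" "Ck_on 1 f S" "x \<in> S"
  shows "(f has_derivative frechet_derivative f (at x)) (at x)"
  using C1_onD(1)[OF assms] by (simp add: frechet_derivative_works)

lemma C1_onI:
  assumes "open S" "\<And>x. x \<in> S \<Longrightarrow> (f has_derivative f' x) (at x)" "\<And>h. continuous_on S (\<lambda>x. f' x h)"
  shows "Ck_on 1 f S"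
proof -
  have "continuous_on S (\<lambda>x. frechet_derivative f (at x) h)" for h
    by (rule continuous_on_eq[OF assms(3)]) (simp add: frechet_derivative_at[OF assms(2), symmetric])
  then show ?thesis
    using assms(2) unfolding C1_on_iff[OF assms(1)] differentiable_def by blast
qed

lemma C1_on_continuous_on:
  assumes "open S" "Ck_on 1 f S"
  shows "continuous_on S f"
  using C1_onD(1)[OF assms] by (blast intro: continuous_at_imp_continuous_on differentiable_imp_continuous_within)

lemma linear_expand:
  fixes f :: "'a::euclidean_space \<Rightarrow> 'b::real_vector"
  assumes "linear f"
  shows "f h = (\<Sum>b\<in>Basis. (h \<bullet> b) *\<^sub>R f b)"
proof -
  have "f h = f (\<Sum>b\<in>Basis. (h \<bullet> b) *\<^sub>R b)" by (simp add: euclidean_representation)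
  then show ?thesis by (simp add: linear_sum[OF assms] linear_cmul[OF assms])
qed

lemma linear_functional_expand:
  fixes f :: "'a::euclidean_space \<Rightarrow> real"
  assumes "linear f"
  shows "f h = (\<Sum>b\<in>Basis. (h \<bullet> b) * f b)"
  by (subst linear_expand[OF assms]) simp

lemmas linear_frechet_derivative_expand = linear_expand[OF linear_frechet_derivative]

lemma continuous_on_frechet_derivative_apply:
  fixes f :: "'a::euclidean_space \<Rightarrow> 'b::real_normed_vector"
  assumes "open S" "Ck_on 1 f S" "continuous_on T g" "continuous_on T k" "g ` T \<subseteq> S"
  shows "continuous_on T (\<lambda>x. frechet_derivative f (at (g x)) (k x))"
proof -
  have "continuous_on T (\<lambda>x. frechet_derivative f (at (g x)) b)" for b
    by (rule continuous_on_compose2[OF C1_onD(2)[OF assms(1,2)] assms(3,5)])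
  then have "continuous_on T (\<lambda>x. \<Sum>b\<in>Basis. (k x \<bullet> b) *\<^sub>R frechet_derivative f (at (g x)) b)"
    using assms by (intro continuous_intros) auto
  moreover have "frechet_derivative f (at (g x)) (k x) =
      (\<Sum>b\<in>Basis. (k x \<bullet> b) *\<^sub>R frechet_derivative f (at (g x)) b)" if "x \<in> T" for x
    using that assms(5) by (intro linear_frechet_derivative_expand C1_onD(1)[OF assms(1,2)]) auto
  ultimately show ?thesis
    by (simp cong: continuous_on_cong)
qed

lemma C1_on_subset:
  assumes "open S" "Ck_on 1 f S" "open T" "T \<subseteq> S"
  shows "Ck_on 1 f T"
  unfolding C1_on_iff[OF assms(3)]
  using C1_onD[OF assms(1,2)] assms(4) by (blast intro: continuous_on_subset)

lemma C1_on_cong: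
  assumes S: "open S" and f: "Ck_on 1 f S" and eq: "\<And>x. x \<in> S \<Longrightarrow> f x = g x"
  shows "Ck_on 1 g S"
proof (rule C1_onI[OF S])
  show "(g has_derivative frechet_derivative f (at x)) (at x)" if "x \<in> S" for x
    by (rule has_derivative_transform_within_open[OF C1_on_has_derivative[OF S f that] S that eq])
qed (rule C1_onD(2)[OF S f])

lemma C1_on_compose:
  fixes f :: "'a::euclidean_space \<Rightarrow> 'b::euclidean_space" and g :: "'b \<Rightarrow> 'c::real_normed_vector"
  assumes S: "open S" and f: "Ck_on 1 f S" and T: "open T" and g: "Ck_on 1 g T" and ST: "f ` S \<subseteq> T"
  shows "Ck_on 1 (g \<circ> f) S"
proof (rule C1_onI[OF S])
  show "(g \<circ> f has_derivative (\<lambda>h. frechet_derivative g (at (f x)) (frechet_derivative f (at x) h))) (at x)"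
    if x: "x \<in> S" for x
  proof -
    have "f x \<in> T" using ST x by auto
    from diff_chain_at[OF C1_on_has_derivative[OF S f x] C1_on_has_derivative[OF T g this]]
    show ?thesis by (simp add: o_def)
  qed
  show "continuous_on S (\<lambda>x. frechet_derivative g (at (f x)) (frechet_derivative f (at x) h))" for h
    by (intro continuous_on_frechet_derivative_apply[OF T g] C1_on_continuous_on C1_onD(2) S f ST)
qed

lemma C1_on_mult:
  fixes f g :: "'a::euclidean_space \<Rightarrow> real"
  assumes S: "open S" and f: "Ck_on 1 f S" and g: "Ck_on 1 g S"
  shows "Ck_on 1 (\<lambda>x. f x * g x) S"
proof (rule C1_onI[OF S])
  show "((\<lambda>x. f x * g x) has_derivative
      (\<lambda>h. f x * frechet_derivative g (at x) h + frechet_derivative f (at x) h * g x)) (at x)" if "x \<in> S" for x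
    by (rule has_derivative_mult[OF C1_on_has_derivative[OF S f that] C1_on_has_derivative[OF S g that]])
  show "continuous_on S (\<lambda>x. f x * frechet_derivative g (at x) h + frechet_derivative f (at x) h * g x)" for h
    by (intro continuous_on_add continuous_on_mult C1_on_continuous_on[OF S f] C1_on_continuous_on[OF S g]
        C1_onD(2)[OF S f] C1_onD(2)[OF S g])
qed

lemma C1_on_sum:
  fixes f :: "'i \<Rightarrow> 'a::euclidean_space \<Rightarrow> real"
  assumes S: "open S" and f: "\<And>i. i \<in> I \<Longrightarrow> Ck_on 1 (f i) S"
  shows "Ck_on 1 (\<lambda>x. \<Sum>i\<in>I. f i x) S"
proof (rule C1_onI[OF S])
  show "((\<lambda>x. \<Sum>i\<in>I. f i x) has_derivative (\<lambda>h. \<Sum>i\<in>I. frechet_derivative (f i) (at x) h)) (at x)"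
    if "x \<in> S" for x
    by (rule has_derivative_sum) (rule C1_on_has_derivative[OF S f that])
  show "continuous_on S (\<lambda>x. \<Sum>i\<in>I. frechet_derivative (f i) (at x) h)" for h
    by (rule continuous_on_sum) (rule C1_onD(2)[OF S f])
qed

lemma C1_on_inverse:
  fixes f :: "'a::euclidean_space \<Rightarrow> real"
  assumes S: "open S" and f: "Ck_on 1 f S" and 0: "\<And>x. x \<in> S \<Longrightarrow> f x \<noteq> 0"
  shows "Ck_on 1 (\<lambda>x. inverse (f x)) S"
proof (rule C1_onI[OF S])
  show "((\<lambda>x. inverse (f x)) has_derivative
      (\<lambda>h. - (inverse (f x) * frechet_derivative f (at x) h * inverse (f x)))) (at x)" if "x \<in> S" for x
    by (rule Deriv.has_derivative_inverse[OF 0[OF that] C1_on_has_derivative[OF S f that]])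
  show "continuous_on S (\<lambda>x. - (inverse (f x) * frechet_derivative f (at x) h * inverse (f x)))" for h
    by (intro continuous_on_minus continuous_on_mult continuous_on_inverse C1_on_continuous_on[OF S f]
        C1_onD(2)[OF S f]) (use 0 in auto)
qed

lemma C1_on_inner_left:
  fixes f :: "'a::euclidean_space \<Rightarrow> 'b::euclidean_space"
  assumes S: "open S" and f: "Ck_on 1 f S"
  shows "Ck_on 1 (\<lambda>x. f x \<bullet> b) S"
proof (rule C1_onI[OF S])
  show "((\<lambda>x. f x \<bullet> b) has_derivative (\<lambda>h. frechet_derivative f (at x) h \<bullet> b)) (at x)" if "x \<in> S" for x
    by (rule has_derivative_inner_left[OF C1_on_has_derivative[OF S f that]])
  show "continuous_on S (\<lambda>x. frechet_derivative f (at x) h \<bullet> b)" for h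
    by (intro continuous_on_inner continuous_on_const C1_onD(2)[OF S f])
qed

text \<open>Uniform continuity of the derivative on a compact set makes the first-order remainder
  uniformly small there.\<close>

lemma C1_uniformly_differentiable:
  fixes f :: "'a::euclidean_space \<Rightarrow> 'b::real_normed_vector"
  assumes "open S" "Ck_on 1 f S" "compact K" "convex K" "K \<subseteq> S" "0 < \<eta>"
  obtains \<delta> where "0 < \<delta>" "\<And>x y. x \<in> K \<Longrightarrow> y \<in> K \<Longrightarrow> norm (y - x) < \<delta> \<Longrightarrow>
      norm (f y - f x - frechet_derivative f (at x) (y - x)) \<le> \<eta> * norm (y - x)"
proof -
  let ?D = "\<lambda>x. frechet_derivative f (at x)"
  have "\<exists>\<delta>>0. \<forall>x\<in>K. \<forall>y\<in>K. dist y x < \<delta> \<longrightarrow> dist (?D y b) (?D x b) < \<eta> / DIM('a)" for b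
  proof -
    have "uniformly_continuous_on K (\<lambda>x. ?D x b)"
      by (intro compact_uniformly_continuous continuous_on_subset[OF C1_onD(2)[OF assms(1,2)]] assms)
    moreover have "0 < \<eta> / DIM('a)" using assms(6) by simp
    ultimately show ?thesis unfolding uniformly_continuous_on_def by blast
  qed
  then obtain \<delta>0 where \<delta>0: "\<And>b. \<delta>0 b > 0"
    "\<And>b x y. x \<in> K \<Longrightarrow> y \<in> K \<Longrightarrow> dist y x < \<delta>0 b \<Longrightarrow> dist (?D y b) (?D x b) < \<eta> / DIM('a)"
    by metis
  define \<delta> where "\<delta> = Min (\<delta>0 ` Basis)"
  have "\<delta> > 0" unfolding \<delta>_def using \<delta>0(1) by (subst Min_gr_iff) auto
  moreover have "norm (f y - f x - ?D x (y - x)) \<le> \<eta> * norm (y - x)"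
    if "x \<in> K" "y \<in> K" "norm (y - x) < \<delta>" for x y
  proof -
    have seg: "x + t *\<^sub>R (y - x) \<in> closed_segment x y" if "t \<in> {0..1}" for t
      using that by (auto simp: closed_segment_def algebra_simps intro!: exI[of _ t])
    have sub: "closed_segment x y \<subseteq> K"
      using assms(4) that by (simp add: closed_segment_subset)
    have on: "onorm (?D z - ?D x) \<le> \<eta>" if z: "z \<in> closed_segment x y" for z
    proof (rule onorm_le)
      fix h
      have zK: "z \<in> K" using z sub by auto
      have dz: "dist z x < \<delta>"
      proof -
        have "norm (z - x) \<le> norm (y - x)" using z by (simp add: segment_bound1)
        then show ?thesis using \<open>norm (y - x) < \<delta>\<close> by (simp add: dist_norm)
      qed
      have diffs: "f differentiable at z" "f differentiable at x"
        using assms(5) zK \<open>x \<in> K\<close> by (auto intro!: C1_onD(1)[OF assms(1,2)])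
      have "(?D z - ?D x) h = (\<Sum>b\<in>Basis. (h \<bullet> b) *\<^sub>R (?D z b - ?D x b))"
        using linear_frechet_derivative_expand[OF diffs(1), of h] linear_frechet_derivative_expand[OF diffs(2), of h]
        by (simp add: scaleR_diff_right sum_subtractf)
      also have "norm \<dots> \<le> (\<Sum>b\<in>(Basis::'a set). norm h * (\<eta> / DIM('a)))"
      proof (rule sum_norm_le)
        fix b :: 'a assume b: "b \<in> Basis"
        have "dist z x < \<delta>0 b" using dz b unfolding \<delta>_def by (subst (asm) Min_gr_iff) auto
        then have "norm (?D z b - ?D x b) \<le> \<eta> / DIM('a)"
          using \<delta>0(2)[OF \<open>x \<in> K\<close> zK] by (simp add: dist_norm less_imp_le)
        then show "norm ((h \<bullet> b) *\<^sub>R (?D z b - ?D x b)) \<le> norm h * (\<eta> / DIM('a))"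
          using b by (simp add: Basis_le_norm mult_mono del: times_divide_eq_right)
      qed
      also have "\<dots> = \<eta> * norm h" by simp
      finally show "norm ((?D z - ?D x) h) \<le> \<eta> * norm h" .
    qed
    have "norm (f y - f x - ?D x (y - x)) \<le> norm (y - x) * \<eta>"
    proof (rule differentiable_bound_linearization[where S = "closed_segment x y" and f' = ?D])
      show "(f has_derivative ?D z) (at z within closed_segment x y)" if "z \<in> closed_segment x y" for z
        using that sub assms by (intro has_derivative_at_withinI[OF C1_on_has_derivative[OF assms(1,2)]]) auto
    qed (use seg on in auto)
    then show ?thesis by (simp add: mult.commute)
  qed
  ultimately show ?thesis by (rule that)
qed

text \<open>A map that is approximated to first order by linear maps, uniformly in the base point and
  with arbitrary precision, is continuously differentiable: the approximating linear maps form a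
  Cauchy sequence, and the limit inherits the uniformity.\<close>

lemma C1_on_if_uniformly_nearly_linear:
  fixes F :: "'a::euclidean_space \<Rightarrow> 'b::banach"
  assumes G: "open G" and cont: "continuous_on G F"
    and approx: "\<And>\<eta>. 0 < \<eta> \<Longrightarrow> \<exists>\<delta>>0. \<forall>x\<in>G. \<exists>L. linear L \<and>
      (\<forall>h. norm h < \<delta> \<longrightarrow> x + h \<in> G \<longrightarrow> norm (F (x + h) - F x - L h) \<le> \<eta> * norm h)"
  shows "Ck_on 1 F G"
proof -
  define \<eta> where "\<eta> n = 1 / real (Suc n)" for n
  have \<eta>: "\<eta> n > 0" for n by (simp add: \<eta>_def)
  define P where "P n \<delta> x L \<longleftrightarrow> linear L \<and>
    (\<forall>h. norm h < \<delta> \<longrightarrow> x + h \<in> G \<longrightarrow> norm (F (x + h) - F x - L h) \<le> \<eta> n * norm h)" for n \<delta> x L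
  have "\<forall>n. \<exists>\<delta>>0. \<forall>x\<in>G. \<exists>L. P n \<delta> x L"
    unfolding P_def by (intro allI approx \<eta>)
  then obtain \<delta> where d: "\<And>n. \<delta> n > 0" and "\<And>n. \<forall>x\<in>G. \<exists>L. P n (\<delta> n) x L"
    by metis
  then have "\<exists>L. \<forall>x\<in>G. P n (\<delta> n) x (L x)" for n
    by (metis bchoice)
  then obtain L where "\<And>n x. x \<in> G \<Longrightarrow> P n (\<delta> n) x (L n x)"
    by metis
  then have L: "\<And>n x. x \<in> G \<Longrightarrow> linear (L n x)"
      "\<And>n x h. x \<in> G \<Longrightarrow> norm h < \<delta> n \<Longrightarrow> x + h \<in> G \<Longrightarrow> norm (F (x + h) - F x - L n x h) \<le> \<eta> n * norm h"
    unfolding P_def by blast+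
  have near: "\<exists>s>0. s * norm h < e \<and> x + s *\<^sub>R h \<in> G" if xG: "x \<in> G" and e: "e > 0" for x h and e :: real
  proof -
    obtain r where r: "r > 0" "ball x r \<subseteq> G" using openE[OF G xG] by blast
    define s where "s = min e r / (norm h + 1)"
    have s: "s > 0" using r e unfolding s_def by (intro divide_pos_pos add_nonneg_pos) auto
    have "s * norm h < s * (norm h + 1)" using s by simp
    also have "\<dots> = min e r" unfolding s_def by (simp add: add_nonneg_eq_0_iff)
    finally have sh: "s * norm h < min e r" .
    then have "x + s *\<^sub>R h \<in> ball x r" using s by (simp add: dist_norm)
    then show ?thesis using s sh r by auto
  qed
  have comp: "norm (L n x h - L m x h) \<le> (\<eta> n + \<eta> m) * norm h" if x: "x \<in> G" for n m x h
  proof -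
    obtain s where s: "s > 0" "s * norm h < min (\<delta> n) (\<delta> m)" "x + s *\<^sub>R h \<in> G"
      using near[OF x, of "min (\<delta> n) (\<delta> m)" h] d by auto
    let ?A = "F (x + s *\<^sub>R h) - F x"
    have "norm (?A - L n x (s *\<^sub>R h)) \<le> \<eta> n * norm (s *\<^sub>R h)"
      using s(1,2) by (intro L(2) x s(3)) simp
    moreover have "norm (?A - L m x (s *\<^sub>R h)) \<le> \<eta> m * norm (s *\<^sub>R h)"
      using s(1,2) by (intro L(2) x s(3)) simp
    moreover have "norm (L n x (s *\<^sub>R h) - L m x (s *\<^sub>R h)) \<le>
        norm (?A - L m x (s *\<^sub>R h)) + norm (?A - L n x (s *\<^sub>R h))"
      by (rule order.trans[OF _ norm_triangle_ineq4]) simp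
    ultimately have "norm (L n x (s *\<^sub>R h) - L m x (s *\<^sub>R h)) \<le> (\<eta> n + \<eta> m) * norm (s *\<^sub>R h)"
      unfolding distrib_right by linarith
    moreover have "L n x (s *\<^sub>R h) - L m x (s *\<^sub>R h) = s *\<^sub>R (L n x h - L m x h)"
      by (simp add: linear_cmul[OF L(1)[OF x]] scaleR_diff_right)
    ultimately have "s * norm (L n x h - L m x h) \<le> s * ((\<eta> n + \<eta> m) * norm h)"
      using s(1) by (simp add: mult.left_commute)
    then show ?thesis using s(1) by simp
  qed
  have \<eta>0: "\<eta> \<longlonglongrightarrow> 0" unfolding \<eta>_def by (rule LIMSEQ_Suc[OF lim_1_over_n])
  define D where "D x h = lim (\<lambda>n. L n x h)" for x h
  have lim: "(\<lambda>n. L n x h) \<longlonglongrightarrow> D x h" if x: "x \<in> G" for x h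
  proof -
    have "Cauchy (\<lambda>n. L n x h)"
    proof (rule metric_CauchyI)
      fix e :: real assume "e > 0"
      have "\<forall>\<^sub>F n in sequentially. \<eta> n * norm h < e / 2"
        using order_tendstoD(2)[OF tendsto_mult_left_zero[OF \<eta>0], of "e / 2"] \<open>e > 0\<close> by simp
      then obtain N where N: "\<And>n. n \<ge> N \<Longrightarrow> \<eta> n * norm h < e / 2"
        unfolding eventually_sequentially by auto
      have "dist (L m x h) (L n x h) < e" if "m \<ge> N" "n \<ge> N" for m n
        using comp[OF x, of m h n] N[OF that(1)] N[OF that(2)] by (simp add: dist_norm distrib_right)
      then show "\<exists>M. \<forall>m\<ge>M. \<forall>n\<ge>M. dist (L m x h) (L n x h) < e" by blast
    qed
    then show ?thesis unfolding D_def by (intro convergent_LIMSEQ_iff[THEN iffD1] Cauchy_convergent)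
  qed
  have linD: "linear (D x)" if x: "x \<in> G" for x
  proof (rule linearI)
    fix a b
    have "(\<lambda>n. L n x (a + b)) \<longlonglongrightarrow> D x a + D x b"
      using tendsto_add[OF lim[OF x, of a] lim[OF x, of b]] by (simp add: linear_add[OF L(1)[OF x]])
    then show "D x (a + b) = D x a + D x b" using lim[OF x] LIMSEQ_unique by blast
  next
    fix r b
    have "(\<lambda>n. L n x (r *\<^sub>R b)) \<longlonglongrightarrow> r *\<^sub>R D x b"
      using tendsto_scaleR[OF tendsto_const lim[OF x, of b]] by (simp add: linear_cmul[OF L(1)[OF x]])
    then show "D x (r *\<^sub>R b) = r *\<^sub>R D x b" using lim[OF x] LIMSEQ_unique by blast
  qed
  have LD: "norm (L n x h - D x h) \<le> \<eta> n * norm h" if x: "x \<in> G" for n x h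
  proof (rule LIMSEQ_le)
    show "(\<lambda>m. norm (L n x h - L m x h)) \<longlonglongrightarrow> norm (L n x h - D x h)"
      by (intro tendsto_intros lim x)
    have "(\<lambda>m. (\<eta> n + \<eta> m) * norm h) \<longlonglongrightarrow> (\<eta> n + 0) * norm h" by (intro tendsto_intros \<eta>0)
    then show "(\<lambda>m. (\<eta> n + \<eta> m) * norm h) \<longlonglongrightarrow> \<eta> n * norm h" by simp
  qed (use comp[OF x] in auto)
  have FD: "norm (F (x + h) - F x - D x h) \<le> 2 * \<eta> n * norm h"
    if "x \<in> G" "norm h < \<delta> n" "x + h \<in> G" for n x h
  proof -
    have "norm (F (x + h) - F x - D x h) \<le> norm (F (x + h) - F x - L n x h) + norm (L n x h - D x h)"
      using norm_triangle_ineq[of "F (x + h) - F x - L n x h" "L n x h - D x h"] by simp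
    then show ?thesis using L(2)[OF that] LD[OF that(1), of n h] by simp
  qed
  have small: "\<exists>n. 2 * \<eta> n < e" if "e > 0" for e
    using order_tendstoD(2)[OF tendsto_mult[OF tendsto_const[of "2::real"] \<eta>0], of e] that
    unfolding eventually_sequentially by auto
  have der: "(F has_derivative D x) (at x)" if x: "x \<in> G" for x
    unfolding has_derivative_at_alt
  proof -
    show "bounded_linear (D x) \<and> (\<forall>e>0. \<exists>d>0. \<forall>y. norm (y - x) < d \<longrightarrow> norm (F y - F x - D x (y - x)) \<le> e * norm (y - x))"
    proof (intro conjI allI impI)
      show "bounded_linear (D x)" using linD[OF x] linear_conv_bounded_linear by blast
      fix e :: real assume "e > 0"
      then obtain n where n: "2 * \<eta> n < e" using small by blast
      obtain r where r: "r > 0" "ball x r \<subseteq> G" using openE[OF G x] by blast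
      have "norm (F y - F x - D x (y - x)) \<le> e * norm (y - x)" if "norm (y - x) < min r (\<delta> n)" for y
      proof -
        have "y \<in> G" using that r by (auto simp: dist_norm norm_minus_commute)
        then have "norm (F y - F x - D x (y - x)) \<le> 2 * \<eta> n * norm (y - x)"
          using FD[OF x, of "y - x" n] that by simp
        also have "\<dots> \<le> e * norm (y - x)" using n by (intro mult_right_mono) auto
        finally show ?thesis .
      qed
      then show "\<exists>d>0. \<forall>y. norm (y - x) < d \<longrightarrow> norm (F y - F x - D x (y - x)) \<le> e * norm (y - x)"
        using r d[of n] by (intro exI[of _ "min r (\<delta> n)"]) auto
    qed
  qed
  have contD: "continuous_on G (\<lambda>x. D x k)" for k
  proof (rule continuous_on_iff[THEN iffD2], intro ballI allI impI)
    fix x e assume x: "x \<in> G" and e: "(e::real) > 0"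
    obtain n where n: "2 * \<eta> n < e / (4 * (norm k + 1))" using small[of "e / (4 * (norm k + 1))"] e
      by (auto simp: add_nonneg_pos)
    obtain s where s: "s > 0" "s * norm k < \<delta> n" "x + s *\<^sub>R k \<in> G" using near[OF x d] by blast
    have "isCont F x" "isCont F (x + s *\<^sub>R k)"
      using cont x s G by (auto simp: continuous_on_eq_continuous_at)
    then have "isCont (\<lambda>y. F (y + s *\<^sub>R k) - F y) x"
      by (intro continuous_intros isCont_o2[of _ "\<lambda>y. y + s *\<^sub>R k" F]) auto
    then have "((\<lambda>y. F (y + s *\<^sub>R k) - F y) \<longlongrightarrow> F (x + s *\<^sub>R k) - F x) (at x)"
      by (simp add: isCont_def)
    then have "\<forall>\<^sub>F y in at x. dist (F (y + s *\<^sub>R k) - F y) (F (x + s *\<^sub>R k) - F x) < s * e / 4"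
      by (rule tendstoD) (use s(1) e in simp)
    moreover have "open ((\<lambda>y. y + s *\<^sub>R k) -` G)"
      using G by (intro continuous_open_vimage continuous_intros)
    then have "\<forall>\<^sub>F y in at x. y + s *\<^sub>R k \<in> G"
      using s(3) eventually_at_topological by blast
    moreover have close: "dist (D y k) (D x k) < e"
      if y: "y \<in> G" "y + s *\<^sub>R k \<in> G" and dy: "dist (F (y + s *\<^sub>R k) - F y) (F (x + s *\<^sub>R k) - F x) < s * e / 4" for y
    proof -
      let ?h = "s *\<^sub>R k"
      have "norm (F (x + ?h) - F x - D x ?h) \<le> 2 * \<eta> n * norm ?h" "norm (F (y + ?h) - F y - D y ?h) \<le> 2 * \<eta> n * norm ?h"
        using s(1,2) by (intro FD x y s(3), simp)+
      then have "norm (D y ?h - D x ?h) \<le> 4 * \<eta> n * norm ?h + s * e / 4"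
        using dy norm_triangle_ineq4[of "F (x + ?h) - F x - D x ?h" "F (y + ?h) - F y - D y ?h"]
          norm_triangle_ineq[of "F (x + ?h) - F x - D x ?h - (F (y + ?h) - F y - D y ?h)" "F (y + ?h) - F y - (F (x + ?h) - F x)"]
        by (simp add: dist_norm)
      moreover have "norm (D y ?h - D x ?h) = s * dist (D y k) (D x k)"
      proof -
        have "D y ?h - D x ?h = s *\<^sub>R (D y k - D x k)"
          by (simp add: linear_cmul[OF linD[OF x]] linear_cmul[OF linD[OF y(1)]] scaleR_diff_right)
        then show ?thesis using s(1) by (simp add: dist_norm)
      qed
      moreover have "4 * \<eta> n * norm ?h = s * (4 * \<eta> n * norm k)" using s(1) by simp
      moreover have "4 * \<eta> n * norm k \<le> e / 2"
      proof -
        have "2 * \<eta> n * (4 * (norm k + 1)) < e"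
          using n by (simp add: pos_less_divide_eq add_nonneg_pos)
        then show ?thesis using \<eta>[of n] by (simp add: algebra_simps)
      qed
      moreover have "s * (4 * \<eta> n * norm k) \<le> s * (e / 2)"
        using s(1) calculation(4) by (intro mult_left_mono) auto
      ultimately have "s * dist (D y k) (D x k) \<le> s * (e / 2) + s * e / 4"
        by linarith
      then have "s * dist (D y k) (D x k) \<le> s * (e / 2 + e / 4)"
        by (simp add: algebra_simps)
      then show ?thesis using s(1) e by simp
    qed
    ultimately have "\<forall>\<^sub>F y in at x. y \<in> G \<longrightarrow> dist (D y k) (D x k) < e"
      by eventually_elim (use close in blast)
    then show "\<exists>d>0. \<forall>x'\<in>G. dist x' x < d \<longrightarrow> dist (D x' k) (D x k) < e"
      unfolding eventually_at using e by (auto, metis dist_self)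
  qed
  show ?thesis by (rule C1_onI[OF G der contD])
qed

lemma norm_increment_le:
  fixes f :: "real \<Rightarrow> 'a::real_normed_vector"
  assumes f: "\<And>s. s \<in> closed_segment a b \<Longrightarrow> (f has_vector_derivative f' s) (at s)"
    and B: "\<And>s. s \<in> closed_segment a b \<Longrightarrow> norm (f' s) \<le> B"
  shows "norm (f b - f a) \<le> B * \<bar>b - a\<bar>"
proof -
  have d: "(f has_derivative (\<lambda>h. h *\<^sub>R f' s)) (at s within closed_segment a b)"
    if "s \<in> closed_segment a b" for s
    using f[OF that] unfolding has_vector_derivative_def by (rule has_derivative_at_withinI)
  have on: "onorm (\<lambda>h. h *\<^sub>R f' s) \<le> B" if s: "s \<in> closed_segment a b" for s
  proof (rule onorm_le)
    fix h :: real
    show "norm (h *\<^sub>R f' s) \<le> B * norm h" using B[OF s] by (simp add: mult.commute[of B] mult_left_mono)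
  qed
  from differentiable_bound[OF convex_closed_segment d on, of b a]
  show ?thesis by simp
qed

lemma C1_derivative_bounded_on_compact:
  fixes f :: "'a::euclidean_space \<Rightarrow> 'b::real_normed_vector"
  assumes "open S" "Ck_on 1 f S" "compact K" "K \<subseteq> S"
  obtains L where "0 \<le> L" "\<And>x. x \<in> K \<Longrightarrow> onorm (frechet_derivative f (at x)) \<le> L"
proof -
  let ?D = "\<lambda>x. frechet_derivative f (at x)"
  have "\<exists>M. \<forall>x\<in>K. norm (?D x b) \<le> M" for b
  proof -
    have "bounded ((\<lambda>x. ?D x b) ` K)"
      by (intro compact_imp_bounded compact_continuous_image
          continuous_on_subset[OF C1_onD(2)[OF assms(1,2)] assms(4)] assms(3))
    then show ?thesis unfolding bounded_iff by auto
  qed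
  then obtain M where M: "\<And>b x. x \<in> K \<Longrightarrow> norm (?D x b) \<le> M b" by metis
  define L where "L = (\<Sum>b\<in>(Basis::'a set). \<bar>M b\<bar>)"
  have "onorm (?D x) \<le> L" if x: "x \<in> K" for x
  proof (rule onorm_le)
    fix h
    have d: "f differentiable at x" using x assms(4) by (intro C1_onD(1)[OF assms(1,2)]) auto
    have "norm (?D x h) \<le> (\<Sum>b\<in>(Basis::'a set). \<bar>M b\<bar> * norm h)"
      unfolding linear_frechet_derivative_expand[OF d, of h]
    proof (rule sum_norm_le)
      fix b :: 'a assume "b \<in> Basis"
      moreover have "norm (?D x b) \<le> \<bar>M b\<bar>" using M[OF x, of b] by linarith
      ultimately show "norm ((h \<bullet> b) *\<^sub>R ?D x b) \<le> \<bar>M b\<bar> * norm h"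
        by (simp add: mult.commute[of "\<bar>M b\<bar>"] mult_mono Basis_le_norm)
    qed
    then show "norm (?D x h) \<le> L * norm h" by (simp add: L_def sum_distrib_right)
  qed
  moreover have "0 \<le> L" unfolding L_def by (simp add: sum_nonneg)
  ultimately show thesis using that by blast
qed

section \<open>Dependence of solutions on the initial value\<close>

text \<open>Over a time interval so short that \<open>L \<tau> \<le> 1/2\<close> the growth estimate for \<open>\<bar>w'\<bar> \<le> L\<bar>w\<bar> + c\<close>
  needs no exponential: the maximum \<open>m\<close> of \<open>\<bar>w\<bar>\<close> satisfies \<open>m \<le> \<bar>w 0\<bar> + \<tau>(L m + c)\<close>.\<close>

lemma short_time_growth_bound:
  fixes w :: "real \<Rightarrow> 'a::real_normed_vector"
  assumes w: "\<And>t. \<bar>t\<bar> \<le> \<tau> \<Longrightarrow> (w has_vector_derivative w' t) (at t)"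
    and bd: "\<And>t. \<bar>t\<bar> \<le> \<tau> \<Longrightarrow> norm (w' t) \<le> L * norm (w t) + c"
    and "0 \<le> L" "0 \<le> c" "L * \<tau> \<le> 1 / 2" "\<bar>t\<bar> \<le> \<tau>"
  shows "norm (w t) \<le> 2 * norm (w 0) + 2 * \<tau> * c"
proof -
  have T: "{-\<tau>..\<tau>} = {t. \<bar>t\<bar> \<le> \<tau>}" by auto
  have cont: "continuous_on {-\<tau>..\<tau>} (\<lambda>t. norm (w t))"
    using w unfolding T by (intro continuous_intros continuous_at_imp_continuous_on)
      (auto intro: has_vector_derivative_continuous)
  have ne: "{-\<tau>..\<tau>} \<noteq> {}" using assms(6) by auto
  obtain s where sT: "s \<in> {-\<tau>..\<tau>}" and *: "\<forall>t\<in>{-\<tau>..\<tau>}. norm (w t) \<le> norm (w s)"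
    using continuous_attains_sup[OF compact_Icc ne cont] by blast
  have s: "\<bar>s\<bar> \<le> \<tau>" using sT unfolding T by simp
  have max: "norm (w t) \<le> norm (w s)" if "\<bar>t\<bar> \<le> \<tau>" for t
    using bspec[OF *, of t] that unfolding T by simp
  have "norm (w s - w 0) \<le> (L * norm (w s) + c) * \<bar>s - 0\<bar>"
  proof (rule norm_increment_le)
    fix r assume "r \<in> closed_segment 0 s"
    then have r: "\<bar>r\<bar> \<le> \<tau>" using s by (auto simp: closed_segment_eq_real_ivl split: if_splits)
    show "(w has_vector_derivative w' r) (at r)" by (rule w[OF r])
    show "norm (w' r) \<le> L * norm (w s) + c"
      using bd[OF r] mult_left_mono[OF max[OF r] \<open>0 \<le> L\<close>] by simp
  qed
  also have "\<dots> \<le> (L * norm (w s) + c) * \<tau>"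
    using s assms by (intro mult_left_mono) auto
  also have "\<dots> = (L * \<tau>) * norm (w s) + c * \<tau>" by (simp add: algebra_simps)
  also have "\<dots> \<le> 1 / 2 * norm (w s) + c * \<tau>"
    using assms(5) by (intro add_right_mono mult_right_mono) auto
  finally have "norm (w s) \<le> 2 * norm (w 0) + 2 * \<tau> * c"
    using norm_triangle_sub[of "w s" "w 0"] by (simp add: algebra_simps)
  then show ?thesis using max[OF assms(6)] by linarith
qed

text \<open>The derivative of \<open>y t\<close> is found without solving the variational equation: to first order, the
  difference of two solutions solves it, so up to a small relative error the difference belonging
  to the displacement \<open>h\<close> is the linear combination of those belonging to displacements
  \<open>\<epsilon> b\<close> of fixed small size along the basis vectors.\<close>

lemma C1_dependence_on_initial_value:
  fixes f :: "'a::euclidean_space \<Rightarrow> 'a"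
  assumes S: "open S" and f: "Ck_on 1 f S" and K: "compact K" "convex K" "K \<subseteq> S" and G: "open G"
    and y0: "\<And>x. x \<in> G \<Longrightarrow> y 0 x = x"
    and yK: "\<And>x t. x \<in> G \<Longrightarrow> \<bar>t\<bar> \<le> \<tau> \<Longrightarrow> y t x \<in> K"
    and ode: "\<And>x t. x \<in> G \<Longrightarrow> \<bar>t\<bar> \<le> \<tau> \<Longrightarrow> ((\<lambda>s. y s x) has_vector_derivative f (y t x)) (at t)"
    and L: "0 \<le> L" "\<And>x. x \<in> K \<Longrightarrow> onorm (frechet_derivative f (at x)) \<le> L"
    and \<tau>: "L * \<tau> \<le> 1 / 2" and t: "\<bar>t\<bar> \<le> \<tau>"
  shows "Ck_on 1 (y t) G"
proof -
  let ?D = "\<lambda>x. frechet_derivative f (at x)"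
  have der: "(f has_derivative ?D x) (at x)" if "x \<in> K" for x
    using that K(3) by (intro C1_on_has_derivative[OF S f]) auto
  have Dn: "norm (?D x h) \<le> L * norm h" if "x \<in> K" for x h
    using onorm[OF has_derivative_bounded_linear[OF der[OF that]], of h] L(2)[OF that]
    by (meson mult_right_mono norm_ge_zero order_trans)
  have flip: "norm (f u - f v) \<le> L * norm (u - v)" if "u \<in> K" "v \<in> K" for u v
    by (rule differentiable_bound[OF K(2) has_derivative_at_withinI[OF der] L(2) that])
  have lip: "norm (y t u - y t v) \<le> 2 * norm (u - v)" if "u \<in> G" "v \<in> G" "\<bar>t\<bar> \<le> \<tau>" for u v t
    using short_time_growth_bound[of \<tau> "\<lambda>t. y t u - y t v" "\<lambda>t. f (y t u) - f (y t v)" L 0 t]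
      that y0 L(1) \<tau> flip[OF yK yK] ode by (simp add: has_vector_derivative_diff)
  have "continuous_on G (y t)"
    by (rule lipschitz_on_continuous_on[of 2]) (use lip t in \<open>auto intro!: lipschitz_onI simp: dist_norm\<close>)
  then show ?thesis
  proof (rule C1_on_if_uniformly_nearly_linear[OF G])
    fix \<eta>' :: real assume \<eta>': "0 < \<eta>'"
    have \<tau>0: "0 \<le> \<tau>" using t by simp
    \<comment> \<open>The growth bound turns the remainder \<open>2 \<eta> (1 + DIM('a)) \<bar>h\<bar>\<close> below into \<open>2 \<tau>\<close> times that;
      \<open>\<tau> + 1\<close> instead of \<open>\<tau>\<close> keeps \<open>m\<close> positive for \<open>\<tau> = 0\<close>.\<close>
    define m where "m = 4 * (\<tau> + 1) * (1 + DIM('a))"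
    have m: "m > 0" unfolding m_def using \<tau>0 by simp
    define \<eta> where "\<eta> = \<eta>' / m"
    have \<eta>: "\<eta> > 0" unfolding \<eta>_def using \<eta>' m by simp
    obtain \<delta> where \<delta>: "0 < \<delta>" "\<And>u v. u \<in> K \<Longrightarrow> v \<in> K \<Longrightarrow> norm (v - u) < \<delta> \<Longrightarrow>
      norm (f v - f u - ?D u (v - u)) \<le> \<eta> * norm (v - u)"
      using C1_uniformly_differentiable[OF S f K \<eta>] by blast
    have rem: "norm (f (y s (x + h)) - f (y s x) - ?D (y s x) (y s (x + h) - y s x)) \<le> 2 * \<eta> * norm h"
      if "x \<in> G" "x + h \<in> G" "norm h < \<delta> / 2" "\<bar>s\<bar> \<le> \<tau>" for x h s
    proof -
      have l: "norm (y s (x + h) - y s x) \<le> 2 * norm h" using lip[OF that(2,1,4)] by simp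
      then have "norm (y s (x + h) - y s x) < \<delta>" using that(3) by linarith
      then have "norm (f (y s (x + h)) - f (y s x) - ?D (y s x) (y s (x + h) - y s x))
          \<le> \<eta> * norm (y s (x + h) - y s x)"
        by (rule \<delta>(2)[OF yK[OF that(1,4)] yK[OF that(2,4)]])
      also have "\<dots> \<le> \<eta> * (2 * norm h)" using \<eta> l by (intro mult_left_mono) auto
      finally show ?thesis by simp
    qed
    show "\<exists>\<delta>>0. \<forall>x\<in>G. \<exists>L. linear L \<and>
      (\<forall>h. norm h < \<delta> \<longrightarrow> x + h \<in> G \<longrightarrow> norm (y t (x + h) - y t x - L h) \<le> \<eta>' * norm h)"
    proof (intro exI[of _ "\<delta> / 2"] conjI ballI)
      fix x assume x: "x \<in> G"
      obtain r where r: "r > 0" "ball x r \<subseteq> G" using openE[OF G x] by blast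
      define \<epsilon> where "\<epsilon> = min r \<delta> / 4"
      have \<epsilon>: "\<epsilon> > 0" "\<epsilon> < \<delta> / 2" "\<epsilon> < r" unfolding \<epsilon>_def using r \<delta> by auto
      have \<epsilon>G: "x + \<epsilon> *\<^sub>R b \<in> G" if "b \<in> Basis" for b
        using r(2) \<epsilon> that by (auto simp: dist_norm subset_iff)
      define z where "z s h = y s (x + h) - y s x" for s h
      define M where "M s h = (\<Sum>b\<in>Basis. ((h \<bullet> b) / \<epsilon>) *\<^sub>R z s (\<epsilon> *\<^sub>R b))" for s h
      have "linear (M t)"
        unfolding M_def by (intro linearI)
          (simp_all add: inner_add_left add_divide_distrib scaleR_add_left sum.distrib scaleR_sum_right)
      moreover have "norm (y t (x + h) - y t x - M t h) \<le> \<eta>' * norm h"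
        if h: "norm h < \<delta> / 2" "x + h \<in> G" for h
      proof -
        define z' where "z' s h = f (y s (x + h)) - f (y s x)" for s h
        have dz: "((\<lambda>s. z s k) has_vector_derivative z' s k) (at s)" if "x + k \<in> G" "\<bar>s\<bar> \<le> \<tau>" for k s
          unfolding z_def z'_def using x that by (intro has_vector_derivative_diff ode)
        have remz: "norm (z' s k - ?D (y s x) (z s k)) \<le> 2 * \<eta> * norm k"
          if "x + k \<in> G" "norm k < \<delta> / 2" "\<bar>s\<bar> \<le> \<tau>" for s k
          unfolding z_def z'_def by (rule rem[OF x that])
        define w where "w s = z s h - M s h" for s
        define w' where "w' s = z' s h - (\<Sum>b\<in>Basis. ((h \<bullet> b) / \<epsilon>) *\<^sub>R z' s (\<epsilon> *\<^sub>R b))" for s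
        have "norm (w t) \<le> 2 * norm (w 0) + 2 * \<tau> * (2 * \<eta> * (1 + DIM('a)) * norm h)"
        proof (rule short_time_growth_bound[where w = w and w' = w', OF _ _ L(1) _ \<tau> t])
          fix s assume s: "\<bar>s\<bar> \<le> \<tau>"
          show "(w has_vector_derivative w' s) (at s)"
            unfolding w_def M_def w'_def using s h(2) \<epsilon>G
            by (auto intro!: derivative_eq_intros dz)
          have lin: "linear (?D (y s x))"
            using has_derivative_linear[OF der[OF yK[OF x s]]] .
          have "w' s - ?D (y s x) (w s) = (z' s h - ?D (y s x) (z s h))
              - (\<Sum>b\<in>Basis. ((h \<bullet> b) / \<epsilon>) *\<^sub>R (z' s (\<epsilon> *\<^sub>R b) - ?D (y s x) (z s (\<epsilon> *\<^sub>R b))))"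
            unfolding w_def w'_def M_def
            by (simp add: linear_diff[OF lin] linear_sum[OF lin] linear_cmul[OF lin] scaleR_diff_right sum_subtractf)
          also have "norm \<dots> \<le> 2 * \<eta> * norm h + (\<Sum>b\<in>(Basis::'a set). 2 * \<eta> * norm h)"
          proof (rule order.trans[OF norm_triangle_ineq4 add_mono[OF _ sum_norm_le]])
            show "norm (z' s h - ?D (y s x) (z s h)) \<le> 2 * \<eta> * norm h" by (rule remz[OF h(2,1) s])
            fix b :: 'a assume b: "b \<in> Basis"
            have "norm (z' s (\<epsilon> *\<^sub>R b) - ?D (y s x) (z s (\<epsilon> *\<^sub>R b))) \<le> 2 * \<eta> * \<epsilon>"
              using remz[OF \<epsilon>G[OF b] _ s] \<epsilon> b by simp
            then have "\<bar>h \<bullet> b\<bar> / \<epsilon> * norm (z' s (\<epsilon> *\<^sub>R b) - ?D (y s x) (z s (\<epsilon> *\<^sub>R b))) \<le> norm h / \<epsilon> * (2 * \<eta> * \<epsilon>)"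
              using b \<epsilon> by (intro mult_mono divide_right_mono Basis_le_norm) auto
            then show "norm (((h \<bullet> b) / \<epsilon>) *\<^sub>R (z' s (\<epsilon> *\<^sub>R b) - ?D (y s x) (z s (\<epsilon> *\<^sub>R b)))) \<le> 2 * \<eta> * norm h"
              using \<epsilon> by (simp add: mult.commute)
          qed
          also have "\<dots> = 2 * \<eta> * (1 + DIM('a)) * norm h" by (simp add: algebra_simps)
          finally have "norm (w' s - ?D (y s x) (w s)) \<le> 2 * \<eta> * (1 + DIM('a)) * norm h" .
          then show "norm (w' s) \<le> L * norm (w s) + 2 * \<eta> * (1 + DIM('a)) * norm h"
            using Dn[OF yK[OF x s], of "w s"] norm_triangle_sub[of "w' s" "?D (y s x) (w s)"] by linarith
        next
          show "0 \<le> 2 * \<eta> * (1 + DIM('a)) * norm h" using \<eta> by simp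
        qed
        moreover have "w 0 = 0"
        proof -
          have "z 0 k = k" if "x + k \<in> G" for k unfolding z_def using x that by (simp add: y0)
          then have "M 0 h = (\<Sum>b\<in>Basis. (h \<bullet> b) *\<^sub>R b)" "z 0 h = h"
            unfolding M_def using \<epsilon> \<epsilon>G h(2) by auto
          then show ?thesis unfolding w_def by (simp add: euclidean_representation)
        qed
        ultimately have "norm (w t) \<le> (4 * \<tau> * (1 + DIM('a))) * \<eta> * norm h" by (simp add: algebra_simps)
        also have "\<dots> \<le> m * \<eta> * norm h"
          unfolding m_def using \<eta> \<tau>0 by (intro mult_right_mono) auto
        also have "\<dots> = \<eta>' * norm h" using m by (simp add: \<eta>_def)
        finally show ?thesis unfolding w_def z_def .
      qed
      ultimately show "\<exists>L. linear L \<and> (\<forall>h. norm h < \<delta> / 2 \<longrightarrow> x + h \<in> G \<longrightarrow>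
          norm (y t (x + h) - y t x - L h) \<le> \<eta>' * norm h)" by blast
    qed (use \<delta> in simp)
  qed
qed

section \<open>Naturality of the exterior derivative\<close>

text \<open>A second derivative at a single point is symmetric, without continuity: by the mean value theorem
  the second difference over a small parallelogram with sides \<open>s u\<close> and \<open>s v\<close> is
  \<open>s\<^sup>2 B u v + o(s\<^sup>2)\<close>, and it does not change when \<open>u\<close> and \<open>v\<close> are exchanged.\<close>

lemma second_difference_limit:
  fixes g :: "'a::real_normed_vector \<Rightarrow> real"
  assumes S: "open S" "x0 \<in> S" and g: "\<And>x. x \<in> S \<Longrightarrow> (g has_derivative g' x) (at x)"
    and B: "((\<lambda>x. g' x u) has_derivative B) (at x0)"
  shows "((\<lambda>s. (g (x0 + s *\<^sub>R u + s *\<^sub>R v) - g (x0 + s *\<^sub>R u) - g (x0 + s *\<^sub>R v) + g x0) / s\<^sup>2)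
    \<longlongrightarrow> B v) (at_right 0)"
proof (rule tendstoI)
  fix e :: real assume e: "0 < e"
  define m where "m = 2 * (norm u + norm v + 1)"
  have m: "m > 0" unfolding m_def by (simp add: add_nonneg_pos)
  obtain r where r: "r > 0" "ball x0 r \<subseteq> S" using openE[OF S] by blast
  have lB: "linear B" using B has_derivative_linear by blast
  obtain \<delta> where \<delta>: "\<delta> > 0" "\<And>y. norm (y - x0) < \<delta> \<Longrightarrow>
      \<bar>g' y u - g' x0 u - B (y - x0)\<bar> \<le> e / (2 * m) * norm (y - x0)"
    using B e m unfolding has_derivative_at_alt by (metis divide_pos_pos mult_pos_pos real_norm_def zero_less_numeral)
  define s0 where "s0 = min r \<delta> / m"
  have s0: "s0 > 0" unfolding s0_def using r \<delta> m by simp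
  have bound: "dist ((g (x0 + s *\<^sub>R u + s *\<^sub>R v) - g (x0 + s *\<^sub>R u) - g (x0 + s *\<^sub>R v) + g x0) / s\<^sup>2) (B v) < e"
    if s: "0 < s" "s < s0" for s
  proof -
    have sm: "s * m < min r \<delta>" using s(2) m unfolding s0_def by (simp add: pos_less_divide_eq)
    have small: "norm (k *\<^sub>R u + l *\<^sub>R v) \<le> s * m / 2" if "0 \<le> k" "k \<le> s" "0 \<le> l" "l \<le> s" for k l
    proof -
      have "norm (k *\<^sub>R u + l *\<^sub>R v) \<le> k * norm u + l * norm v"
        using that by (intro order.trans[OF norm_triangle_ineq]) simp
      also have "\<dots> \<le> s * norm u + s * norm v"
        using that by (intro add_mono mult_right_mono) auto
      also have "\<dots> \<le> s * m / 2" unfolding m_def using s by (simp add: algebra_simps)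
      finally show ?thesis .
    qed
    have near: "norm (k *\<^sub>R u + l *\<^sub>R v) < r" "norm (k *\<^sub>R u + l *\<^sub>R v) < \<delta>"
      if "0 \<le> k" "k \<le> s" "0 \<le> l" "l \<le> s" for k l
    proof -
      have "0 < s * m" using s m by simp
      then show "norm (k *\<^sub>R u + l *\<^sub>R v) < r" "norm (k *\<^sub>R u + l *\<^sub>R v) < \<delta>"
        using small[OF that] sm by linarith+
    qed
    have inS: "x0 + k *\<^sub>R u + l *\<^sub>R v \<in> S" if "0 \<le> k" "k \<le> s" "0 \<le> l" "l \<le> s" for k l
    proof -
      have "dist (x0 + (k *\<^sub>R u + l *\<^sub>R v)) x0 < r" using near(1)[OF that] by (simp add: dist_norm)
      then show ?thesis using r(2) by (auto simp: add.assoc dist_commute)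
    qed
    define \<psi> where "\<psi> k = g (x0 + k *\<^sub>R u + s *\<^sub>R v) - g (x0 + k *\<^sub>R u + 0 *\<^sub>R v)" for k
    have d\<psi>: "(\<psi> has_real_derivative g' (x0 + k *\<^sub>R u + s *\<^sub>R v) u - g' (x0 + k *\<^sub>R u + 0 *\<^sub>R v) u) (at k)"
      if k: "0 \<le> k" "k \<le> s" for k
    proof -
      have dg: "((\<lambda>k. g (x0 + k *\<^sub>R u + l *\<^sub>R v)) has_derivative (\<lambda>h. h * g' (x0 + k *\<^sub>R u + l *\<^sub>R v) u)) (at k)"
        if l: "0 \<le> l" "l \<le> s" for l
      proof -
        have 1: "((\<lambda>k. x0 + k *\<^sub>R u + l *\<^sub>R v) has_derivative (\<lambda>h. h *\<^sub>R u)) (at k)"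
          by (auto intro!: derivative_eq_intros)
        have 2: "(g has_derivative g' (x0 + k *\<^sub>R u + l *\<^sub>R v)) (at (x0 + k *\<^sub>R u + l *\<^sub>R v))"
          by (rule g[OF inS[OF k l]])
        show ?thesis
          using has_derivative_compose[OF 1 2] by (simp add: linear_cmul[OF has_derivative_linear[OF 2]])
      qed
      show ?thesis
        unfolding \<psi>_def has_field_derivative_def
        by (rule has_derivative_eq_rhs[OF has_derivative_diff[OF
              dg[OF less_imp_le[OF s(1)] order_refl] dg[OF order_refl less_imp_le[OF s(1)]]]])
          (simp add: fun_eq_iff algebra_simps)
    qed
    obtain k where k: "0 < k" "k < s"
      and mvt: "\<psi> s - \<psi> 0 = (s - 0) * (g' (x0 + k *\<^sub>R u + s *\<^sub>R v) u - g' (x0 + k *\<^sub>R u + 0 *\<^sub>R v) u)"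
      using MVT2[OF s(1) d\<psi>] by blast
    let ?p = "k *\<^sub>R u + s *\<^sub>R v" and ?q = "k *\<^sub>R u + 0 *\<^sub>R v"
    have p: "\<bar>g' (x0 + ?p) u - g' x0 u - B ?p\<bar> \<le> e / (2 * m) * norm ?p"
      using \<delta>(2)[of "x0 + ?p"] near(2)[of k s] k by simp
    have q: "\<bar>g' (x0 + ?q) u - g' x0 u - B ?q\<bar> \<le> e / (2 * m) * norm ?q"
      using \<delta>(2)[of "x0 + ?q"] near(2)[of k 0] k by simp
    have "B ?p - B ?q = s * B v"
      by (simp add: linear_add[OF lB] linear_cmul[OF lB])
    then have "\<bar>g' (x0 + ?p) u - g' (x0 + ?q) u - s * B v\<bar> \<le> e / (2 * m) * norm ?p + e / (2 * m) * norm ?q"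
      using p q by linarith
    also have "\<dots> \<le> e / (2 * m) * (s * m / 2) + e / (2 * m) * (s * m / 2)"
      using e m k small[of k s] small[of k 0] s by (intro add_mono mult_left_mono) auto
    also have "\<dots> = s * e / 2" using m by (simp add: field_simps)
    finally have "s * \<bar>g' (x0 + ?p) u - g' (x0 + ?q) u - s * B v\<bar> \<le> s * (s * e / 2)"
      using s by (intro mult_left_mono) auto
    also have "s * (s * e / 2) < s * s * e" using s e by simp
    finally have "s * \<bar>g' (x0 + ?p) u - g' (x0 + ?q) u - s * B v\<bar> < s * s * e" .
    moreover have "(\<psi> s - \<psi> 0) - s * s * B v = s * (g' (x0 + ?p) u - g' (x0 + ?q) u - s * B v)"
      unfolding mvt by (simp add: algebra_simps)
    ultimately have "\<bar>(\<psi> s - \<psi> 0) - s * s * B v\<bar> < s * s * e"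
      using s(1) by (simp only: abs_mult abs_of_pos)
    then have "\<bar>(\<psi> s - \<psi> 0) / (s * s) - B v\<bar> < e"
      using s by (simp add: field_simps abs_divide)
    moreover have "\<psi> s - \<psi> 0 = g (x0 + s *\<^sub>R u + s *\<^sub>R v) - g (x0 + s *\<^sub>R u) - g (x0 + s *\<^sub>R v) + g x0"
      unfolding \<psi>_def by simp
    ultimately show ?thesis by (simp add: dist_real_def power2_eq_square)
  qed
  then show "\<forall>\<^sub>F s in at_right 0. dist ((g (x0 + s *\<^sub>R u + s *\<^sub>R v) - g (x0 + s *\<^sub>R u)
      - g (x0 + s *\<^sub>R v) + g x0) / s\<^sup>2) (B v) < e"
    unfolding eventually_at_right[OF s0] using s0 by blast
qed

lemma second_derivative_at_point_symmetric:
  fixes g :: "'a::real_normed_vector \<Rightarrow> real"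
  assumes S: "open S" "x0 \<in> S" and g: "\<And>x. x \<in> S \<Longrightarrow> (g has_derivative g' x) (at x)"
    and B: "((\<lambda>x. g' x u) has_derivative Bu) (at x0)" "((\<lambda>x. g' x v) has_derivative Bv) (at x0)"
  shows "Bu v = Bv u"
proof (rule tendsto_unique[OF trivial_limit_at_right_real])
  show "((\<lambda>s. (g (x0 + s *\<^sub>R u + s *\<^sub>R v) - g (x0 + s *\<^sub>R u) - g (x0 + s *\<^sub>R v) + g x0) / s\<^sup>2)
    \<longlongrightarrow> Bu v) (at_right 0)"
    by (rule second_difference_limit[OF S g B(1)])
  have "x0 + s *\<^sub>R v + s *\<^sub>R u = x0 + s *\<^sub>R u + s *\<^sub>R v" for s by simp
  then show "((\<lambda>s. (g (x0 + s *\<^sub>R u + s *\<^sub>R v) - g (x0 + s *\<^sub>R u) - g (x0 + s *\<^sub>R v) + g x0) / s\<^sup>2)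
    \<longlongrightarrow> Bv u) (at_right 0)"
    using second_difference_limit[OF S g B(2), of u] by (simp add: algebra_simps)
qed

text \<open>At a zero of \<open>g\<close> the term \<open>f' g\<close> of the product rule is absent, so that continuity of \<open>f\<close> suffices.\<close>

lemma has_derivative_mult_vanishing:
  fixes f g :: "'a::real_normed_vector \<Rightarrow> real"
  assumes f: "isCont f x0" and g: "(g has_derivative g') (at x0)" "g x0 = 0"
  shows "((\<lambda>x. f x * g x) has_derivative (\<lambda>h. f x0 * g' h)) (at x0)"
  unfolding has_derivative_at_alt
proof (intro conjI allI impI)
  have lin: "bounded_linear g'" using g(1) by (rule has_derivative_bounded_linear)
  then show "bounded_linear (\<lambda>h. f x0 * g' h)" by (rule bounded_linear_const_mult)
  obtain K where K: "K > 0" "\<And>h. norm (g' h) \<le> norm h * K"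
    using bounded_linear.pos_bounded[OF lin] by blast
  fix e :: real assume e: "e > 0"
  define e1 where "e1 = min 1 (e / (2 * (\<bar>f x0\<bar> + 1 + K)))"
  have e1: "e1 > 0" "e1 \<le> 1" "e1 * (\<bar>f x0\<bar> + 1 + K) \<le> e"
  proof -
    have pos: "2 * (\<bar>f x0\<bar> + 1 + K) > 0" using K(1) by simp
    then show "e1 > 0" "e1 \<le> 1" using e unfolding e1_def by auto
    have "e1 * (2 * (\<bar>f x0\<bar> + 1 + K)) \<le> e"
      using pos by (simp add: e1_def pos_le_divide_eq[symmetric])
    then show "e1 * (\<bar>f x0\<bar> + 1 + K) \<le> e" using e by linarith
  qed
  obtain d1 where d1: "d1 > 0" "\<And>y. dist y x0 < d1 \<Longrightarrow> dist (f y) (f x0) < e1"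
    using f e1(1) unfolding continuous_at_eps_delta by metis
  obtain d2 where d2: "d2 > 0" "\<And>y. norm (y - x0) < d2 \<Longrightarrow>
      norm (g y - g x0 - g' (y - x0)) \<le> e1 * norm (y - x0)"
    using g(1) e1(1) unfolding has_derivative_at_alt by metis
  have "norm (f y * g y - f x0 * g x0 - f x0 * g' (y - x0)) \<le> e * norm (y - x0)"
    if y: "norm (y - x0) < min d1 d2" for y
  proof -
    let ?r = "g y - g' (y - x0)"
    have r: "\<bar>?r\<bar> \<le> e1 * norm (y - x0)" using d2(2)[of y] y g(2) by simp
    have fy: "\<bar>f y - f x0\<bar> \<le> e1" using d1(2)[of y] y by (simp add: dist_norm)
    have g'y: "\<bar>g' (y - x0)\<bar> \<le> K * norm (y - x0)" using K(2)[of "y - x0"] by (simp add: mult.commute)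
    have "f y * g y - f x0 * g x0 - f x0 * g' (y - x0) = f y * ?r + (f y - f x0) * g' (y - x0)"
      using g(2) by (simp add: algebra_simps)
    also have "\<bar>\<dots>\<bar> \<le> \<bar>f y\<bar> * \<bar>?r\<bar> + \<bar>f y - f x0\<bar> * \<bar>g' (y - x0)\<bar>"
      by (intro order.trans[OF abs_triangle_ineq]) (simp add: abs_mult)
    also have "\<dots> \<le> (\<bar>f x0\<bar> + 1) * (e1 * norm (y - x0)) + e1 * (K * norm (y - x0))"
      using fy e1 r g'y K(1) by (intro add_mono mult_mono) auto
    also have "\<dots> = (e1 * (\<bar>f x0\<bar> + 1 + K)) * norm (y - x0)" by (simp add: algebra_simps)
    also have "\<dots> \<le> e * norm (y - x0)" using e1(3) by (intro mult_right_mono) auto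
    finally show ?thesis by simp
  qed
  then show "\<exists>d>0. \<forall>y. norm (y - x0) < d \<longrightarrow>
      norm (f y * g y - f x0 * g x0 - f x0 * g' (y - x0)) \<le> e * norm (y - x0)"
    using d1(1) d2(1) by (intro exI[of _ "min d1 d2"]) auto
qed

text \<open>Since \<open>F\<close> is only \<open>C\<^sup>1\<close>, the pulled-back form \<open>b\<close> need not be differentiable, which is why this is
  assumed. To first order at \<open>y\<^sub>0 = F x\<^sub>0\<close>, the form \<open>a\<close> is the differential of the quadratic
  polynomial \<open>a y\<^sub>0 y + 1/2 A(y - y\<^sub>0, y - y\<^sub>0)\<close> plus the skew part of its derivative \<open>A\<close>. The
  pull-back of the first is the differential of a function, whose second derivative at \<open>x\<^sub>0\<close> is
  symmetric; the skew part vanishes at \<open>y\<^sub>0\<close>, so that differentiating its pull-back at \<open>x\<^sub>0\<close>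
  takes only one derivative of \<open>F\<close>.\<close>

lemma exterior_derivative_pullback_C1:
  fixes F :: "'a::euclidean_space \<Rightarrow> 'b::euclidean_space" and a :: "'b \<Rightarrow> 'b \<Rightarrow> real" and b :: "'a \<Rightarrow> 'a \<Rightarrow> real"
  assumes S: "open S" "x0 \<in> S" and F: "Ck_on 1 F S" and T: "open T" "F ` S \<subseteq> T"
    and lin: "\<And>y. y \<in> T \<Longrightarrow> linear (a y)"
    and A: "\<And>k. ((\<lambda>y. a y k) has_derivative (\<lambda>h. A h k)) (at (F x0))"
    and b: "\<And>x h. x \<in> S \<Longrightarrow> b x h = a (F x) (frechet_derivative F (at x) h)"
    and B: "\<And>k. ((\<lambda>x. b x k) has_derivative (\<lambda>h. B h k)) (at x0)"
  shows "B u v - B v u = A (frechet_derivative F (at x0) u) (frechet_derivative F (at x0) v)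
    - A (frechet_derivative F (at x0) v) (frechet_derivative F (at x0) u)"
proof -
  let ?y = "F x0"
  define D where "D x = frechet_derivative F (at x)" for x
  have dF: "(F has_derivative D x) (at x)" if "x \<in> S" for x
    unfolding D_def by (rule C1_on_has_derivative[OF S(1) F that])
  have yT: "?y \<in> T" using S T by auto
  have A1: "linear (\<lambda>h. A h k)" for k by (rule has_derivative_linear[OF A])
  have A2: "linear (A h)" for h
  proof (rule linearI)
    fix k l
    have "((\<lambda>y. a y (k + l)) has_derivative (\<lambda>h. A h k + A h l)) (at ?y)"
      by (rule has_derivative_transform_within_open[OF has_derivative_add[OF A A] T(1) yT])
        (simp add: linear_add[OF lin])
    from has_derivative_unique[OF A this] show "A h (k + l) = A h k + A h l" by meson
  next
    fix r k
    have "((\<lambda>y. a y (r *\<^sub>R k)) has_derivative (\<lambda>h. r * A h k)) (at ?y)"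
      by (rule has_derivative_transform_within_open[OF has_derivative_mult_right[OF A] T(1) yT])
        (simp add: linear_cmul[OF lin])
    from has_derivative_unique[OF A this] show "A h (r *\<^sub>R k) = r *\<^sub>R A h k" by (simp add: fun_eq_iff)
  qed
  have bilA: "bounded_bilinear A"
    using A1 A2 bilinear_conv_bounded_bilinear unfolding bilinear_def by blast
  \<comment> \<open>\<open>\<sigma>\<close> is what remains of \<open>a\<close> along \<open>F\<close> after the differential of the quadratic polynomial has
    been subtracted: it vanishes at \<open>x0\<close>, and its derivative there is the skew part of \<open>A\<close>
    along the derivative of \<open>F\<close>.\<close>
  define \<sigma> where "\<sigma> i x = a (F x) i - a ?y i - (A (F x - ?y) i + A i (F x - ?y)) / 2" for i x
  have d\<sigma>: "(\<sigma> i has_derivative (\<lambda>h. (A (D x0 h) i - A i (D x0 h)) / 2)) (at x0)" for i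
  proof -
    have "((\<lambda>x. a (F x) i) has_derivative (\<lambda>h. A (D x0 h) i)) (at x0)"
      by (rule has_derivative_compose[OF dF[OF S(2)] A])
    moreover have "((\<lambda>x. F x - ?y) has_derivative D x0) (at x0)"
      using has_derivative_diff[OF dF[OF S(2)] has_derivative_const[of ?y]] by simp
    then have "((\<lambda>x. A (F x - ?y) i) has_derivative (\<lambda>h. A (D x0 h) i)) (at x0)"
      "((\<lambda>x. A i (F x - ?y)) has_derivative (\<lambda>h. A i (D x0 h))) (at x0)"
      using bounded_linear.has_derivative[OF bounded_bilinear.bounded_linear_left[OF bilA]]
        bounded_linear.has_derivative[OF bounded_bilinear.bounded_linear_right[OF bilA]] by blast+
    ultimately show ?thesis
      unfolding \<sigma>_def by (auto intro!: derivative_eq_intros simp: field_simps)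
  qed
  define R where "R k x = (\<Sum>i\<in>Basis. (D x k \<bullet> i) * \<sigma> i x)" for k x
  have dR: "(R k has_derivative (\<lambda>h. (A (D x0 h) (D x0 k) - A (D x0 k) (D x0 h)) / 2)) (at x0)" for k
  proof -
    have "isCont (\<lambda>x. D x k) x0"
      using C1_onD(2)[OF S(1) F, of k] S unfolding D_def by (simp add: continuous_on_eq_continuous_at)
    then have "((\<lambda>x. (D x k \<bullet> i) * \<sigma> i x) has_derivative
        (\<lambda>h. (D x0 k \<bullet> i) * ((A (D x0 h) i - A i (D x0 h)) / 2))) (at x0)" for i
      by (intro has_derivative_mult_vanishing d\<sigma> continuous_intros)
        (simp_all add: \<sigma>_def bounded_bilinear.zero_left[OF bilA] bounded_bilinear.zero_right[OF bilA])
    from has_derivative_sum[OF this] have "(R k has_derivative (\<lambda>h. \<Sum>i\<in>Basis. (D x0 k \<bullet> i) * ((A (D x0 h) i - A i (D x0 h)) / 2))) (at x0)"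
      unfolding R_def .
    moreover have "(\<Sum>i\<in>Basis. (D x0 k \<bullet> i) * ((A (D x0 h) i - A i (D x0 h)) / 2))
        = (A (D x0 h) (D x0 k) - A (D x0 k) (D x0 h)) / 2" for h
      using linear_functional_expand[OF A2, of "D x0 h" "D x0 k"] linear_functional_expand[OF A1, of "D x0 k" "D x0 h"]
      by (simp add: right_diff_distrib sum_subtractf diff_divide_distrib sum_divide_distrib)
    ultimately show ?thesis by (simp only:)
  qed
  define G where "G x = a ?y (F x) + A (F x - ?y) (F x - ?y) / 2" for x
  define G' where "G' x k = a ?y (D x k) + (A (F x - ?y) (D x k) + A (D x k) (F x - ?y)) / 2" for x k
  have dG: "(G has_derivative G' x) (at x)" if x: "x \<in> S" for x
  proof -
    have "bounded_linear (a ?y)" using lin[OF yT] linear_conv_bounded_linear by blast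
    from bounded_linear.has_derivative[OF this dF[OF x]]
    have "((\<lambda>x. a ?y (F x)) has_derivative (\<lambda>h. a ?y (D x h))) (at x)" .
    moreover have "((\<lambda>x. F x - ?y) has_derivative D x) (at x)"
      using has_derivative_diff[OF dF[OF x] has_derivative_const[of ?y]] by simp
    then have "((\<lambda>x. A (F x - ?y) (F x - ?y)) has_derivative
        (\<lambda>h. A (F x - ?y) (D x h) + A (D x h) (F x - ?y))) (at x)"
      by (intro bounded_bilinear.FDERIV[OF bilA])
    ultimately show ?thesis
      unfolding G_def G'_def[abs_def] by (auto intro!: derivative_eq_intros)
  qed
  have G'_eq: "b x k - R k x = G' x k" if x: "x \<in> S" for x k
  proof -
    have FxT: "F x \<in> T" using x T by auto
    have "R k x = a (F x) (D x k) - G' x k"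
      unfolding R_def \<sigma>_def G'_def linear_functional_expand[OF lin[OF FxT], of "D x k"]
        linear_functional_expand[OF lin[OF yT], of "D x k"] linear_functional_expand[OF A2, of "F x - ?y" "D x k"]
        linear_functional_expand[OF A1, of "D x k" "F x - ?y"]
      by (simp add: algebra_simps sum_subtractf sum.distrib sum_divide_distrib add_divide_distrib)
    then show ?thesis by (simp add: b[OF x] D_def)
  qed
  have dG': "((\<lambda>x. G' x k) has_derivative
      (\<lambda>h. B h k - (A (D x0 h) (D x0 k) - A (D x0 k) (D x0 h)) / 2)) (at x0)" for k
    by (rule has_derivative_transform_within_open[OF has_derivative_diff[OF B dR] S G'_eq])
  show ?thesis
    using second_derivative_at_point_symmetric[OF S dG dG'[of u] dG'[of v]]
    unfolding D_def by (simp add: field_simps)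
qed

section \<open>Charts, tangent vectors and derivatives\<close>

lemma scaleR_fun_apply [simp]: "(r *\<^sub>R f) x = r *\<^sub>R f x"
  by (simp add: scaleR_fun_def)

locale smooth_atlas =
  fixes A :: "('m::t2_space) chart set"
  assumes atlas: "oriented_smooth_atlas A"
begin

lemma
  assumes "c \<in> A"
  shows open_cdom: "open (cdom c)"
    and open_cimg: "open (cimg c)"
    and homeomorphism_chart: "homeomorphism (cdom c) (cimg c) (cmap c) (cinv c)"
  using atlas assms unfolding oriented_smooth_atlas_def is_chart_def by blast+

lemma cinv_cmap: "c \<in> A \<Longrightarrow> p \<in> cdom c \<Longrightarrow> cinv c (cmap c p) = p"
  using homeomorphism_chart homeomorphism_apply1 by blast

lemma cmap_cinv: "c \<in> A \<Longrightarrow> x \<in> cimg c \<Longrightarrow> cmap c (cinv c x) = x"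
  using homeomorphism_chart homeomorphism_apply2 by blast

lemma cinv_in_cdom: "c \<in> A \<Longrightarrow> x \<in> cimg c \<Longrightarrow> cinv c x \<in> cdom c"
  using homeomorphism_image2[OF homeomorphism_chart] by blast

lemma continuous_on_cmap: "c \<in> A \<Longrightarrow> continuous_on (cdom c) (cmap c)"
  using homeomorphism_chart homeomorphism_cont1 by blast

lemma continuous_on_cinv: "c \<in> A \<Longrightarrow> continuous_on (cimg c) (cinv c)"
  using homeomorphism_chart homeomorphism_cont2 by blast

lemma cmap_image_eq:
  assumes "c \<in> A" "U \<subseteq> cdom c"
  shows "cmap c ` U = cimg c \<inter> cinv c -` U"
proof (intro equalityI subsetI)
  show "x \<in> cimg c \<inter> cinv c -` U" if "x \<in> cmap c ` U" for x
    using that assms by (auto simp: cinv_cmap subset_iff)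
  show "x \<in> cmap c ` U" if "x \<in> cimg c \<inter> cinv c -` U" for x
    using that by (intro image_eqI[of _ _ "cinv c x"]) (auto simp: cmap_cinv[OF assms(1)])
qed

lemma open_cmap_image:
  assumes "c \<in> A" "open U" "U \<subseteq> cdom c"
  shows "open (cmap c ` U)"
  unfolding cmap_image_eq[OF assms(1,3)]
  by (rule continuous_open_preimage[OF continuous_on_cinv open_cimg]) (use assms in auto)

lemma ex_chart: "\<exists>c\<in>A. p \<in> cdom c"
  using atlas unfolding oriented_smooth_atlas_def by blast

lemma
  shows chart_at_in: "chart_at A p \<in> A"
    and in_chart_at: "p \<in> cdom (chart_at A p)"
  using someI_ex[of "\<lambda>c. c \<in> A \<and> p \<in> cdom c"] ex_chart[of p] unfolding chart_at_def by blast+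

lemma C1_transition:
  assumes "c \<in> A" "c' \<in> A"
  shows "Ck_on 1 (transition c c') (cmap c ` (cdom c \<inter> cdom c'))"
  using atlas assms unfolding oriented_smooth_atlas_def by blast

lemma open_overlap:
  assumes "c \<in> A" "c' \<in> A"
  shows "open (cmap c ` (cdom c \<inter> cdom c'))"
  using assms by (intro open_cmap_image open_Int open_cdom) auto

lemma transition_cmap: "c \<in> A \<Longrightarrow> p \<in> cdom c \<Longrightarrow> transition c c' (cmap c p) = cmap c' p"
  by (simp add: transition_def cinv_cmap)

lemma differentiable_transition:
  assumes "c \<in> A" "c' \<in> A" "p \<in> cdom c" "p \<in> cdom c'"
  shows "transition c c' differentiable at (cmap c p)"
  using assms by (intro C1_onD(1)[OF open_overlap C1_transition]) auto

lemma frechet_derivative_transition_compose: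
  assumes "c \<in> A" "c' \<in> A" "c'' \<in> A" "p \<in> cdom c" "p \<in> cdom c'" "p \<in> cdom c''"
  shows "frechet_derivative (transition c' c'') (at (cmap c' p))
      (frechet_derivative (transition c c') (at (cmap c p)) h)
    = frechet_derivative (transition c c'') (at (cmap c p)) h"
proof -
  have d: "transition c c' differentiable at (cmap c p)"
    "transition c' c'' differentiable at (transition c c' (cmap c p))"
    using assms by (simp_all add: transition_cmap differentiable_transition)
  have "frechet_derivative (transition c' c'' \<circ> transition c c') (at (cmap c p))
      = frechet_derivative (transition c c'') (at (cmap c p))"
  proof (rule frechet_derivative_transform_within_open)
    show "(transition c' c'' \<circ> transition c c') differentiable at (cmap c p)"
      by (rule differentiable_chain_at[OF d])
    show "open (cmap c ` (cdom c \<inter> cdom c'))" by (rule open_overlap[OF assms(1,2)])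
    show "(transition c' c'' \<circ> transition c c') x = transition c c'' x"
      if "x \<in> cmap c ` (cdom c \<inter> cdom c')" for x
      using that assms by (auto simp: transition_cmap)
  qed (use assms in auto)
  moreover have "frechet_derivative (transition c' c'' \<circ> transition c c') (at (cmap c p)) h
      = frechet_derivative (transition c' c'') (at (cmap c' p))
          (frechet_derivative (transition c c') (at (cmap c p)) h)"
    using frechet_derivative_compose[OF d] assms by (simp add: transition_cmap)
  ultimately show ?thesis by simp
qed

lemma frechet_derivative_transition_same:
  assumes "c \<in> A" "p \<in> cdom c"
  shows "frechet_derivative (transition c c) (at (cmap c p)) h = h"
proof -
  have "frechet_derivative (\<lambda>x. x) (at (cmap c p)) = frechet_derivative (transition c c) (at (cmap c p))"
    by (rule frechet_derivative_transform_within_open[OF _ open_cimg[OF assms(1)]])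
      (use assms in \<open>auto simp: transition_cmap\<close>)
  then show ?thesis by (metis frechet_derivative_ident)
qed

subsection \<open>Tangent spaces\<close>

lemma tangent_spaceI:
  assumes "\<And>c c'. c \<in> A \<Longrightarrow> c' \<in> A \<Longrightarrow> p \<in> cdom c \<Longrightarrow> p \<in> cdom c' \<Longrightarrow>
      v c' = frechet_derivative (transition c c') (at (cmap c p)) (v c)"
    and "\<And>c. \<not> (c \<in> A \<and> p \<in> cdom c) \<Longrightarrow> v c = 0"
  shows "v \<in> tangent_space A p"
  using assms unfolding tangent_space_def by blast

lemma tangent_space_change:
  assumes "v \<in> tangent_space A p" "c \<in> A" "c' \<in> A" "p \<in> cdom c" "p \<in> cdom c'"
  shows "v c' = frechet_derivative (transition c c') (at (cmap c p)) (v c)"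
  using assms unfolding tangent_space_def by blast

lemma tangent_space_outside: "v \<in> tangent_space A p \<Longrightarrow> \<not> (c \<in> A \<and> p \<in> cdom c) \<Longrightarrow> v c = 0"
  unfolding tangent_space_def by blast

lemma coord_vec_in_tangent_space:
  assumes "c \<in> A" "p \<in> cdom c"
  shows "coord_vec A c p h \<in> tangent_space A p"
  using assms unfolding tangent_space_def coord_vec_def
  by (auto simp: frechet_derivative_transition_compose)

lemma coord_vec_self: "c \<in> A \<Longrightarrow> p \<in> cdom c \<Longrightarrow> coord_vec A c p h c = h"
  by (simp add: coord_vec_def frechet_derivative_transition_same)

lemma coord_vec_component:
  assumes "v \<in> tangent_space A p" "c \<in> A" "p \<in> cdom c"
  shows "coord_vec A c p (v c) = v"
proof
  fix c'
  show "coord_vec A c p (v c) c' = v c'"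
    using assms tangent_space_change[OF assms(1,2) _ assms(3), of c'] tangent_space_outside[OF assms(1), of c']
    by (auto simp: coord_vec_def)
qed

lemma tangent_eqI:
  assumes "v \<in> tangent_space A p" "w \<in> tangent_space A p" "c \<in> A" "p \<in> cdom c" "v c = w c"
  shows "v = w"
  using assms by (metis coord_vec_component)

lemma subspace_tangent_space: "subspace (tangent_space A p)"
proof -
  have lin: "linear (frechet_derivative (transition c c') (at (cmap c p)))"
    if "c \<in> A" "c' \<in> A" "p \<in> cdom c" "p \<in> cdom c'" for c c'
    using differentiable_transition[OF that] by (rule linear_frechet_derivative)
  show ?thesis
    unfolding subspace_def
  proof (intro conjI ballI allI)
    show "0 \<in> tangent_space A p"
      by (rule tangent_spaceI) (simp_all add: linear_0[OF lin])
  next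
    fix v w assume v: "v \<in> tangent_space A p" and w: "w \<in> tangent_space A p"
    show "v + w \<in> tangent_space A p"
    proof (rule tangent_spaceI)
      fix c c' assume c: "c \<in> A" "c' \<in> A" "p \<in> cdom c" "p \<in> cdom c'"
      show "(v + w) c' = frechet_derivative (transition c c') (at (cmap c p)) ((v + w) c)"
        using tangent_space_change[OF v c] tangent_space_change[OF w c] by (simp add: linear_add[OF lin[OF c]])
    qed (simp add: tangent_space_outside[OF v] tangent_space_outside[OF w])
  next
    fix r v assume v: "v \<in> tangent_space A p"
    show "r *\<^sub>R v \<in> tangent_space A p"
    proof (rule tangent_spaceI)
      fix c c' assume c: "c \<in> A" "c' \<in> A" "p \<in> cdom c" "p \<in> cdom c'"
      show "(r *\<^sub>R v) c' = frechet_derivative (transition c c') (at (cmap c p)) ((r *\<^sub>R v) c)"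
        using tangent_space_change[OF v c] by (simp add: linear_cmul[OF lin[OF c]])
    qed (simp add: tangent_space_outside[OF v])
  qed
qed

lemmas tangent_space_intros =
  subspace_0[OF subspace_tangent_space] subspace_add[OF subspace_tangent_space]
  subspace_diff[OF subspace_tangent_space] subspace_scale[OF subspace_tangent_space]

lemma coord_vec_linear:
  assumes "c \<in> A" "p \<in> cdom c"
  shows "linear (coord_vec A c p)"
proof (rule linearI)
  fix h k :: "real^3" and r :: real
  note [simp] = coord_vec_self[OF assms]
  show "coord_vec A c p (h + k) = coord_vec A c p h + coord_vec A c p k"
    by (rule tangent_eqI[OF _ _ assms]) (simp_all add: tangent_space_intros coord_vec_in_tangent_space assms)
  show "coord_vec A c p (r *\<^sub>R h) = r *\<^sub>R coord_vec A c p h"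
    by (rule tangent_eqI[OF _ _ assms]) (simp_all add: tangent_space_intros coord_vec_in_tangent_space assms)
qed

subsection \<open>Continuously differentiable maps and their derivatives\<close>

text \<open>One pair of charts is enough in this definition, and then any pair will do, because the transition
  maps are \<open>C\<^sup>1\<close>; see \<open>C1_near_in_charts\<close>.\<close>

definition C1_near :: "('m \<Rightarrow> 'm) \<Rightarrow> 'm \<Rightarrow> bool" where
  "C1_near g p \<longleftrightarrow> (\<exists>c\<in>A. \<exists>c'\<in>A. \<exists>U. open U \<and> p \<in> U \<and> U \<subseteq> cdom c \<and> g ` U \<subseteq> cdom c' \<and>
     Ck_on 1 (cmap c' \<circ> g \<circ> cinv c) (cmap c ` U))"

lemma continuous_on_if_C1_in_charts:
  assumes "c \<in> A" "c' \<in> A" "open U" "U \<subseteq> cdom c" "g ` U \<subseteq> cdom c'"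
    and "Ck_on 1 (cmap c' \<circ> g \<circ> cinv c) (cmap c ` U)"
  shows "continuous_on U g"
proof (rule continuous_on_eq)
  have 1: "continuous_on (cmap c ` U) (cmap c' \<circ> g \<circ> cinv c)"
    using assms by (intro C1_on_continuous_on open_cmap_image)
  have 2: "continuous_on U (cmap c)"
    using continuous_on_cmap[OF assms(1)] assms(4) continuous_on_subset by blast
  have "continuous_on U (\<lambda>q. (cmap c' \<circ> g \<circ> cinv c) (cmap c q))"
    by (rule continuous_on_compose2[OF 1 2 order_refl])
  then show "continuous_on U (\<lambda>q. cinv c' ((cmap c' \<circ> g \<circ> cinv c) (cmap c q)))"
    by (rule continuous_on_compose2[OF continuous_on_cinv[OF assms(2)]])
      (use assms(1,4,5) in \<open>auto simp: cinv_cmap subset_iff image_subset_iff\<close>)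
  show "cinv c' ((cmap c' \<circ> g \<circ> cinv c) (cmap c q)) = g q" if "q \<in> U" for q
    using that assms by (auto simp: cinv_cmap subset_iff)
qed

lemma C1_near_isCont:
  assumes "C1_near g p"
  shows "isCont g p"
  using assms continuous_on_if_C1_in_charts unfolding C1_near_def
  by (metis continuous_on_eq_continuous_at)

lemma C1_near_in_charts:
  assumes g: "C1_near g p" and c: "c \<in> A" "p \<in> cdom c" and c': "c' \<in> A" "g p \<in> cdom c'"
  obtains U where "open U" "p \<in> U" "U \<subseteq> cdom c" "g ` U \<subseteq> cdom c'"
    "Ck_on 1 (cmap c' \<circ> g \<circ> cinv c) (cmap c ` U)"
proof -
  obtain d d' U where d: "d \<in> A" "d' \<in> A" and U: "open U" "p \<in> U" "U \<subseteq> cdom d" "g ` U \<subseteq> cdom d'"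
    and F: "Ck_on 1 (cmap d' \<circ> g \<circ> cinv d) (cmap d ` U)"
    using g unfolding C1_near_def by blast
  define V where "V = (U \<inter> g -` cdom c') \<inter> cdom c"
  have "open V"
    unfolding V_def using continuous_on_if_C1_in_charts[OF d U(1,3,4) F]
    by (intro open_Int continuous_open_preimage U open_cdom c c')
  moreover have V: "V \<subseteq> U" "V \<subseteq> cdom c" "g ` V \<subseteq> cdom c'" unfolding V_def by auto
  moreover have "Ck_on 1 (cmap c' \<circ> g \<circ> cinv c) (cmap c ` V)"
  proof (rule C1_on_cong)
    have VU: "cmap d ` V \<subseteq> cmap d ` U" "open (cmap d ` V)" "open (cmap d ` U)" "open (cmap c ` V)"
      using V U \<open>open V\<close> c d by (auto intro!: open_cmap_image)
    have 1: "Ck_on 1 (cmap d' \<circ> g \<circ> cinv d) (cmap d ` V)"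
      using VU F by (blast intro: C1_on_subset)
    have 2: "Ck_on 1 (transition c d) (cmap c ` V)"
      using image_mono[of V "cdom c \<inter> cdom d" "cmap c"] V U
      by (intro C1_on_subset[OF open_overlap C1_transition] c d VU) auto
    have 3: "Ck_on 1 ((cmap d' \<circ> g \<circ> cinv d) \<circ> transition c d) (cmap c ` V)"
      using V c by (intro C1_on_compose[OF VU(4) 2 VU(2) 1]) (auto simp: transition_cmap subset_iff)
    show "Ck_on 1 (transition d' c' \<circ> ((cmap d' \<circ> g \<circ> cinv d) \<circ> transition c d)) (cmap c ` V)"
      using V U c d c' by (intro C1_on_compose[OF VU(4) 3 open_overlap C1_transition])
        (auto simp: transition_cmap cinv_cmap subset_iff)
    show "(transition d' c' \<circ> ((cmap d' \<circ> g \<circ> cinv d) \<circ> transition c d)) x = (cmap c' \<circ> g \<circ> cinv c) x"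
      if "x \<in> cmap c ` V" for x
      using that V U c d c' by (auto simp: transition_cmap cinv_cmap subset_iff)
  qed (use V c \<open>open V\<close> open_cmap_image in auto)
  ultimately show thesis using that[of V] U c c' unfolding V_def by auto
qed

lemma C1_near_id: "C1_near (\<lambda>p. p) p"
proof -
  let ?c = "chart_at A p"
  have "Ck_on 1 (cmap ?c \<circ> (\<lambda>p. p) \<circ> cinv ?c) (cimg ?c)"
    by (rule C1_on_cong[where f = "transition ?c ?c"])
      (use C1_transition[OF chart_at_in chart_at_in, of p p] open_cimg[OF chart_at_in] in \<open>auto simp: transition_def\<close>)
  then show ?thesis
    unfolding C1_near_def using chart_at_in in_chart_at open_cdom[OF chart_at_in, of p] by blast
qed

lemma C1_near_compose:
  assumes g: "C1_near g p" and k: "C1_near k (g p)"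
  shows "C1_near (\<lambda>q. k (g q)) p"
proof -
  let ?c = "chart_at A p" and ?c' = "chart_at A (g p)" and ?c'' = "chart_at A (k (g p))"
  note ch = chart_at_in in_chart_at
  obtain U where U: "open U" "p \<in> U" "U \<subseteq> cdom ?c" "g ` U \<subseteq> cdom ?c'"
    "Ck_on 1 (cmap ?c' \<circ> g \<circ> cinv ?c) (cmap ?c ` U)"
    using C1_near_in_charts[OF g ch ch] by metis
  obtain W where W: "open W" "g p \<in> W" "W \<subseteq> cdom ?c'" "k ` W \<subseteq> cdom ?c''"
    "Ck_on 1 (cmap ?c'' \<circ> k \<circ> cinv ?c') (cmap ?c' ` W)"
    using C1_near_in_charts[OF k ch ch] by metis
  define V where "V = U \<inter> g -` W"
  have V: "open V" "V \<subseteq> U" "g ` V \<subseteq> W" "p \<in> V"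
    unfolding V_def using continuous_on_if_C1_in_charts[OF ch(1) ch(1) U(1,3,4,5)] U W
    by (auto intro!: continuous_open_preimage)
  have op: "open (cmap ?c ` V)" "open (cmap ?c' ` W)" "open (cmap ?c ` U)"
    using V U W by (auto intro!: open_cmap_image ch(1))
  have 1: "Ck_on 1 (cmap ?c' \<circ> g \<circ> cinv ?c) (cmap ?c ` V)"
    using V by (intro C1_on_subset[OF op(3) U(5) op(1)]) auto
  have "Ck_on 1 (cmap ?c'' \<circ> (\<lambda>q. k (g q)) \<circ> cinv ?c) (cmap ?c ` V)"
  proof (rule C1_on_cong[OF op(1)])
    show "Ck_on 1 ((cmap ?c'' \<circ> k \<circ> cinv ?c') \<circ> (cmap ?c' \<circ> g \<circ> cinv ?c)) (cmap ?c ` V)"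
      using V U W by (intro C1_on_compose[OF op(1) 1 op(2) W(5)]) (auto simp: cinv_cmap ch(1) subset_iff image_subset_iff)
    show "((cmap ?c'' \<circ> k \<circ> cinv ?c') \<circ> (cmap ?c' \<circ> g \<circ> cinv ?c)) x = (cmap ?c'' \<circ> (\<lambda>q. k (g q)) \<circ> cinv ?c) x"
      if "x \<in> cmap ?c ` V" for x
      using that V U W by (auto simp: cinv_cmap ch(1) subset_iff)
  qed
  moreover have "V \<subseteq> cdom ?c" using U(3) V(2) by blast
  moreover have "(\<lambda>q. k (g q)) ` V \<subseteq> cdom ?c''" using V(3) W(4) unfolding image_subset_iff by blast
  ultimately show ?thesis
    unfolding C1_near_def using ch(1) V(1,4) by blast
qed

lemma C1_near_differentiable:
  assumes "C1_near g p" "c \<in> A" "p \<in> cdom c" "c' \<in> A" "g p \<in> cdom c'"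
  shows "(cmap c' \<circ> g \<circ> cinv c) differentiable at (cmap c p)"
proof -
  obtain U where U: "open U" "p \<in> U" "U \<subseteq> cdom c" "Ck_on 1 (cmap c' \<circ> g \<circ> cinv c) (cmap c ` U)"
    using C1_near_in_charts[OF assms] by metis
  show ?thesis
    using U by (intro C1_onD(1)[OF open_cmap_image[OF assms(2) U(1,3)] U(4)]) auto
qed

text \<open>The derivative is defined by means of one chosen chart at \<open>p\<close>; by the chain rule every chart gives
  the same.\<close>

lemma pushforward_apply:
  assumes g: "C1_near g p" and v: "v \<in> tangent_space A p"
    and c: "c \<in> A" "p \<in> cdom c" and c': "c' \<in> A" "g p \<in> cdom c'"
  shows "pushforward A g p v c' = frechet_derivative (cmap c' \<circ> g \<circ> cinv c) (at (cmap c p)) (v c)"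
proof -
  let ?d = "chart_at A p"
  note d = chart_at_in[of p] in_chart_at[of p]
  have d1: "transition ?d c differentiable at (cmap ?d p)"
    "(cmap c' \<circ> g \<circ> cinv c) differentiable at (transition ?d c (cmap ?d p))"
    using C1_near_differentiable[OF g c c'] c d by (simp_all add: transition_cmap differentiable_transition)
  have "frechet_derivative ((cmap c' \<circ> g \<circ> cinv c) \<circ> transition ?d c) (at (cmap ?d p))
      = frechet_derivative (cmap c' \<circ> g \<circ> cinv ?d) (at (cmap ?d p))"
  proof (rule frechet_derivative_transform_within_open)
    show "((cmap c' \<circ> g \<circ> cinv c) \<circ> transition ?d c) differentiable at (cmap ?d p)"
      by (rule differentiable_chain_at[OF d1])
    show "open (cmap ?d ` (cdom ?d \<inter> cdom c))" by (rule open_overlap[OF d(1) c(1)])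
    show "((cmap c' \<circ> g \<circ> cinv c) \<circ> transition ?d c) x = (cmap c' \<circ> g \<circ> cinv ?d) x"
      if "x \<in> cmap ?d ` (cdom ?d \<inter> cdom c)" for x
      using that d c by (auto simp: transition_cmap cinv_cmap)
  qed (use c d in auto)
  then have "frechet_derivative (cmap c' \<circ> g \<circ> cinv ?d) (at (cmap ?d p)) (v ?d)
      = frechet_derivative (cmap c' \<circ> g \<circ> cinv c) (at (cmap c p)) (v c)"
    using frechet_derivative_compose[OF d1] tangent_space_change[OF v d(1) c(1) d(2) c(2)]
      transition_cmap[OF d] by (metis comp_apply)
  then show ?thesis using c' by (simp add: pushforward_def Let_def)
qed

lemma pushforward_outside: "\<not> (c' \<in> A \<and> g p \<in> cdom c') \<Longrightarrow> pushforward A g p v c' = 0"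
  by (auto simp: pushforward_def Let_def)

lemma pushforward_in_tangent_space:
  assumes g: "C1_near g p" and v: "v \<in> tangent_space A p"
  shows "pushforward A g p v \<in> tangent_space A (g p)"
proof -
  let ?c = "chart_at A p"
  note c = chart_at_in[of p] in_chart_at[of p]
  have "pushforward A g p v c'' = frechet_derivative (transition c' c'') (at (cmap c' (g p))) (pushforward A g p v c')"
    if c': "c' \<in> A" "c'' \<in> A" "g p \<in> cdom c'" "g p \<in> cdom c''" for c' c''
  proof -
    obtain U where U: "open U" "p \<in> U" "U \<subseteq> cdom ?c" "g ` U \<subseteq> cdom c'"
      using C1_near_in_charts[OF g c c'(1,3)] by metis
    have gp: "(cmap c' \<circ> g \<circ> cinv ?c) (cmap ?c p) = cmap c' (g p)" using c by (simp add: cinv_cmap)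
    have d: "(cmap c' \<circ> g \<circ> cinv ?c) differentiable at (cmap ?c p)"
      "transition c' c'' differentiable at ((cmap c' \<circ> g \<circ> cinv ?c) (cmap ?c p))"
      unfolding gp using C1_near_differentiable[OF g c c'(1,3)] differentiable_transition[OF c'] by auto
    have "frechet_derivative (transition c' c'' \<circ> (cmap c' \<circ> g \<circ> cinv ?c)) (at (cmap ?c p))
      = frechet_derivative (cmap c'' \<circ> g \<circ> cinv ?c) (at (cmap ?c p))"
    proof (rule frechet_derivative_transform_within_open)
      show "(transition c' c'' \<circ> (cmap c' \<circ> g \<circ> cinv ?c)) differentiable at (cmap ?c p)"
        by (rule differentiable_chain_at[OF d])
      show "open (cmap ?c ` U)" by (rule open_cmap_image[OF c(1) U(1,3)])
      show "(transition c' c'' \<circ> (cmap c' \<circ> g \<circ> cinv ?c)) x = (cmap c'' \<circ> g \<circ> cinv ?c) x"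
        if "x \<in> cmap ?c ` U" for x
        using that U c c' by (auto simp: transition_cmap cinv_cmap subset_iff)
    qed (use U in auto)
    then show ?thesis
      unfolding pushforward_apply[OF g v c c'(1,3)] pushforward_apply[OF g v c c'(2,4)]
      using frechet_derivative_compose[OF d] gp by (metis comp_apply)
  qed
  then show ?thesis
    unfolding tangent_space_def using pushforward_outside by blast
qed

lemma pushforward_linear:
  assumes "C1_near g p"
  shows "linear (pushforward A g p)"
proof -
  have "linear (frechet_derivative (cmap c' \<circ> g \<circ> cinv (chart_at A p)) (at (cmap (chart_at A p) p)))"
    if "c' \<in> A" "g p \<in> cdom c'" for c'
    by (rule linear_frechet_derivative[OF C1_near_differentiable[OF assms chart_at_in in_chart_at that]])
  then show ?thesis
    by (intro linearI) (auto simp: pushforward_def Let_def fun_eq_iff linear_add linear_cmul)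
qed

lemma pushforward_compose:
  assumes g: "C1_near g p" and k: "C1_near k (g p)" and v: "v \<in> tangent_space A p"
  shows "pushforward A (\<lambda>q. k (g q)) p v = pushforward A k (g p) (pushforward A g p v)"
proof (rule tangent_eqI[OF _ _ chart_at_in in_chart_at])
  note kg = C1_near_compose[OF g k]
  show "pushforward A (\<lambda>q. k (g q)) p v \<in> tangent_space A (k (g p))"
    by (rule pushforward_in_tangent_space[OF kg v])
  show "pushforward A k (g p) (pushforward A g p v) \<in> tangent_space A (k (g p))"
    by (rule pushforward_in_tangent_space[OF k pushforward_in_tangent_space[OF g v]])
  let ?c = "chart_at A p" and ?c' = "chart_at A (g p)" and ?c'' = "chart_at A (k (g p))"
  note ch = chart_at_in in_chart_at
  obtain U where U: "open U" "p \<in> U" "U \<subseteq> cdom ?c" "g ` U \<subseteq> cdom ?c'"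
    using C1_near_in_charts[OF g ch ch] by metis
  have gp: "(cmap ?c' \<circ> g \<circ> cinv ?c) (cmap ?c p) = cmap ?c' (g p)" by (simp add: cinv_cmap ch)
  have d: "(cmap ?c' \<circ> g \<circ> cinv ?c) differentiable at (cmap ?c p)"
    "(cmap ?c'' \<circ> k \<circ> cinv ?c') differentiable at ((cmap ?c' \<circ> g \<circ> cinv ?c) (cmap ?c p))"
    unfolding gp by (rule C1_near_differentiable[OF g ch ch] C1_near_differentiable[OF k ch ch])+
  have "frechet_derivative ((cmap ?c'' \<circ> k \<circ> cinv ?c') \<circ> (cmap ?c' \<circ> g \<circ> cinv ?c)) (at (cmap ?c p))
      = frechet_derivative (cmap ?c'' \<circ> (\<lambda>q. k (g q)) \<circ> cinv ?c) (at (cmap ?c p))"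
  proof (rule frechet_derivative_transform_within_open)
    show "((cmap ?c'' \<circ> k \<circ> cinv ?c') \<circ> (cmap ?c' \<circ> g \<circ> cinv ?c)) differentiable at (cmap ?c p)"
      by (rule differentiable_chain_at[OF d])
    show "open (cmap ?c ` U)" by (rule open_cmap_image[OF ch(1) U(1,3)])
    show "((cmap ?c'' \<circ> k \<circ> cinv ?c') \<circ> (cmap ?c' \<circ> g \<circ> cinv ?c)) x = (cmap ?c'' \<circ> (\<lambda>q. k (g q)) \<circ> cinv ?c) x"
      if "x \<in> cmap ?c ` U" for x
      using that U by (auto simp: cinv_cmap ch(1) subset_iff)
  qed (use U in auto)
  then show "pushforward A (\<lambda>q. k (g q)) p v ?c'' = pushforward A k (g p) (pushforward A g p v) ?c''"
    unfolding pushforward_apply[OF kg v ch ch] pushforward_apply[OF g v ch ch]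
      pushforward_apply[OF k pushforward_in_tangent_space[OF g v] ch ch]
    using frechet_derivative_compose[OF d] gp by (metis comp_apply)
qed

lemma pushforward_id:
  assumes "v \<in> tangent_space A p"
  shows "pushforward A (\<lambda>q. q) p v = v"
proof (rule tangent_eqI[OF _ assms chart_at_in in_chart_at])
  show "pushforward A (\<lambda>q. q) p v \<in> tangent_space A p"
    by (rule pushforward_in_tangent_space[OF C1_near_id assms])
  have "cmap (chart_at A p) \<circ> (\<lambda>q. q) \<circ> cinv (chart_at A p) = transition (chart_at A p) (chart_at A p)"
    by (simp add: transition_def o_def)
  then show "pushforward A (\<lambda>q. q) p v (chart_at A p) = v (chart_at A p)"
    by (simp add: pushforward_apply[OF C1_near_id assms chart_at_in in_chart_at chart_at_in in_chart_at]
        frechet_derivative_transition_same[OF chart_at_in in_chart_at])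
qed

lemma continuous_on_pushforward:
  assumes g: "\<And>p. C1_near g p" and Y: "continuous_vector_field_on A UNIV Y" and c': "c' \<in> A"
  shows "continuous_on (g -` cdom c') (\<lambda>p. pushforward A g p (Y p) c')"
proof (rule continuous_at_imp_continuous_on, rule ballI)
  fix p assume p: "p \<in> g -` cdom c'"
  let ?c = "chart_at A p"
  note c = chart_at_in[of p] in_chart_at[of p]
  obtain U where U: "open U" "p \<in> U" "U \<subseteq> cdom ?c" "g ` U \<subseteq> cdom c'"
    "Ck_on 1 (cmap c' \<circ> g \<circ> cinv ?c) (cmap ?c ` U)"
    using C1_near_in_charts[OF g c c'] p by (metis vimageE)
  have "continuous_on U (\<lambda>q. frechet_derivative (cmap c' \<circ> g \<circ> cinv ?c) (at (cmap ?c q)) (Y q ?c))"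
  proof (rule continuous_on_frechet_derivative_apply[OF open_cmap_image[OF c(1) U(1,3)] U(5)])
    show "continuous_on U (cmap ?c)" using continuous_on_cmap[OF c(1)] U(3) continuous_on_subset by blast
    have "continuous_on (cdom ?c) (\<lambda>q. Y q ?c)"
      using Y c unfolding continuous_vector_field_on_def by simp
    then show "continuous_on U (\<lambda>q. Y q ?c)" using U(3) continuous_on_subset by blast
  qed auto
  moreover have "frechet_derivative (cmap c' \<circ> g \<circ> cinv ?c) (at (cmap ?c q)) (Y q ?c)
      = pushforward A g q (Y q) c'" if "q \<in> U" for q
    using that U Y c c' unfolding continuous_vector_field_on_def
    by (subst pushforward_apply[OF g, of _ _ ?c]) auto
  ultimately have "continuous_on U (\<lambda>q. pushforward A g q (Y q) c')"
    by (rule continuous_on_eq)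
  then show "isCont (\<lambda>p. pushforward A g p (Y p) c') p"
    using U(1,2) by (simp add: continuous_on_eq_continuous_at)
qed

end

section \<open>The flow of a \<open>C\<^sup>1\<close> vector field\<close>

locale closed_manifold_flow = smooth_atlas A for A :: "('m::t2_space) chart set" +
  fixes X :: "'m \<Rightarrow> 'm tvec" and \<phi> :: "real \<Rightarrow> 'm \<Rightarrow> 'm"
  assumes compact_manifold: "compact (UNIV :: 'm set)"
    and C1_plus_X: "C1_plus_vector_field A X"
    and flow: "flow_generated_by A X \<phi>"
begin

lemma X_tangent: "X p \<in> tangent_space A p"
  using C1_plus_X unfolding C1_plus_vector_field_def by blast

lemma C1_local_rep_X: "c \<in> A \<Longrightarrow> Ck_on 1 (local_rep c X) (cimg c)"
  using C1_plus_X unfolding C1_plus_vector_field_def by blast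

lemma local_rep_X: "c \<in> A \<Longrightarrow> p \<in> cdom c \<Longrightarrow> local_rep c X (cmap c p) = X p c"
  by (simp add: local_rep_def cinv_cmap)

lemma continuous_X: "continuous_vector_field_on A UNIV X"
  unfolding continuous_vector_field_on_def
proof (intro conjI ballI)
  fix c assume c: "c \<in> A"
  have "continuous_on (cdom c) (\<lambda>p. local_rep c X (cmap c p))"
    by (rule continuous_on_compose2[OF C1_on_continuous_on[OF open_cimg C1_local_rep_X] continuous_on_cmap])
      (use c in auto)
  then show "continuous_on (cdom c \<inter> UNIV) (\<lambda>p. X p c)"
    by (auto intro: continuous_on_eq simp: local_rep_X c)
qed (rule X_tangent)

lemma flow_0 [simp]: "\<phi> 0 p = p"
  and flow_add: "\<phi> (s + t) p = \<phi> s (\<phi> t p)"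
  and continuous_orbit: "continuous_on UNIV (\<lambda>t. \<phi> t p)"
  using flow unfolding flow_generated_by_def by blast+

lemma flow_derivative:
  "c \<in> A \<Longrightarrow> \<phi> t p \<in> cdom c \<Longrightarrow> ((\<lambda>s. cmap c (\<phi> s p)) has_vector_derivative X (\<phi> t p) c) (at t)"
  using flow unfolding flow_generated_by_def by blast

lemma flow_minus [simp]: "\<phi> (- t) (\<phi> t p) = p" "\<phi> t (\<phi> (- t) p) = p"
  by (simp_all flip: flow_add)

subsection \<open>Differentiability of the flow\<close>

text \<open>An orbit cannot leave a ball of a chart faster than the vector field allows. At the first exit
  time the orbit is still in the compact, hence closed, preimage of the closed ball, so that the
  chart can be used up to and including that time.\<close>

lemma orbit_stays_in_ball:
  assumes c: "c \<in> A" and r: "cball x0 r \<subseteq> cimg c"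
    and p: "p \<in> cdom c" "dist x0 (cmap c p) < r / 2"
    and K: "\<And>x. x \<in> cball x0 r \<Longrightarrow> norm (local_rep c X x) \<le> K" "\<bar>t\<bar> * K < r / 2"
  shows "\<phi> t p \<in> cdom c \<and> cmap c (\<phi> t p) \<in> ball x0 r"
proof -
  define W where "W = cdom c \<inter> cmap c -` ball x0 r"
  define Wc where "Wc = cinv c ` cball x0 r"
  have "open W"
    unfolding W_def by (intro continuous_open_preimage continuous_on_cmap open_cdom c open_ball)
  have "closed Wc"
    unfolding Wc_def by (intro compact_imp_closed compact_continuous_image
        continuous_on_subset[OF continuous_on_cinv[OF c] r] compact_cball)
  have WWc: "W \<subseteq> Wc"
  proof
    fix q assume "q \<in> W"
    then have "q = cinv c (cmap c q)" "cmap c q \<in> cball x0 r" unfolding W_def by (auto simp: cinv_cmap c)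
    then show "q \<in> Wc" unfolding Wc_def by blast
  qed
  have Wc: "q \<in> cdom c" "cmap c q \<in> cball x0 r" if "q \<in> Wc" for q
    using that r cinv_in_cdom[OF c] cmap_cinv[OF c] unfolding Wc_def by auto
  define \<gamma> where "\<gamma> s = \<phi> (s * t) p" for s
  have cont: "continuous_on UNIV \<gamma>"
    unfolding \<gamma>_def by (rule continuous_on_compose2[OF continuous_orbit]) (auto intro!: continuous_intros)
  have "dist x0 (cmap c p) < r" using p(2) zero_le_dist[of x0 "cmap c p"] by linarith
  then have pW: "p \<in> W" unfolding W_def using p(1) by simp
  define N where "N = {0..1} \<inter> \<gamma> -` (- W)"
  have clN: "closed N"
    unfolding N_def using \<open>open W\<close>
    by (intro continuous_closed_preimage continuous_on_subset[OF cont]) (auto simp: closed_Compl)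
  have "N = {}"
  proof (rule ccontr)
    assume ne: "N \<noteq> {}"
    define s0 where "s0 = Inf N"
    have bdd: "bdd_below N" unfolding N_def by (rule bdd_belowI[of _ 0]) auto
    have s0N: "s0 \<in> N" unfolding s0_def by (rule closed_contains_Inf[OF ne bdd clN])
    have "\<gamma> 0 = p" unfolding \<gamma>_def by simp
    then have "s0 \<noteq> 0" using s0N pW unfolding N_def by auto
    then have s0: "0 < s0" "s0 \<le> 1" using s0N unfolding N_def by auto
    have before: "\<gamma> s \<in> W" if "s \<in> {0..<s0}" for s
    proof (rule ccontr)
      assume "\<gamma> s \<notin> W"
      then have "s \<in> N" using that s0 unfolding N_def by auto
      then have "s0 \<le> s" unfolding s0_def by (rule cInf_lower[OF _ bdd])
      then show False using that by simp
    qed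
    have "\<gamma> ` closure {0..<s0} \<subseteq> Wc"
    proof (rule image_closure_subset)
      show "continuous_on (closure {0..<s0}) \<gamma>" using cont continuous_on_subset by blast
      show "closed Wc" by fact
      show "\<gamma> ` {0..<s0} \<subseteq> Wc" using before WWc by blast
    qed
    then have upto: "\<gamma> s \<in> Wc" if "0 \<le> s" "s \<le> s0" for s
      using that s0 by (auto simp: image_subset_iff)
    have "norm (cmap c (\<gamma> s0) - cmap c (\<gamma> 0)) \<le> (\<bar>t\<bar> * K) * \<bar>s0 - 0\<bar>"
    proof (rule norm_increment_le[where f = "\<lambda>s. cmap c (\<gamma> s)" and f' = "\<lambda>s. t *\<^sub>R X (\<gamma> s) c"])
      fix s assume "s \<in> closed_segment 0 s0"
      then have s: "0 \<le> s" "s \<le> s0" using s0 by (simp_all add: closed_segment_eq_real_ivl)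
      note w = Wc[OF upto[OF s]]
      have "((\<lambda>s. cmap c (\<phi> s p)) \<circ> (\<lambda>s. s * t) has_vector_derivative t *\<^sub>R X (\<phi> (s * t) p) c) (at s)"
        by (rule vector_diff_chain_at)
          (use w flow_derivative[OF c, of "s * t" p] in \<open>auto simp: \<gamma>_def intro!: derivative_eq_intros\<close>)
      then show "((\<lambda>s. cmap c (\<gamma> s)) has_vector_derivative t *\<^sub>R X (\<gamma> s) c) (at s)"
        unfolding \<gamma>_def o_def .
      have "norm (X (\<gamma> s) c) \<le> K" using K(1)[OF w(2)] local_rep_X[OF c w(1)] by simp
      then show "norm (t *\<^sub>R X (\<gamma> s) c) \<le> \<bar>t\<bar> * K" by (simp add: mult_left_mono)
    qed
    also have "\<dots> \<le> \<bar>t\<bar> * K"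
    proof -
      have "0 \<le> r" using p(2) zero_le_dist[of x0 "cmap c p"] by linarith
      then have "0 \<le> K" using K(1)[of x0] norm_ge_zero[of "local_rep c X x0"] by (simp, linarith)
      then show ?thesis using s0 by (simp add: mult_left_le)
    qed
    finally have "dist (cmap c p) (cmap c (\<gamma> s0)) < r / 2"
      using K(2) \<open>\<gamma> 0 = p\<close> by (simp add: dist_norm norm_minus_commute)
    then have "cmap c (\<gamma> s0) \<in> ball x0 r"
      using p(2) dist_triangle[of x0 "cmap c (\<gamma> s0)" "cmap c p"] by simp
    then have "\<gamma> s0 \<in> W" unfolding W_def using Wc(1)[OF upto[of s0]] s0 by simp
    then show False using s0N unfolding N_def by simp
  qed
  then have "1 \<notin> N" by simp
  then have "\<gamma> 1 \<in> W" by (simp add: N_def)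
  then show ?thesis unfolding W_def \<gamma>_def by simp
qed

text \<open>A compact ball in a chart bounds the vector field and its derivative, so that a time \<open>\<tau>\<close> suits all
  points near its centre.\<close>

lemma flow_C1_near_short_time:
  obtains U \<tau> where "open U" "q \<in> U" "0 < \<tau>"
    "\<And>t p. \<bar>t\<bar> \<le> \<tau> \<Longrightarrow> p \<in> U \<Longrightarrow> C1_near (\<phi> t) p"
proof -
  let ?c = "chart_at A q" and ?x0 = "cmap (chart_at A q) q"
  let ?f = "local_rep ?c X"
  note c = chart_at_in[of q] in_chart_at[of q]
  have "?x0 \<in> cimg ?c" using c by blast
  then obtain r where r: "0 < r" "cball ?x0 r \<subseteq> cimg ?c"
    using open_cimg[OF c(1)] open_contains_cball by blast
  note f = C1_local_rep_X[OF c(1)]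
  have "bounded (?f ` cball ?x0 r)"
    by (intro compact_imp_bounded compact_continuous_image compact_cball
        continuous_on_subset[OF C1_on_continuous_on[OF open_cimg[OF c(1)] f] r(2)])
  then obtain K where K: "0 < K" "\<And>x. x \<in> cball ?x0 r \<Longrightarrow> norm (?f x) \<le> K"
    unfolding bounded_pos by blast
  obtain L where L: "0 \<le> L" "\<And>x. x \<in> cball ?x0 r \<Longrightarrow> onorm (frechet_derivative ?f (at x)) \<le> L"
    using C1_derivative_bounded_on_compact[OF open_cimg[OF c(1)] f compact_cball r(2)] by blast
  \<comment> \<open>The first bound keeps the orbits in the ball, the second one is \<open>L \<tau> \<le> 1/2\<close>.\<close>
  define \<tau> where "\<tau> = min (r / (4 * K)) (1 / (2 * (L + 1)))"
  have \<tau>: "0 < \<tau>" unfolding \<tau>_def using r K L by simp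
  have "\<tau> * K \<le> r / (4 * K) * K" unfolding \<tau>_def using K(1) by (intro mult_right_mono) auto
  then have \<tau>K: "\<tau> * K < r / 2" using K(1) r(1) by simp
  have "L * \<tau> \<le> L * (1 / (2 * (L + 1)))" unfolding \<tau>_def using L(1) by (intro mult_left_mono) auto
  also have "\<dots> \<le> 1 / 2" using L(1) by (simp add: divide_simps)
  finally have \<tau>L: "L * \<tau> \<le> 1 / 2" .
  define G where "G = ball ?x0 (r / 2)"
  define U where "U = cinv ?c ` G"
  have Gc: "G \<subseteq> cimg ?c" unfolding G_def using r by (auto simp: subset_iff)
  have U_eq: "U = cdom ?c \<inter> cmap ?c -` G"
  proof (intro equalityI subsetI)
    show "p \<in> cdom ?c \<inter> cmap ?c -` G" if "p \<in> U" for p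
      using that Gc cinv_in_cdom[OF c(1)] cmap_cinv[OF c(1)] unfolding U_def by auto
    show "p \<in> U" if "p \<in> cdom ?c \<inter> cmap ?c -` G" for p
      using that unfolding U_def by (intro image_eqI[of _ _ "cmap ?c p"]) (auto simp: cinv_cmap c)
  qed
  have openU: "open U"
    unfolding U_eq G_def by (intro continuous_open_preimage continuous_on_cmap open_cdom c open_ball)
  have qU: "q \<in> U" unfolding U_eq G_def using c r by simp
  have img: "cmap ?c ` U = G"
    using Gc by (auto simp: U_def image_image cmap_cinv c subset_iff)
  have stay: "\<phi> t p \<in> cdom ?c" "cmap ?c (\<phi> t p) \<in> ball ?x0 r" if "\<bar>t\<bar> \<le> \<tau>" "p \<in> U" for t p
  proof -
    have "\<bar>t\<bar> * K \<le> \<tau> * K" using that K(1) by (intro mult_right_mono) auto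
    then have "\<bar>t\<bar> * K < r / 2" using \<tau>K by simp
    then show "\<phi> t p \<in> cdom ?c" "cmap ?c (\<phi> t p) \<in> ball ?x0 r"
      using orbit_stays_in_ball[OF c(1) r(2) _ _ K(2), of p t] that(2) unfolding U_eq G_def by auto
  qed
  have "C1_near (\<phi> t) p" if t: "\<bar>t\<bar> \<le> \<tau>" and p: "p \<in> U" for t p
  proof -
    have inv: "cinv ?c x \<in> U" "cmap ?c (cinv ?c x) = x" if "x \<in> G" for x
      using that Gc cmap_cinv[OF c(1)] unfolding U_def by auto
    have "Ck_on 1 (cmap ?c \<circ> \<phi> t \<circ> cinv ?c) G"
    proof (rule C1_dependence_on_initial_value[where f = ?f and y = "\<lambda>t. cmap ?c \<circ> \<phi> t \<circ> cinv ?c"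
          and K = "cball ?x0 r", OF open_cimg[OF c(1)] f compact_cball convex_cball r(2) _ _ _ _ L \<tau>L t])
      show "open G" unfolding G_def by simp
      show "(cmap ?c \<circ> \<phi> 0 \<circ> cinv ?c) x = x" if "x \<in> G" for x using inv[OF that] by simp
      show "(cmap ?c \<circ> \<phi> s \<circ> cinv ?c) x \<in> cball ?x0 r" if "x \<in> G" "\<bar>s\<bar> \<le> \<tau>" for x s
        using stay(2)[OF that(2) inv(1)[OF that(1)]] by simp
      show "((\<lambda>s. (cmap ?c \<circ> \<phi> s \<circ> cinv ?c) x) has_vector_derivative ?f ((cmap ?c \<circ> \<phi> s \<circ> cinv ?c) x)) (at s)"
        if "x \<in> G" "\<bar>s\<bar> \<le> \<tau>" for x s
        using flow_derivative[OF c(1) stay(1)[OF that(2) inv(1)[OF that(1)]]]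
          local_rep_X[OF c(1) stay(1)[OF that(2) inv(1)[OF that(1)]]] by simp
    qed
    then have "Ck_on 1 (cmap ?c \<circ> \<phi> t \<circ> cinv ?c) (cmap ?c ` U)" unfolding img .
    moreover have "U \<subseteq> cdom ?c" unfolding U_eq by blast
    moreover have "\<phi> t ` U \<subseteq> cdom ?c" using stay(1)[OF t] by blast
    ultimately show ?thesis
      unfolding C1_near_def using c(1) openU p by blast
  qed
  then show thesis by (rule that[OF openU qU \<tau>])
qed

text \<open>Compactness gives a short time \<open>\<sigma>\<close> that works at all points, and the time-\<open>t\<close> map is an iterate of
  the time-\<open>t/n\<close> map with \<open>\<bar>t/n\<bar> \<le> \<sigma>\<close>.\<close>

lemma flow_C1_near: "C1_near (\<phi> t) p"
proof -
  define good where "good q U \<tau> \<longleftrightarrow> open U \<and> q \<in> U \<and> 0 < \<tau> \<and>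
    (\<forall>t p. \<bar>t\<bar> \<le> \<tau> \<longrightarrow> p \<in> U \<longrightarrow> C1_near (\<phi> t) p)" for q U and \<tau> :: real
  have "\<forall>q. \<exists>U \<tau>. good q U \<tau>"
  proof
    fix q
    show "\<exists>U \<tau>. good q U \<tau>"
    proof (rule flow_C1_near_short_time[of q])
      fix U \<tau> assume a: "open U" "q \<in> U" "0 < \<tau>"
        "\<And>t p. \<bar>t\<bar> \<le> \<tau> \<Longrightarrow> p \<in> U \<Longrightarrow> C1_near (\<phi> t) p"
      have "good q U \<tau>" unfolding good_def by (intro conjI allI impI a)
      then show ?thesis by blast
    qed
  qed
  then obtain U \<tau> where "\<And>q. good q (U q) (\<tau> q)" by metis
  then have U: "\<And>q. open (U q)" "\<And>q. q \<in> U q" "\<And>q. 0 < \<tau> q"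
    "\<And>q t p. \<bar>t\<bar> \<le> \<tau> q \<Longrightarrow> p \<in> U q \<Longrightarrow> C1_near (\<phi> t) p"
    unfolding good_def by blast+
  obtain F where F: "finite F" "UNIV \<subseteq> (\<Union>q\<in>F. U q)"
    by (rule compactE_image[OF compact_manifold, of UNIV U]) (use U in auto)
  then have "F \<noteq> {}" by auto
  define \<sigma> where "\<sigma> = Min (\<tau> ` F)"
  have \<sigma>: "0 < \<sigma>" unfolding \<sigma>_def using F \<open>F \<noteq> {}\<close> U(3) by (subst Min_gr_iff) auto
  have small: "C1_near (\<phi> s) q" if s: "\<bar>s\<bar> \<le> \<sigma>" for s q
  proof -
    obtain q' where q': "q' \<in> F" "q \<in> U q'" using F(2) by blast
    have "\<sigma> \<le> \<tau> q'" unfolding \<sigma>_def using F q' by simp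
    then show ?thesis using U(4)[of s q' q] s q' by linarith
  qed
  obtain n :: nat where n: "\<bar>t\<bar> / \<sigma> < real n" using reals_Archimedean2 by blast
  moreover have "0 \<le> \<bar>t\<bar> / \<sigma>" using \<sigma> by simp
  ultimately have n0: "real n > 0" by linarith
  define s where "s = t / real n"
  have "\<bar>s\<bar> \<le> \<sigma>" unfolding s_def using n n0 \<sigma> by (simp add: field_simps)
  have "C1_near (\<phi> (real k * s)) p" for k
  proof (induction k)
    case 0
    have "\<phi> 0 = (\<lambda>q. q)" by (simp add: fun_eq_iff)
    then show ?case using C1_near_id[of p] by simp
  next
    case (Suc k)
    have "\<phi> (real (Suc k) * s) = (\<lambda>q. \<phi> s (\<phi> (real k * s) q))"
      by (simp add: fun_eq_iff algebra_simps flip: flow_add)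
    then show ?case using C1_near_compose[OF Suc small[OF \<open>\<bar>s\<bar> \<le> \<sigma>\<close>]] by simp
  qed
  from this[of n] show ?thesis using n0 by (simp add: s_def)
qed

lemma continuous_flow: "continuous_on UNIV (\<phi> t)"
  using C1_near_isCont[OF flow_C1_near] by (simp add: continuous_at_imp_continuous_on)

subsection \<open>The derivative of the flow\<close>

abbreviation dflow :: "real \<Rightarrow> 'm \<Rightarrow> 'm tvec \<Rightarrow> 'm tvec" where
  "dflow t p \<equiv> pushforward A (\<phi> t) p"

lemma dflow_tangent: "v \<in> tangent_space A p \<Longrightarrow> dflow t p v \<in> tangent_space A (\<phi> t p)"
  by (rule pushforward_in_tangent_space[OF flow_C1_near])

lemma dflow_linear: "linear (dflow t p)"
  by (rule pushforward_linear[OF flow_C1_near])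

lemma dflow_add: "v \<in> tangent_space A p \<Longrightarrow> dflow (s + t) p v = dflow s (\<phi> t p) (dflow t p v)"
  using pushforward_compose[OF flow_C1_near[of t p] flow_C1_near[of s "\<phi> t p"], of v]
  by (simp add: flow_add[abs_def])

lemma dflow_0: "v \<in> tangent_space A p \<Longrightarrow> dflow 0 p v = v"
proof -
  have "\<phi> 0 = (\<lambda>q. q)" by (simp add: fun_eq_iff)
  then show "v \<in> tangent_space A p \<Longrightarrow> dflow 0 p v = v" using pushforward_id[of v p] by simp
qed

text \<open>Both sides are the velocity at \<open>s = 0\<close> of the curve \<open>s \<mapsto> \<phi> (s + t) p = \<phi> t (\<phi> s p)\<close>.\<close>

lemma dflow_X: "dflow t p (X p) = X (\<phi> t p)"
proof (rule tangent_eqI[OF dflow_tangent[OF X_tangent] X_tangent chart_at_in in_chart_at])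
  let ?c = "chart_at A p" and ?c' = "chart_at A (\<phi> t p)"
  note ch = chart_at_in in_chart_at
  let ?F = "cmap ?c' \<circ> \<phi> t \<circ> cinv ?c"
  have F: "(?F has_derivative frechet_derivative ?F (at (cmap ?c p))) (at (cmap ?c (\<phi> 0 p)))"
    using C1_near_differentiable[OF flow_C1_near ch ch] by (simp add: frechet_derivative_works)
  have "((\<lambda>s. cmap ?c (\<phi> s p)) has_vector_derivative X p ?c) (at 0)"
    using flow_derivative[OF ch(1), of 0 p p] ch(2)[of p] by simp
  from has_derivative_compose[OF this[unfolded has_vector_derivative_def] F]
  have 1: "((\<lambda>s. ?F (cmap ?c (\<phi> s p))) has_vector_derivative frechet_derivative ?F (at (cmap ?c p)) (X p ?c)) (at 0)"
    unfolding has_vector_derivative_def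
    using linear_cmul[OF has_derivative_linear[OF F]] by simp
  have 2: "((\<lambda>s. cmap ?c' (\<phi> (s + t) p)) has_vector_derivative X (\<phi> t p) ?c') (at 0)"
  proof -
    have "((\<lambda>s. cmap ?c' (\<phi> s p)) has_vector_derivative X (\<phi> t p) ?c') (at (0 + t))"
      using flow_derivative[OF chart_at_in in_chart_at, of t p] by simp
    moreover have "((\<lambda>s. s + t) has_vector_derivative 1) (at 0)"
      by (auto intro!: derivative_eq_intros)
    ultimately have "((\<lambda>s. cmap ?c' (\<phi> s p)) \<circ> (\<lambda>s. s + t) has_vector_derivative 1 *\<^sub>R X (\<phi> t p) ?c') (at 0)"
      by (intro vector_diff_chain_at)
    then show ?thesis by (simp add: o_def)
  qed
  let ?S = "(\<lambda>s. \<phi> s p) -` cdom ?c"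
  have "open ?S" by (intro continuous_open_vimage open_cdom ch)
      (use continuous_orbit in \<open>simp add: continuous_on_eq_continuous_at\<close>)
  have "((\<lambda>s. cmap ?c' (\<phi> (s + t) p)) has_vector_derivative frechet_derivative ?F (at (cmap ?c p)) (X p ?c)) (at 0)"
    by (rule has_vector_derivative_transform_within_open[OF 1 \<open>open ?S\<close>])
      (use ch(2)[of p] in \<open>auto simp: cinv_cmap ch(1) add.commute[of _ t] flow_add\<close>)
  from vector_derivative_unique_at[OF this 2]
  show "dflow t p (X p) ?c' = X (\<phi> t p) ?c'"
    unfolding pushforward_apply[OF flow_C1_near X_tangent ch ch] .
qed

end

section \<open>Frames and coordinates\<close>

definition trip :: "real^3 \<Rightarrow> real^3 \<Rightarrow> real^3 \<Rightarrow> real" where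
  "trip u v w = u \<bullet> cross3 v w"

lemma trip_rotate: "trip v w u = trip u v w"
  by (simp add: trip_def cross3_simps)

lemma trip_combination: "trip (x *\<^sub>R u + a *\<^sub>R v + b *\<^sub>R w) v w = x * trip u v w"
  by (simp add: trip_def inner_add_left dot_cross_self)

lemma trip_linear: "linear (\<lambda>u. trip u v w)"
  by (rule linearI) (simp_all add: trip_def inner_add_left)

lemma continuous_on_trip:
  fixes f :: "'x::t2_space \<Rightarrow> real^3"
  shows "continuous_on S f \<Longrightarrow> continuous_on S g \<Longrightarrow> continuous_on S h \<Longrightarrow>
    continuous_on S (\<lambda>x. trip (f x) (g x) (h x))"
  unfolding trip_def by (intro continuous_on_inner continuous_on_cross)

text \<open>If the triple product vanishes, the cross product of any two of the vectors is orthogonal to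
  all three, hence zero if they span; but then all cross products vanish.\<close>

lemma trip_nonzero_if_spanning:
  assumes span: "\<And>z. \<exists>x a b. z = x *\<^sub>R u + a *\<^sub>R v + b *\<^sub>R w"
  shows "trip u v w \<noteq> 0"
proof
  assume 0: "trip u v w = 0"
  have zero: "cross3 v w = 0" if t: "trip u v w = 0" and s: "\<And>z. \<exists>x a b. z = x *\<^sub>R u + a *\<^sub>R v + b *\<^sub>R w" for u v w
  proof -
    obtain x a b where "cross3 v w = x *\<^sub>R u + a *\<^sub>R v + b *\<^sub>R w" using s by blast
    then have "cross3 v w \<bullet> cross3 v w = (x *\<^sub>R u + a *\<^sub>R v + b *\<^sub>R w) \<bullet> cross3 v w" by simp
    also have "\<dots> = x * trip u v w" using trip_combination unfolding trip_def .
    finally show ?thesis using t by simp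
  qed
  have span': "\<exists>x a b. z = x *\<^sub>R v + a *\<^sub>R w + b *\<^sub>R u" "\<exists>x a b. z = x *\<^sub>R w + a *\<^sub>R u + b *\<^sub>R v" for z
  proof -
    obtain x a b where "z = x *\<^sub>R u + a *\<^sub>R v + b *\<^sub>R w" using span by blast
    then have "z = a *\<^sub>R v + b *\<^sub>R w + x *\<^sub>R u" "z = b *\<^sub>R w + x *\<^sub>R u + a *\<^sub>R v"
      by (simp_all add: add_ac)
    then show "\<exists>x a b. z = x *\<^sub>R v + a *\<^sub>R w + b *\<^sub>R u" "\<exists>x a b. z = x *\<^sub>R w + a *\<^sub>R u + b *\<^sub>R v"
      by blast+
  qed
  have c: "cross3 v w = 0" "cross3 w u = 0" "cross3 u v = 0"
    using zero[OF 0 span] zero[OF _ span'(1)] zero[OF _ span'(2)] 0 trip_rotate by metis+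
  then have c': "cross3 w v = 0" "cross3 u w = 0" "cross3 v u = 0"
    using cross_skew by (metis minus_zero)+
  have "cross3 z z' = 0" for z z'
  proof -
    obtain x a b x' a' b' where "z = x *\<^sub>R u + a *\<^sub>R v + b *\<^sub>R w" "z' = x' *\<^sub>R u + a' *\<^sub>R v + b' *\<^sub>R w"
      using span by metis
    then show ?thesis
      by (simp add: cross_add_left cross_add_right cross_mult_left cross_mult_right c c')
  qed
  then have "cross3 (axis 1 1) (axis 2 1) = 0" by blast
  then show False by (simp add: cross_basis axis_eq_0_iff)
qed

context smooth_atlas
begin

definition tangent_basis :: "'m \<Rightarrow> 'm tvec \<Rightarrow> 'm tvec \<Rightarrow> 'm tvec \<Rightarrow> bool" where
  "tangent_basis p u v w \<longleftrightarrow>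
     u \<in> tangent_space A p \<and> v \<in> tangent_space A p \<and> w \<in> tangent_space A p \<and>
     (\<forall>z\<in>tangent_space A p. \<exists>x a b. z = x *\<^sub>R u + a *\<^sub>R v + b *\<^sub>R w)"

text \<open>The coefficient along \<open>u\<close> with respect to the basis \<open>u, v, w\<close>, by Cramer's rule; the other
  coefficients are obtained by rotating the basis.\<close>

definition coord :: "'m \<Rightarrow> 'm tvec \<Rightarrow> 'm tvec \<Rightarrow> 'm tvec \<Rightarrow> 'm tvec \<Rightarrow> real" where
  "coord p u v w z =
     (let c = chart_at A p in trip (z c) (v c) (w c) / trip (u c) (v c) (w c))"

lemma tangent_basis_rotate:
  assumes "tangent_basis p u v w"
  shows "tangent_basis p v w u"
proof -
  have "\<exists>x a b. z = x *\<^sub>R v + a *\<^sub>R w + b *\<^sub>R u" if z: "z \<in> tangent_space A p" for z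
  proof -
    obtain x a b where "z = x *\<^sub>R u + a *\<^sub>R v + b *\<^sub>R w"
      using assms z unfolding tangent_basis_def by blast
    then have "z = a *\<^sub>R v + b *\<^sub>R w + x *\<^sub>R u" by (simp add: add_ac)
    then show ?thesis by blast
  qed
  then show ?thesis using assms unfolding tangent_basis_def by blast
qed

lemma tangent_basis_trip:
  assumes b: "tangent_basis p u v w" and c: "c \<in> A" "p \<in> cdom c"
  shows "trip (u c) (v c) (w c) \<noteq> 0"
proof (rule trip_nonzero_if_spanning)
  fix h :: "real^3"
  obtain x a b where "coord_vec A c p h = x *\<^sub>R u + a *\<^sub>R v + b *\<^sub>R w"
    using b coord_vec_in_tangent_space[OF c] unfolding tangent_basis_def by blast
  then have "coord_vec A c p h c = x *\<^sub>R u c + a *\<^sub>R v c + b *\<^sub>R w c" by simp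
  then show "\<exists>x a b. h = x *\<^sub>R u c + a *\<^sub>R v c + b *\<^sub>R w c"
    unfolding coord_vec_self[OF c] by blast
qed

lemma coord_combination:
  assumes "tangent_basis p u v w"
  shows "coord p u v w (x *\<^sub>R u + a *\<^sub>R v + b *\<^sub>R w) = x"
  using tangent_basis_trip[OF assms chart_at_in in_chart_at]
  by (simp add: coord_def Let_def trip_combination)

lemma coord_in_chart:
  assumes b: "tangent_basis p u v w" and c: "c \<in> A" "p \<in> cdom c" and z: "z \<in> tangent_space A p"
  shows "coord p u v w z = trip (z c) (v c) (w c) / trip (u c) (v c) (w c)"
proof -
  obtain x a b where z: "z = x *\<^sub>R u + a *\<^sub>R v + b *\<^sub>R w"
    using b z unfolding tangent_basis_def by blast
  show ?thesis
    unfolding z coord_combination[OF b] using tangent_basis_trip[OF b c] by (simp add: trip_combination)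
qed

lemma coord_expansion:
  assumes b: "tangent_basis p u v w" and z: "z \<in> tangent_space A p"
  shows "z = coord p u v w z *\<^sub>R u + coord p v w u z *\<^sub>R v + coord p w u v z *\<^sub>R w"
proof -
  obtain x a b where z: "z = x *\<^sub>R u + a *\<^sub>R v + b *\<^sub>R w"
    using b z unfolding tangent_basis_def by blast
  have 1: "coord p u v w z = x" unfolding z by (rule coord_combination[OF b])
  have "z = a *\<^sub>R v + b *\<^sub>R w + x *\<^sub>R u" by (simp add: z add_ac)
  then have 2: "coord p v w u z = a" using coord_combination[OF tangent_basis_rotate[OF b]] by simp
  have "z = b *\<^sub>R w + x *\<^sub>R u + a *\<^sub>R v" by (simp add: z add_ac)
  then have 3: "coord p w u v z = b"
    using coord_combination[OF tangent_basis_rotate[OF tangent_basis_rotate[OF b]]] by simp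
  show ?thesis unfolding 1 2 3 by (rule z)
qed

lemma coord_linear: "linear (coord p u v w)"
proof (rule linearI)
  show "coord p u v w (z + z') = coord p u v w z + coord p u v w z'" for z z'
    using linear_add[OF trip_linear] by (simp add: coord_def Let_def add_divide_distrib)
  show "coord p u v w (r *\<^sub>R z) = r *\<^sub>R coord p u v w z" for r z
    using linear_cmul[OF trip_linear] by (simp add: coord_def Let_def)
qed

lemma coord_basis:
  assumes "tangent_basis p u v w"
  shows "coord p u v w u = 1" "coord p u v w v = 0" "coord p u v w w = 0"
  using coord_combination[OF assms, of 1 0 0] coord_combination[OF assms, of 0 1 0]
    coord_combination[OF assms, of 0 0 1] by simp_all

text \<open>Continuous vector fields along a map \<open>g\<close>. The field \<open>p \<mapsto> dflow t p (Y p)\<close>, which is tangent at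
  \<open>\<phi> t p\<close>, is of this kind.\<close>

definition continuous_along :: "'m set \<Rightarrow> ('m \<Rightarrow> 'm) \<Rightarrow> ('m \<Rightarrow> 'm tvec) \<Rightarrow> bool" where
  "continuous_along V g \<sigma> \<longleftrightarrow> (\<forall>p\<in>V. \<sigma> p \<in> tangent_space A (g p)) \<and>
     (\<forall>c\<in>A. continuous_on (V \<inter> g -` cdom c) (\<lambda>p. \<sigma> p c))"

lemma continuous_along_id: "continuous_along V (\<lambda>p. p) Y \<longleftrightarrow> continuous_vector_field_on A V Y"
  unfolding continuous_along_def continuous_vector_field_on_def by (simp add: Int_commute)

lemma continuous_along_compose:
  assumes "continuous_vector_field_on A UNIV Y" "continuous_on UNIV g"
  shows "continuous_along UNIV g (\<lambda>p. Y (g p))"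
  unfolding continuous_along_def
proof (intro conjI ballI)
  fix c assume c: "c \<in> A"
  have 1: "continuous_on (cdom c) (\<lambda>p. Y p c)"
    using assms(1) c unfolding continuous_vector_field_on_def by simp
  have 2: "continuous_on (UNIV \<inter> g -` cdom c) g" using assms(2) continuous_on_subset by blast
  show "continuous_on (UNIV \<inter> g -` cdom c) (\<lambda>p. Y (g p) c)"
    by (rule continuous_on_compose2[OF 1 2]) auto
qed (use assms(1) in \<open>simp add: continuous_vector_field_on_def\<close>)

lemma continuous_along_pushforward:
  assumes "\<And>p. C1_near g p" "continuous_vector_field_on A UNIV Y"
  shows "continuous_along UNIV g (\<lambda>p. pushforward A g p (Y p))"
  using assms continuous_on_pushforward[OF assms] pushforward_in_tangent_space[OF assms(1)]
  unfolding continuous_along_def continuous_vector_field_on_def by simp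

lemma continuous_on_coord:
  assumes V: "open V" and g: "continuous_on V g"
    and u: "continuous_along V g u" and v: "continuous_along V g v" and w: "continuous_along V g w"
    and z: "continuous_along V g z"
    and b: "\<And>p. p \<in> V \<Longrightarrow> tangent_basis (g p) (u p) (v p) (w p)"
  shows "continuous_on V (\<lambda>p. coord (g p) (u p) (v p) (w p) (z p))"
proof (rule continuous_at_imp_continuous_on, rule ballI)
  fix p assume p: "p \<in> V"
  let ?c = "chart_at A (g p)"
  note c = chart_at_in[of "g p"] in_chart_at[of "g p"]
  let ?W = "V \<inter> g -` cdom ?c"
  have "open ?W" by (rule continuous_open_preimage[OF g V open_cdom[OF c(1)]])
  have *: "continuous_on ?W (\<lambda>q. \<sigma> q ?c)" if "continuous_along V g \<sigma>" for \<sigma>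
    using that c unfolding continuous_along_def by blast
  have "continuous_on ?W (\<lambda>q. trip (z q ?c) (v q ?c) (w q ?c) / trip (u q ?c) (v q ?c) (w q ?c))"
    by (intro continuous_on_divide continuous_on_trip * u v w z)
      (use b c tangent_basis_trip in blast)
  then have "continuous_on ?W (\<lambda>p. coord (g p) (u p) (v p) (w p) (z p))"
  proof (rule continuous_on_eq)
    fix q assume q: "q \<in> ?W"
    then have "z q \<in> tangent_space A (g q)" using z unfolding continuous_along_def by blast
    then show "trip (z q ?c) (v q ?c) (w q ?c) / trip (u q ?c) (v q ?c) (w q ?c)
        = coord (g q) (u q) (v q) (w q) (z q)"
      using coord_in_chart[OF b c(1), of q "z q"] q by simp
  qed
  then show "isCont (\<lambda>p. coord (g p) (u p) (v p) (w p) (z p)) p"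
    using \<open>open ?W\<close> p c by (simp add: continuous_on_eq_continuous_at)
qed

lemma continuous_on_coord_of_coord_vec:
  assumes u: "continuous_vector_field_on A UNIV u" and v: "continuous_vector_field_on A UNIV v"
    and w: "continuous_vector_field_on A UNIV w"
    and b: "\<And>p. tangent_basis p (u p) (v p) (w p)" and c: "c \<in> A"
  shows "continuous_on (cdom c \<times> UNIV) (\<lambda>(p, h). coord p (u p) (v p) (w p) (coord_vec A c p h))"
proof -
  have *: "continuous_on (cdom c \<times> UNIV) (\<lambda>x. Y (fst x) c)" if "continuous_vector_field_on A UNIV Y" for Y
  proof (rule continuous_on_compose2[of "cdom c" "\<lambda>p. Y p c"])
    show "continuous_on (cdom c) (\<lambda>p. Y p c)"
      using that c unfolding continuous_vector_field_on_def by simp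
  qed (auto intro: continuous_intros)
  have "continuous_on (cdom c \<times> UNIV) (\<lambda>x. trip (snd x) (v (fst x) c) (w (fst x) c)
      / trip (u (fst x) c) (v (fst x) c) (w (fst x) c))"
    by (intro continuous_on_divide continuous_on_trip * u v w continuous_on_snd continuous_on_id)
      (use tangent_basis_trip[OF b c] in auto)
  then show ?thesis
  proof (rule continuous_on_eq)
    fix x assume "x \<in> cdom c \<times> (UNIV :: (real^3) set)"
    then obtain p h where x: "x = (p, h)" and p: "p \<in> cdom c" by auto
    show "trip (snd x) (v (fst x) c) (w (fst x) c) / trip (u (fst x) c) (v (fst x) c) (w (fst x) c)
        = (case x of (p, h) \<Rightarrow> coord p (u p) (v p) (w p) (coord_vec A c p h))"
      unfolding x using coord_in_chart[OF b c p coord_vec_in_tangent_space[OF c p]]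
      by (simp add: coord_vec_self[OF c p])
  qed
qed

lemma continuous_vector_field_combination:
  assumes U: "open U" and Y: "continuous_vector_field_on A U Y" and Z: "continuous_vector_field_on A U Z"
    and a: "continuous_on U a" and b: "continuous_on U b"
  shows "continuous_vector_field_on A U (\<lambda>p. a p *\<^sub>R Y p + b p *\<^sub>R Z p)"
  unfolding continuous_vector_field_on_def
proof (intro conjI ballI)
  fix p assume "p \<in> U"
  then show "a p *\<^sub>R Y p + b p *\<^sub>R Z p \<in> tangent_space A p"
    using Y Z unfolding continuous_vector_field_on_def by (simp add: tangent_space_intros)
next
  fix c assume c: "c \<in> A"
  have "continuous_on (cdom c \<inter> U) (\<lambda>p. Y p c)" "continuous_on (cdom c \<inter> U) (\<lambda>p. Z p c)"
    using Y Z c unfolding continuous_vector_field_on_def by blast+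
  moreover have "continuous_on (cdom c \<inter> U) a" "continuous_on (cdom c \<inter> U) b"
    using a b continuous_on_subset by blast+
  ultimately show "continuous_on (cdom c \<inter> U) (\<lambda>p. (a p *\<^sub>R Y p + b p *\<^sub>R Z p) c)"
    by (simp add: continuous_on_add continuous_on_scaleR)
qed

lemma continuous_vector_field_subset:
  assumes "continuous_vector_field_on A U Y" "V \<subseteq> U"
  shows "continuous_vector_field_on A V Y"
  unfolding continuous_vector_field_on_def
proof (intro conjI ballI)
  show "Y p \<in> tangent_space A p" if "p \<in> V" for p
    using assms that unfolding continuous_vector_field_on_def by blast
  fix c assume "c \<in> A"
  then have "continuous_on (cdom c \<inter> U) (\<lambda>p. Y p c)"
    using assms(1) unfolding continuous_vector_field_on_def by blast
  then show "continuous_on (cdom c \<inter> V) (\<lambda>p. Y p c)"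
    by (rule continuous_on_subset) (use assms(2) in blast)
qed

lemma continuous_vector_field_local:
  assumes "\<And>p. \<exists>U. open U \<and> p \<in> U \<and> continuous_vector_field_on A U Y"
  shows "continuous_vector_field_on A UNIV Y"
  unfolding continuous_vector_field_on_def
proof (intro conjI ballI)
  fix p
  show "Y p \<in> tangent_space A p"
    using assms[of p] unfolding continuous_vector_field_on_def by blast
next
  fix c assume c: "c \<in> A"
  have "isCont (\<lambda>p. Y p c) p" if p: "p \<in> cdom c" for p
  proof -
    obtain U where "open U" "p \<in> U" "continuous_vector_field_on A U Y" using assms by blast
    then have "continuous_on (cdom c \<inter> U) (\<lambda>p. Y p c)" "open (cdom c \<inter> U)" "p \<in> cdom c \<inter> U"
      using c p open_cdom[OF c] unfolding continuous_vector_field_on_def by auto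
    then show ?thesis by (metis continuous_on_eq_continuous_at)
  qed
  then show "continuous_on (cdom c \<inter> UNIV) (\<lambda>p. Y p c)"
    by (simp add: continuous_at_imp_continuous_on)
qed

end

section \<open>A connection form\<close>

context closed_manifold_flow
begin

lemma ex_bump:
  obtains \<beta> :: "'m \<Rightarrow> real" and K where "closed K" "K \<subseteq> cdom (chart_at A q)" "continuous_on UNIV \<beta>"
    "\<And>p. 0 \<le> \<beta> p" "0 < \<beta> q" "\<And>p. p \<notin> K \<Longrightarrow> \<beta> p = 0"
proof -
  let ?c = "chart_at A q" and ?x = "cmap (chart_at A q) q"
  note c = chart_at_in[of q] in_chart_at[of q]
  have "?x \<in> cimg ?c" using c by blast
  then obtain r where r: "0 < r" "cball ?x r \<subseteq> cimg ?c"
    using open_cimg[OF c(1)] open_contains_cball by blast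
  define K where "K = cinv ?c ` cball ?x r"
  have K: "closed K"
    unfolding K_def by (intro compact_imp_closed compact_continuous_image
        continuous_on_subset[OF continuous_on_cinv[OF c(1)] r(2)] compact_cball)
  have Kc: "K \<subseteq> cdom ?c" unfolding K_def using r(2) cinv_in_cdom[OF c(1)] by blast
  define \<beta> where "\<beta> p = (if p \<in> cdom ?c then max 0 (r - dist ?x (cmap ?c p)) else 0)" for p
  have off: "\<beta> p = 0" if "p \<notin> K" for p
  proof (cases "p \<in> cdom ?c")
    case True
    have "cmap ?c p \<notin> cball ?x r"
    proof
      assume "cmap ?c p \<in> cball ?x r"
      then have "cinv ?c (cmap ?c p) \<in> K" unfolding K_def by blast
      then show False using that by (simp add: cinv_cmap[OF c(1) True])
    qed
    then show ?thesis by (simp add: \<beta>_def)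
  qed (simp add: \<beta>_def)
  have "continuous_on (cdom ?c) (\<lambda>p. max 0 (r - dist ?x (cmap ?c p)))"
    by (intro continuous_intros continuous_on_cmap c)
  then have "continuous_on (cdom ?c) \<beta>" by (rule continuous_on_eq) (simp add: \<beta>_def)
  moreover have "continuous_on (- K) \<beta>"
    by (rule continuous_on_eq[OF continuous_on_const[of _ 0]]) (simp add: off)
  ultimately have "continuous_on (cdom ?c \<union> - K) \<beta>"
    using K by (intro continuous_on_open_Un open_cdom c) auto
  moreover have "cdom ?c \<union> - K = UNIV" using Kc by blast
  ultimately have "continuous_on UNIV \<beta>" by simp
  moreover have "0 < \<beta> q" "\<And>p. 0 \<le> \<beta> p" unfolding \<beta>_def using r c by auto
  ultimately show thesis using that[of K \<beta>] K Kc off by blast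
qed

text \<open>The scalar product with \<open>X\<close>, for the continuous metric glued from the Euclidean metrics of
  finitely many charts, is positive on \<open>X\<close>; it is divided by its value there.\<close>

lemma ex_connection_form:
  assumes X0: "\<And>p. X p \<noteq> 0"
  obtains \<eta> where "\<And>p. linear (\<eta> p)" "\<And>p. \<eta> p (X p) = (1::real)"
    "\<And>U Y. open U \<Longrightarrow> continuous_vector_field_on A U Y \<Longrightarrow> continuous_on U (\<lambda>p. \<eta> p (Y p))"
proof -
  define bump where "bump q \<beta> K \<longleftrightarrow> closed K \<and> K \<subseteq> cdom (chart_at A q) \<and> continuous_on UNIV \<beta> \<and>
    (\<forall>p. 0 \<le> \<beta> p) \<and> 0 < \<beta> q \<and> (\<forall>p. p \<notin> K \<longrightarrow> \<beta> p = 0)" for q K and \<beta> :: "'m \<Rightarrow> real"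
  have "\<forall>q. \<exists>\<beta> K. bump q \<beta> K"
  proof
    fix q show "\<exists>\<beta> K. bump q \<beta> K"
      by (rule ex_bump[of q]) (unfold bump_def, blast)
  qed
  then obtain \<beta> K where "\<And>q. bump q (\<beta> q) (K q)" by metis
  then have K: "\<And>q. closed (K q)" "\<And>q. K q \<subseteq> cdom (chart_at A q)"
    and \<beta>: "\<And>q. continuous_on UNIV (\<beta> q)" "\<And>q p. 0 \<le> \<beta> q p" "\<And>q. 0 < \<beta> q q" "\<And>q p. p \<notin> K q \<Longrightarrow> \<beta> q p = 0"
    unfolding bump_def by blast+
  have op: "open {p. 0 < \<beta> q p}" for q
    by (rule open_Collect_less[OF continuous_on_const \<beta>(1)])
  obtain F where F: "finite F" "UNIV \<subseteq> (\<Union>q\<in>F. {p. 0 < \<beta> q p})"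
    by (rule compactE_image[OF compact_manifold, of UNIV "\<lambda>q. {p. 0 < \<beta> q p}"]) (use op \<beta>(3) in auto)
  define g where "g p v = (\<Sum>q\<in>F. \<beta> q p * (X p (chart_at A q) \<bullet> v (chart_at A q)))" for p v
  have lin: "linear (g p)" for p
    by (rule linearI) (simp_all add: g_def inner_add_right distrib_left sum.distrib sum_distrib_left mult.left_commute)
  have pos: "0 < g p (X p)" for p
  proof -
    obtain q where q: "q \<in> F" "0 < \<beta> q p" using F(2) by blast
    then have pc: "p \<in> cdom (chart_at A q)" using K(2) \<beta>(4)[of p q] by force
    have "X p (chart_at A q) \<noteq> 0"
    proof
      assume "X p (chart_at A q) = 0"
      then have "X p = coord_vec A (chart_at A q) p 0"
        using coord_vec_component[OF X_tangent chart_at_in pc] by simp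
      then show False using X0 linear_0[OF coord_vec_linear[OF chart_at_in pc]] by simp
    qed
    then have "0 < \<beta> q p * (X p (chart_at A q) \<bullet> X p (chart_at A q))" using q by simp
    then show ?thesis
      unfolding g_def using q(1) F(1) \<beta>(2) by (intro sum_pos2[of F q]) auto
  qed
  have cont: "continuous_on U (\<lambda>p. g p (Y p))" if U: "open U" and Y: "continuous_vector_field_on A U Y" for U Y
    unfolding g_def
  proof (rule continuous_on_sum)
    fix q assume "q \<in> F"
    let ?c = "chart_at A q" and ?h = "\<lambda>p. \<beta> q p * (X p (chart_at A q) \<bullet> Y p (chart_at A q))"
    have "continuous_on (cdom ?c \<inter> U) ?h"
    proof (intro continuous_intros)
      show "continuous_on (cdom ?c \<inter> U) (\<beta> q)" using \<beta>(1) continuous_on_subset by blast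
      show "continuous_on (cdom ?c \<inter> U) (\<lambda>p. Y p ?c)" "continuous_on (cdom ?c \<inter> U) (\<lambda>p. X p ?c)"
        using Y continuous_vector_field_subset[OF continuous_X, of U] chart_at_in
        unfolding continuous_vector_field_on_def by blast+
    qed
    moreover have "continuous_on (- K q \<inter> U) ?h"
      by (rule continuous_on_eq[OF continuous_on_const[of _ 0]]) (simp add: \<beta>(4))
    ultimately have "continuous_on ((cdom ?c \<inter> U) \<union> (- K q \<inter> U)) ?h"
      using K(1) U by (intro continuous_on_open_Un open_Int open_cdom chart_at_in) auto
    moreover have "(cdom ?c \<inter> U) \<union> (- K q \<inter> U) = U" using K(2) by blast
    ultimately show "continuous_on U ?h" by simp
  qed
  show thesis
  proof (rule that[of "\<lambda>p v. g p v / g p (X p)"])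
    show "linear (\<lambda>v. g p v / g p (X p))" for p
      by (rule linearI) (simp_all add: linear_add[OF lin] linear_cmul[OF lin] add_divide_distrib)
    show "g p (X p) / g p (X p) = 1" for p using pos[of p] by simp
    show "continuous_on U (\<lambda>p. g p (Y p) / g p (X p))"
      if "open U" "continuous_vector_field_on A U Y" for U Y
      using pos that continuous_vector_field_subset[OF continuous_X, of U]
      by (intro continuous_on_divide cont) (auto simp: less_imp_neq[THEN not_sym])
  qed
qed

end

section \<open>Lifting a splitting of the quotient bundle\<close>

lemma mem_qclass: "w \<in> qclass X p v \<longleftrightarrow> (\<exists>k. w = v + k *\<^sub>R X p)"
  unfolding qclass_def elt_set_plus_def span_singleton by auto

lemma qclass_eq_iff: "qclass X p v = qclass X p w \<longleftrightarrow> (\<exists>k. w = v + k *\<^sub>R X p)"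
proof
  assume "qclass X p v = qclass X p w"
  moreover have "w \<in> qclass X p w" unfolding mem_qclass by (rule exI[of _ 0]) simp
  ultimately show "\<exists>k. w = v + k *\<^sub>R X p" unfolding mem_qclass[symmetric] by simp
next
  assume "\<exists>k. w = v + k *\<^sub>R X p"
  then obtain k where w: "w = v + k *\<^sub>R X p" by blast
  show "qclass X p v = qclass X p w"
  proof (intro set_eqI iffI)
    fix z
    show "z \<in> qclass X p w" if "z \<in> qclass X p v"
    proof -
      from that obtain l where "z = v + l *\<^sub>R X p" unfolding mem_qclass by blast
      then have "z = w + (l - k) *\<^sub>R X p" by (simp add: w scaleR_diff_left)
      then show ?thesis unfolding mem_qclass by blast
    qed
    show "z \<in> qclass X p v" if "z \<in> qclass X p w"
    proof -
      from that obtain l where "z = w + l *\<^sub>R X p" unfolding mem_qclass by blast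
      then have "z = v + (k + l) *\<^sub>R X p" by (simp add: w scaleR_add_left add.assoc)
      then show ?thesis unfolding mem_qclass by blast
    qed
  qed
qed

lemma qclass_add: "qclass X p v + qclass X p w = qclass X p (v + w)"
proof (intro set_eqI iffI)
  fix z
  show "z \<in> qclass X p (v + w)" if "z \<in> qclass X p v + qclass X p w"
  proof -
    from that obtain v' w' where "v' \<in> qclass X p v" "w' \<in> qclass X p w" "z = v' + w'"
      by (auto elim: set_plus_elim)
    then obtain k l where "z = (v + k *\<^sub>R X p) + (w + l *\<^sub>R X p)"
      unfolding mem_qclass by blast
    then have "z = (v + w) + (k + l) *\<^sub>R X p" by (simp add: scaleR_add_left add_ac)
    then show ?thesis unfolding mem_qclass by blast
  qed
  show "z \<in> qclass X p v + qclass X p w" if "z \<in> qclass X p (v + w)"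
  proof -
    from that obtain k where k: "z = (v + w) + k *\<^sub>R X p" unfolding mem_qclass by blast
    show ?thesis
      unfolding k add.assoc
      by (intro set_plus_intro) (auto simp: mem_qclass intro: exI[of _ 0])
  qed
qed

lemma mem_plane_over:
  assumes "E p = {qclass X p (a *\<^sub>R Y) | a. True}"
  shows "w \<in> plane_over E p \<longleftrightarrow> (\<exists>a k. w = a *\<^sub>R Y + k *\<^sub>R X p)"
  unfolding plane_over_def assms by (auto simp: mem_qclass) (metis mem_qclass)

context smooth_atlas
begin

lemma tangent_basis_of_splitting:
  assumes E: "E p = {qclass X p (a *\<^sub>R u) | a. True}" and F: "F p = {qclass X p (a *\<^sub>R v) | a. True}"
    and EF: "quotient_space A X p = E p + F p"
    and t: "X p \<in> tangent_space A p" "u \<in> tangent_space A p" "v \<in> tangent_space A p"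
  shows "tangent_basis p (X p) u v"
proof -
  have "\<exists>x a b. z = x *\<^sub>R X p + a *\<^sub>R u + b *\<^sub>R v" if z: "z \<in> tangent_space A p" for z
  proof -
    have "qclass X p z \<in> E p + F p"
      using z unfolding EF[symmetric] quotient_space_def by blast
    then obtain a b where "qclass X p z = qclass X p (a *\<^sub>R u) + qclass X p (b *\<^sub>R v)"
      unfolding set_plus_def E F by blast
    then have "qclass X p (a *\<^sub>R u + b *\<^sub>R v) = qclass X p z" by (simp add: qclass_add)
    then obtain k where "z = a *\<^sub>R u + b *\<^sub>R v + k *\<^sub>R X p" unfolding qclass_eq_iff by blast
    then have "z = k *\<^sub>R X p + a *\<^sub>R u + b *\<^sub>R v" by (simp add: add_ac)
    then show ?thesis by blast
  qed
  then show ?thesis using t unfolding tangent_basis_def by blast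
qed

end

context closed_manifold_flow
begin

text \<open>A continuous line field \<open>E\<close> in the quotient bundle with a complement \<open>F\<close> whose preimage is
  transversely orientable is spanned by the class of a global vector field: the component along \<open>E\<close>
  of a field transverse to \<open>F\<close>. It is normalised to lie in the kernel of a connection form, because
  only its class is determined by the splitting and local lifts need not agree.\<close>

lemma ex_global_lift:
  assumes X0: "\<And>p. X p \<noteq> 0"
    and E: "continuous_quotient_line_bundle A X E" and F: "continuous_quotient_line_bundle A X F"
    and EF: "\<And>p. quotient_space A X p = E p + F p"
    and or: "transversely_orientable A (plane_over F)"
  shows "\<exists>e. continuous_vector_field_on A UNIV e \<and> (\<forall>p. E p = {qclass X p (a *\<^sub>R e p) | a. True})"
proof -
  obtain \<eta> where \<eta>: "\<And>p. linear (\<eta> p)" "\<And>p. \<eta> p (X p) = (1::real)"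
    "\<And>U Y. open U \<Longrightarrow> continuous_vector_field_on A U Y \<Longrightarrow> continuous_on U (\<lambda>p. \<eta> p (Y p))"
    using ex_connection_form[OF X0] by metis
  obtain Z where Z: "continuous_vector_field_on A UNIV Z" "\<And>p. Z p \<notin> plane_over F p"
    using or unfolding transversely_orientable_def by blast
  have Zt: "Z p \<in> tangent_space A p" for p
    using Z(1) unfolding continuous_vector_field_on_def by blast
  define lift where "lift p w \<longleftrightarrow> w \<in> plane_over E p \<and> Z p - w \<in> plane_over F p \<and> \<eta> p w = 0" for p w
  define local where "local U YE YF \<longleftrightarrow> open U \<and> continuous_vector_field_on A U YE \<and>
    continuous_vector_field_on A U YF \<and> (\<forall>q\<in>U. E q = {qclass X q (a *\<^sub>R YE q) | a. True} \<and>
    F q = {qclass X q (a *\<^sub>R YF q) | a. True})" for U YE YF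
  have ex_local: "\<exists>U YE YF. p \<in> U \<and> local U YE YF" for p
  proof -
    obtain U1 YE where 1: "open U1" "p \<in> U1" "continuous_vector_field_on A U1 YE"
      "\<And>q. q \<in> U1 \<Longrightarrow> E q = {qclass X q (a *\<^sub>R YE q) | a. True}"
      using E unfolding continuous_quotient_line_bundle_def by meson
    obtain U2 YF where 2: "open U2" "p \<in> U2" "continuous_vector_field_on A U2 YF"
      "\<And>q. q \<in> U2 \<Longrightarrow> F q = {qclass X q (a *\<^sub>R YF q) | a. True}"
      using F unfolding continuous_quotient_line_bundle_def by meson
    have "continuous_vector_field_on A (U1 \<inter> U2) YE" "continuous_vector_field_on A (U1 \<inter> U2) YF"
      using continuous_vector_field_subset[OF 1(3)] continuous_vector_field_subset[OF 2(3)] by blast+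
    then have "local (U1 \<inter> U2) YE YF" using 1 2 unfolding local_def by (simp add: open_Int)
    then show ?thesis using 1(2) 2(2) by blast
  qed
  have basis: "tangent_basis q (X q) (YE q) (YF q)" if "local U YE YF" "q \<in> U" for U YE YF q
    using that tangent_basis_of_splitting[of E q X "YE q" F "YF q", OF _ _ EF X_tangent]
    unfolding local_def continuous_vector_field_on_def by blast
  define cE where "cE YE YF q = coord q (YE q) (YF q) (X q) (Z q)" for YE YF q
  have Z_exp: "Z q = coord q (X q) (YE q) (YF q) (Z q) *\<^sub>R X q + cE YE YF q *\<^sub>R YE q
      + coord q (YF q) (X q) (YE q) (Z q) *\<^sub>R YF q" if "local U YE YF" "q \<in> U" for U YE YF q
    unfolding cE_def by (rule coord_expansion[OF basis[OF that] Zt])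
  have lift_iff: "lift q w \<longleftrightarrow> w = cE YE YF q *\<^sub>R (YE q - \<eta> q (YE q) *\<^sub>R X q)"
    if l: "local U YE YF" "q \<in> U" for U YE YF q w
  proof -
    have EFq: "E q = {qclass X q (a *\<^sub>R YE q) | a. True}" "F q = {qclass X q (a *\<^sub>R YF q) | a. True}"
      using l unfolding local_def by blast+
    note b = basis[OF l]
    show ?thesis
    proof
      assume "lift q w"
      then obtain a k b' k' where w: "w = a *\<^sub>R YE q + k *\<^sub>R X q" and "Z q - w = b' *\<^sub>R YF q + k' *\<^sub>R X q"
        and 0: "\<eta> q w = 0"
        unfolding lift_def mem_plane_over[of E, OF EFq(1)] mem_plane_over[of F, OF EFq(2)] by blast
      then have "Z q = (b' *\<^sub>R YF q + k' *\<^sub>R X q) + (a *\<^sub>R YE q + k *\<^sub>R X q)"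
        by (metis diff_add_cancel)
      then have "Z q = a *\<^sub>R YE q + b' *\<^sub>R YF q + (k + k') *\<^sub>R X q"
        by (simp add: scaleR_add_left add_ac)
      then have a: "cE YE YF q = a"
        unfolding cE_def using coord_combination[OF tangent_basis_rotate[OF b]] by simp
      have "a * \<eta> q (YE q) + k = 0"
        using 0 by (simp add: w linear_add[OF \<eta>(1)] linear_cmul[OF \<eta>(1)] \<eta>(2))
      then have "k = - (a * \<eta> q (YE q))" by linarith
      then show "w = cE YE YF q *\<^sub>R (YE q - \<eta> q (YE q) *\<^sub>R X q)"
        unfolding w a by (simp add: scaleR_diff_right)
    next
      let ?a = "cE YE YF q" and ?x = "coord q (X q) (YE q) (YF q) (Z q)" and ?b = "coord q (YF q) (X q) (YE q) (Z q)"
      assume w: "w = ?a *\<^sub>R (YE q - \<eta> q (YE q) *\<^sub>R X q)"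
      have "w = ?a *\<^sub>R YE q + (- (?a * \<eta> q (YE q))) *\<^sub>R X q" by (simp add: w scaleR_diff_right)
      moreover have "Z q - w = ?b *\<^sub>R YF q + (?x + ?a * \<eta> q (YE q)) *\<^sub>R X q"
        by (subst Z_exp[OF l]) (simp add: w scaleR_diff_right scaleR_add_left)
      moreover have "\<eta> q w = 0"
        by (simp add: w linear_diff[OF \<eta>(1)] linear_cmul[OF \<eta>(1)] \<eta>(2))
      ultimately show "lift q w"
        unfolding lift_def mem_plane_over[of E, OF EFq(1)] mem_plane_over[of F, OF EFq(2)] by blast
    qed
  qed
  have "\<exists>w. lift q w" for q
    using ex_local[of q] lift_iff by blast
  then obtain e where e: "\<And>q. lift q (e q)" by metis
  have e_local: "e q = cE YE YF q *\<^sub>R (YE q - \<eta> q (YE q) *\<^sub>R X q)" if "local U YE YF" "q \<in> U" for U YE YF q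
    using lift_iff[OF that] e by blast
  show ?thesis
  proof (intro exI conjI allI)
    show "continuous_vector_field_on A UNIV e"
    proof (rule continuous_vector_field_local)
      fix p
      obtain U YE YF where p: "p \<in> U" and l: "local U YE YF" using ex_local by blast
      then have U: "open U" and Y: "continuous_vector_field_on A U YE" "continuous_vector_field_on A U YF"
        unfolding local_def by blast+
      have XU: "continuous_vector_field_on A U X" "continuous_vector_field_on A U Z"
        by (rule continuous_vector_field_subset[OF continuous_X] continuous_vector_field_subset[OF Z(1)], simp)+
      have cc: "continuous_on U (cE YE YF)"
        unfolding cE_def[abs_def]
        by (intro continuous_on_coord[where g = "\<lambda>p. p"] U continuous_on_id)
          (use Y XU basis[OF l] tangent_basis_rotate in \<open>auto simp: continuous_along_id\<close>)
      have "continuous_vector_field_on A U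
          (\<lambda>q. cE YE YF q *\<^sub>R YE q + (- (cE YE YF q * \<eta> q (YE q))) *\<^sub>R X q)"
        by (intro continuous_vector_field_combination U Y XU cc continuous_intros \<eta>(3))
      moreover have "e q = cE YE YF q *\<^sub>R YE q + (- (cE YE YF q * \<eta> q (YE q))) *\<^sub>R X q" if "q \<in> U" for q
        unfolding e_local[OF l that] by (simp add: scaleR_diff_right)
      ultimately have "continuous_vector_field_on A U e"
        unfolding continuous_vector_field_on_def by (simp cong: continuous_on_cong_simp)
      then show "\<exists>U. open U \<and> p \<in> U \<and> continuous_vector_field_on A U e" using U p by blast
    qed
    fix p
    obtain U YE YF where p: "p \<in> U" and l: "local U YE YF" using ex_local by blast
    have EFp: "E p = {qclass X p (a *\<^sub>R YE p) | a. True}" "F p = {qclass X p (a *\<^sub>R YF p) | a. True}"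
      using l p unfolding local_def by blast+
    let ?c = "cE YE YF p" and ?y = "\<eta> p (YE p)"
    have c0: "?c \<noteq> 0"
    proof
      assume "?c = 0"
      then have "e p = 0" using e_local[OF l p] by simp
      then have "Z p \<in> plane_over F p" using e[of p] unfolding lift_def by simp
      then show False using Z(2) by blast
    qed
    have q: "qclass X p (a *\<^sub>R e p) = qclass X p ((a * ?c) *\<^sub>R YE p)" for a
      unfolding qclass_eq_iff e_local[OF l p]
      by (rule exI[of _ "a * ?c * ?y"]) (simp add: scaleR_diff_right)
    have "qclass X p (a *\<^sub>R YE p) = qclass X p ((a / ?c) *\<^sub>R e p)" for a
      unfolding q using c0 by simp
    then show "E p = {qclass X p (a *\<^sub>R e p) | a. True}"
      unfolding EFp(1) using q by blast
  qed
qed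

end

section \<open>Hyperbolic invariant lines\<close>

text \<open>An affine cocycle acts on functions by \<open>h \<mapsto> f t \<sqdot> (h \<circ> \<phi> t) + a t\<close>. The image \<open>a n\<close> of the zero
  function at time \<open>n\<close> converges geometrically, hence uniformly, if the linear part contracts, and
  the limit is fixed by the action of all times.\<close>

lemma affine_cocycle_invariant_section:
  fixes \<phi> :: "real \<Rightarrow> 'm::topological_space \<Rightarrow> 'm" and f a :: "real \<Rightarrow> 'm \<Rightarrow> real"
  assumes comp: "compact (UNIV :: 'm set)" and \<phi>: "\<And>t. continuous_on UNIV (\<phi> t)"
    and f: "\<And>t. continuous_on UNIV (f t)" and a: "\<And>t. continuous_on UNIV (a t)"
    and cocycle: "\<And>s t p. a (s + t) p = f t p * a s (\<phi> t p) + a t p"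
    and contr: "\<And>t p. 0 \<le> t \<Longrightarrow> \<bar>f t p\<bar> \<le> exp (- K * t)" and K: "0 < K"
  obtains h where "continuous_on UNIV h" "\<And>t p. h p = f t p * h (\<phi> t p) + a t p"
proof -
  have bounded: "\<exists>M. \<forall>p. \<bar>a t p\<bar> \<le> M" for t
  proof -
    have "bounded (range (a t))"
      by (rule compact_imp_bounded[OF compact_continuous_image[OF a comp]])
    then show ?thesis unfolding bounded_iff by auto
  qed
  obtain M where M: "\<And>p. \<bar>a 1 p\<bar> \<le> M" using bounded by blast
  define q where "q = exp (- K)"
  have q: "0 < q" "q < 1" unfolding q_def using K by auto
  have f_nat: "\<bar>f (real n) p\<bar> \<le> q ^ n" for n p
    using contr[of "real n" p] by (simp add: q_def exp_of_nat_mult[symmetric] mult.commute)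
  define g where "g n p = f (real n) p * a 1 (\<phi> (real n) p)" for n p
  have a_sum: "a (real n) p = (\<Sum>i<n. g i p) + a 0 p" for n p
  proof (induction n)
    case (Suc n)
    have "a (1 + real n) p = g n p + a (real n) p" unfolding g_def by (rule cocycle)
    then show ?case using Suc by simp
  qed simp
  have g_bound: "norm (g n p) \<le> q ^ n * M" for n p
    unfolding g_def real_norm_def abs_mult using q by (intro mult_mono f_nat M) auto
  have summable: "summable (\<lambda>n. q ^ n * M)"
    using q by (intro summable_mult2 summable_geometric) simp
  have unif: "uniform_limit UNIV (\<lambda>n p. \<Sum>i<n. g i p) (\<lambda>p. \<Sum>i. g i p) sequentially"
    by (rule Weierstrass_m_test[OF g_bound summable])
  define h where "h p = (\<Sum>i. g i p) + a 0 p" for p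
  have cg: "continuous_on UNIV (g n)" for n
    unfolding g_def by (intro continuous_on_mult f continuous_on_compose2[OF a \<phi>]) auto
  have "continuous_on UNIV (\<lambda>p. \<Sum>i. g i p)"
    by (rule uniform_limit_theorem[OF _ unif]) (simp_all add: cg continuous_on_sum)
  then have ch: "continuous_on UNIV h" unfolding h_def by (intro continuous_on_add a)
  have lim: "(\<lambda>n. a (real n) p) \<longlonglongrightarrow> h p" for p
    unfolding a_sum h_def
    by (intro tendsto_add tendsto_const tendsto_uniform_limitI[OF unif]) simp
  have "h p = f t p * h (\<phi> t p) + a t p" for t p
  proof (rule LIMSEQ_unique)
    have "a (t + real n) p = f t p * a (real n) (\<phi> t p) + a t p" for n
      using cocycle[of "real n" t p] by (simp add: add.commute)
    then show "(\<lambda>n. a (t + real n) p) \<longlonglongrightarrow> f t p * h (\<phi> t p) + a t p"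
      by (simp add: tendsto_add tendsto_mult lim)
    obtain B where B: "\<And>p. \<bar>a t p\<bar> \<le> B" using bounded by blast
    have "(\<lambda>n. f (real n) p * a t (\<phi> (real n) p)) \<longlonglongrightarrow> 0"
    proof (rule Lim_null_comparison)
      show "\<forall>\<^sub>F n in sequentially. norm (f (real n) p * a t (\<phi> (real n) p)) \<le> q ^ n * B"
        unfolding real_norm_def abs_mult using q by (intro always_eventually allI mult_mono f_nat B) auto
      show "(\<lambda>n. q ^ n * B) \<longlonglongrightarrow> 0"
        using tendsto_mult_left_zero[OF LIMSEQ_power_zero[of q]] q by simp
    qed
    from tendsto_add[OF this lim[of p]]
    show "(\<lambda>n. a (t + real n) p) \<longlonglongrightarrow> h p"
      by (simp add: cocycle)
  qed
  then show thesis using that ch by blast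
qed

context smooth_atlas
begin

lemma tangent_basis_swap:
  assumes "tangent_basis p u v w"
  shows "tangent_basis p u w v"
proof -
  have "\<exists>x a b. z = x *\<^sub>R u + a *\<^sub>R w + b *\<^sub>R v" if z: "z \<in> tangent_space A p" for z
  proof -
    obtain x a b where "z = x *\<^sub>R u + a *\<^sub>R v + b *\<^sub>R w"
      using assms z unfolding tangent_basis_def by blast
    then have "z = x *\<^sub>R u + b *\<^sub>R w + a *\<^sub>R v" by (simp add: add_ac)
    then show ?thesis by blast
  qed
  then show ?thesis using assms unfolding tangent_basis_def by blast
qed

lemma tangent_basis_unique:
  assumes b: "tangent_basis p u v w"
    and "x *\<^sub>R u + a *\<^sub>R v + b *\<^sub>R w = x' *\<^sub>R u + a' *\<^sub>R v + b' *\<^sub>R w"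
  shows "x = x'" "a = a'" "b = b'"
proof -
  show "x = x'" using coord_combination[OF b] assms(2) by metis
  have "a *\<^sub>R v + b *\<^sub>R w + x *\<^sub>R u = a' *\<^sub>R v + b' *\<^sub>R w + x' *\<^sub>R u" using assms(2) by (simp add: add_ac)
  then show "a = a'" using coord_combination[OF tangent_basis_rotate[OF b]] by metis
  have "b *\<^sub>R w + x *\<^sub>R u + a *\<^sub>R v = b' *\<^sub>R w + x' *\<^sub>R u + a' *\<^sub>R v" using assms(2) by (simp add: add_ac)
  then show "b = b'"
    using coord_combination[OF tangent_basis_rotate[OF tangent_basis_rotate[OF b]]] by metis
qed

lemma qclass_nonzero:
  assumes b: "tangent_basis p (X p) u v" and r: "r \<noteq> 0"
  shows "qclass X p (r *\<^sub>R u) \<noteq> qclass X p 0"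
proof
  assume "qclass X p (r *\<^sub>R u) = qclass X p 0"
  then obtain k where "0 = r *\<^sub>R u + k *\<^sub>R X p" unfolding qclass_eq_iff by blast
  then have "k *\<^sub>R X p + r *\<^sub>R u + 0 *\<^sub>R v = 0 *\<^sub>R X p + 0 *\<^sub>R u + 0 *\<^sub>R v"
    by (simp add: add.commute)
  then show False using tangent_basis_unique(2)[OF b] r by blast
qed

definition frame :: "('m \<Rightarrow> 'm tvec) \<Rightarrow> ('m \<Rightarrow> 'm tvec) \<Rightarrow> ('m \<Rightarrow> 'm tvec) \<Rightarrow> bool" where
  "frame u v w \<longleftrightarrow> continuous_vector_field_on A UNIV u \<and> continuous_vector_field_on A UNIV v \<and>
     continuous_vector_field_on A UNIV w \<and> (\<forall>p. tangent_basis p (u p) (v p) (w p))"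

lemma continuous_norm_of_frame:
  assumes fr: "frame u v w"
  shows "continuous_norm A (\<lambda>p z. \<bar>coord p (u p) (v p) (w p) z\<bar> + \<bar>coord p (v p) (w p) (u p) z\<bar>
    + \<bar>coord p (w p) (u p) (v p) z\<bar>)"
    (is "continuous_norm A ?N")
proof -
  have b: "tangent_basis p (u p) (v p) (w p)" for p using fr unfolding frame_def by blast
  note b' = tangent_basis_rotate[OF b] note b'' = tangent_basis_rotate[OF b']
  have c: "continuous_vector_field_on A UNIV u" "continuous_vector_field_on A UNIV v" "continuous_vector_field_on A UNIV w"
    using fr unfolding frame_def by blast+
  have "fibre_norm_on (tangent_space A p) (?N p)" for p
    unfolding fibre_norm_on_def
  proof (intro conjI ballI allI)
    fix z z' r assume z: "z \<in> tangent_space A p"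
    show "0 \<le> ?N p z" by simp
    show "?N p z = 0 \<longleftrightarrow> z = 0"
    proof
      assume "?N p z = 0"
      then have "coord p (u p) (v p) (w p) z = 0" "coord p (v p) (w p) (u p) z = 0" "coord p (w p) (u p) (v p) z = 0"
        by linarith+
      then show "z = 0" using coord_expansion[OF b z] by simp
    qed (simp add: linear_0[OF coord_linear])
    show "?N p (r *\<^sub>R z) = \<bar>r\<bar> * ?N p z"
      by (simp add: linear_cmul[OF coord_linear] abs_mult distrib_left)
    show "?N p (z + z') \<le> ?N p z + ?N p z'"
      unfolding linear_add[OF coord_linear]
      by (rule order.trans[OF add_mono[OF add_mono[OF abs_triangle_ineq abs_triangle_ineq] abs_triangle_ineq]])
        (simp add: add_ac)
  qed
  moreover have "continuous_on (cdom c \<times> UNIV) (\<lambda>(p, h). ?N p (coord_vec A c p h))" if "c \<in> A" for c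
    using continuous_on_coord_of_coord_vec[OF c b that] continuous_on_coord_of_coord_vec[OF c(2,3,1) b' that]
      continuous_on_coord_of_coord_vec[OF c(3,1,2) b'' that]
    unfolding case_prod_unfold by (intro continuous_on_add continuous_on_rabs)
  ultimately show ?thesis unfolding continuous_norm_def by blast
qed

end

context closed_manifold_flow
begin

text \<open>The field \<open>e - h X\<close> spans an invariant line if \<open>h\<close> is invariant under the affine cocycle with linear
  part \<open>f\<close> and translation part \<open>a\<close>. The sign \<open>\<epsilon>\<close> is the direction of time in which \<open>f\<close> contracts.\<close>

lemma
  assumes fr: "frame X e e'"
    and e: "\<And>t p. dflow t p (e p) = f t p *\<^sub>R e (\<phi> t p) + a t p *\<^sub>R X (\<phi> t p)"
  shows multiplier_minus: "f (- t) p * f t (\<phi> (- t) p) = 1"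
    and ex_invariant_correction: "\<And>K \<epsilon>. 0 < K \<Longrightarrow> \<bar>\<epsilon>\<bar> = 1 \<Longrightarrow> (\<And>t p. 0 \<le> t \<Longrightarrow> \<bar>f (\<epsilon> * t) p\<bar> \<le> exp (- K * t)) \<Longrightarrow>
      \<exists>h. continuous_on UNIV h \<and>
        (\<forall>t p. dflow t p (e p - h p *\<^sub>R X p) = f t p *\<^sub>R (e (\<phi> t p) - h (\<phi> t p) *\<^sub>R X (\<phi> t p)))"
proof -
  have b: "tangent_basis p (X p) (e p) (e' p)" for p using fr unfolding frame_def by blast
  have c: "continuous_vector_field_on A UNIV X" "continuous_vector_field_on A UNIV e" "continuous_vector_field_on A UNIV e'"
    using fr unfolding frame_def by blast+
  have et: "e p \<in> tangent_space A p" for p using b unfolding tangent_basis_def by blast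
  have "e p = f 0 p *\<^sub>R e p + a 0 p *\<^sub>R X p" for p
    using e[of 0 p] dflow_0[OF et] by simp
  then have "0 *\<^sub>R X p + 1 *\<^sub>R e p + 0 *\<^sub>R e' p = a 0 p *\<^sub>R X p + f 0 p *\<^sub>R e p + 0 *\<^sub>R e' p" for p
    by (simp add: add.commute)
  then have f0: "f 0 p = 1" for p using tangent_basis_unique(2)[OF b] by metis
  have "f (s + t) p *\<^sub>R e (\<phi> s (\<phi> t p)) + a (s + t) p *\<^sub>R X (\<phi> s (\<phi> t p))
      = dflow s (\<phi> t p) (f t p *\<^sub>R e (\<phi> t p) + a t p *\<^sub>R X (\<phi> t p))" for s t p
    unfolding e[symmetric] flow_add[symmetric] by (rule dflow_add[OF et])
  then have "a (s + t) p *\<^sub>R X (\<phi> s (\<phi> t p)) + f (s + t) p *\<^sub>R e (\<phi> s (\<phi> t p)) + 0 *\<^sub>R e' (\<phi> s (\<phi> t p))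
      = (f t p * a s (\<phi> t p) + a t p) *\<^sub>R X (\<phi> s (\<phi> t p)) + (f t p * f s (\<phi> t p)) *\<^sub>R e (\<phi> s (\<phi> t p))
        + 0 *\<^sub>R e' (\<phi> s (\<phi> t p))" for s t p
    by (simp add: linear_add[OF dflow_linear] linear_cmul[OF dflow_linear] dflow_X e
        scaleR_add_left scaleR_add_right add_ac)
  from tangent_basis_unique[OF b this]
  have ac: "a (s + t) p = f t p * a s (\<phi> t p) + a t p" and fc: "f (s + t) p = f t p * f s (\<phi> t p)" for s t p
    by blast+
  show "f (- t) p * f t (\<phi> (- t) p) = 1" using fc[of t "- t" p] f0 by simp
  have along: "continuous_along UNIV (\<phi> t) (\<lambda>p. Y (\<phi> t p))" if "continuous_vector_field_on A UNIV Y" for Y t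
    by (rule continuous_along_compose[OF that continuous_flow])
  have push: "continuous_along UNIV (\<phi> t) (\<lambda>p. dflow t p (e p))" for t
    by (rule continuous_along_pushforward[OF flow_C1_near c(2)])
  have eq: "dflow t p (e p) = a t p *\<^sub>R X (\<phi> t p) + f t p *\<^sub>R e (\<phi> t p) + 0 *\<^sub>R e' (\<phi> t p)"
    "dflow t p (e p) = f t p *\<^sub>R e (\<phi> t p) + 0 *\<^sub>R e' (\<phi> t p) + a t p *\<^sub>R X (\<phi> t p)" for t p
    by (simp_all add: e add.commute)
  have "coord (\<phi> t p) (X (\<phi> t p)) (e (\<phi> t p)) (e' (\<phi> t p)) (dflow t p (e p)) = a t p" for t p
    unfolding eq(1) by (rule coord_combination[OF b])
  then have ca: "continuous_on UNIV (a t)" for t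
    using continuous_on_coord[OF open_UNIV continuous_flow along[OF c(1)] along[OF c(2)] along[OF c(3)] push b, of t]
    by simp
  have "coord (\<phi> t p) (e (\<phi> t p)) (e' (\<phi> t p)) (X (\<phi> t p)) (dflow t p (e p)) = f t p" for t p
    unfolding eq(2) by (rule coord_combination[OF tangent_basis_rotate[OF b]])
  then have cf: "continuous_on UNIV (f t)" for t
    using continuous_on_coord[OF open_UNIV continuous_flow along[OF c(2)] along[OF c(3)] along[OF c(1)] push
        tangent_basis_rotate[OF b], of t]
    by simp
  fix K \<epsilon> :: real
  assume K: "0 < K" and \<epsilon>: "\<bar>\<epsilon>\<bar> = 1" and contr: "\<And>t p. 0 \<le> t \<Longrightarrow> \<bar>f (\<epsilon> * t) p\<bar> \<le> exp (- K * t)"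
  obtain h where h: "continuous_on UNIV h" "\<And>t p. h p = f (\<epsilon> * t) p * h (\<phi> (\<epsilon> * t) p) + a (\<epsilon> * t) p"
  proof (rule affine_cocycle_invariant_section[of "\<lambda>t. \<phi> (\<epsilon> * t)" "\<lambda>t. f (\<epsilon> * t)" "\<lambda>t. a (\<epsilon> * t)" K])
    show "a (\<epsilon> * (s + t)) p = f (\<epsilon> * t) p * a (\<epsilon> * s) (\<phi> (\<epsilon> * t) p) + a (\<epsilon> * t) p" for s t p
      unfolding distrib_left by (rule ac)
  qed (use compact_manifold continuous_flow cf ca contr K in auto)
  have h': "h p = f t p * h (\<phi> t p) + a t p" for t p
  proof -
    have \<epsilon>2: "\<epsilon> * (\<epsilon> * t) = t"
    proof -
      have "\<epsilon> * \<epsilon> = 1" using \<epsilon> by (metis abs_mult_self_eq mult_1)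
      then show ?thesis by (simp add: mult.assoc[symmetric])
    qed
    show ?thesis using h(2)[of p "\<epsilon> * t"] unfolding \<epsilon>2 .
  qed
  have "dflow t p (e p - h p *\<^sub>R X p) = f t p *\<^sub>R (e (\<phi> t p) - h (\<phi> t p) *\<^sub>R X (\<phi> t p))" for t p
  proof -
    have "dflow t p (e p - h p *\<^sub>R X p) = f t p *\<^sub>R e (\<phi> t p) + a t p *\<^sub>R X (\<phi> t p) - h p *\<^sub>R X (\<phi> t p)"
      by (simp add: linear_diff[OF dflow_linear] linear_cmul[OF dflow_linear] dflow_X e)
    then show ?thesis by (simp add: h'[of p t] scaleR_add_left scaleR_diff_right)
  qed
  then show "\<exists>h. continuous_on UNIV h \<and>
      (\<forall>t p. dflow t p (e p - h p *\<^sub>R X p) = f t p *\<^sub>R (e (\<phi> t p) - h (\<phi> t p) *\<^sub>R X (\<phi> t p)))"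
    using h(1) by blast
qed

lemma invariant_line:
  assumes "\<And>t p. dflow t p (Y p) = f t p *\<^sub>R Y (\<phi> t p)" "\<And>t p. f t p \<noteq> 0"
  shows "invariant_field A \<phi> (\<lambda>p. span {Y p})"
  unfolding invariant_field_def
proof (intro allI)
  fix t p
  have "dflow t p ` span {Y p} = span {dflow t p (Y p)}"
    using linear_span_image[OF dflow_linear, of t p "{Y p}"] by simp
  also have "\<dots> = span {Y (\<phi> t p)}"
  proof (intro equalityI span_minimal subspace_span)
    show "{dflow t p (Y p)} \<subseteq> span {Y (\<phi> t p)}"
      by (simp add: assms(1) span_scale span_base)
    have "Y (\<phi> t p) = inverse (f t p) *\<^sub>R dflow t p (Y p)" using assms(2) by (simp add: assms(1))
    then show "{Y (\<phi> t p)} \<subseteq> span {dflow t p (Y p)}"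
      by (metis empty_subsetI insert_subset singletonI span_base span_scale)
  qed
  finally show "dflow t p ` span {Y p} = span {Y (\<phi> t p)}" .
qed

text \<open>Corrected by multiples of \<open>X\<close>, found with the direction of time in which the respective line
  contracts, \<open>e1\<close> and \<open>e2\<close> span invariant lines. For the norm that adds the absolute values of the
  coordinates with respect to \<open>X\<close> and the corrected fields, the rates on these lines are \<open>\<bar>f\<bar>\<close> and \<open>\<bar>g\<bar>\<close>
  themselves, so that no constant appears in front of the exponentials.\<close>

lemma anosov_if_hyperbolic_frame:
  assumes fr: "frame X e1 e2" and K: "0 < K"
    and e1: "\<And>t p. dflow t p (e1 p) = f t p *\<^sub>R e1 (\<phi> t p) + a t p *\<^sub>R X (\<phi> t p)"
    and e2: "\<And>t p. dflow t p (e2 p) = g t p *\<^sub>R e2 (\<phi> t p) + b t p *\<^sub>R X (\<phi> t p)"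
    and f: "\<And>t p. 0 \<le> t \<Longrightarrow> \<bar>f t p\<bar> \<le> exp (- K * t)"
    and g: "\<And>t p. 0 \<le> t \<Longrightarrow> exp (K * t) \<le> \<bar>g t p\<bar>"
  shows "anosov A X \<phi>"
proof -
  have bas: "tangent_basis p (X p) (e1 p) (e2 p)" for p using fr unfolding frame_def by blast
  have c: "continuous_vector_field_on A UNIV X" "continuous_vector_field_on A UNIV e1" "continuous_vector_field_on A UNIV e2"
    using fr unfolding frame_def by blast+
  have fr': "frame X e2 e1" using fr tangent_basis_swap unfolding frame_def by blast
  have "\<exists>h. continuous_on UNIV h \<and>
      (\<forall>t p. dflow t p (e1 p - h p *\<^sub>R X p) = f t p *\<^sub>R (e1 (\<phi> t p) - h (\<phi> t p) *\<^sub>R X (\<phi> t p)))"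
    by (rule ex_invariant_correction[OF fr e1 K, of 1]) (simp_all add: f[simplified])
  then obtain h where h: "continuous_on UNIV h"
    "\<And>t p. dflow t p (e1 p - h p *\<^sub>R X p) = f t p *\<^sub>R (e1 (\<phi> t p) - h (\<phi> t p) *\<^sub>R X (\<phi> t p))"
    by blast
  have backward: "\<bar>g (- t) p\<bar> \<le> exp (- K * t)" if t: "0 \<le> t" for t p
  proof -
    have "\<bar>g (- t) p\<bar> * exp (K * t) \<le> \<bar>g (- t) p\<bar> * \<bar>g t (\<phi> (- t) p)\<bar>"
      by (intro mult_left_mono g t) simp
    also have "\<dots> = 1" using multiplier_minus[OF fr' e2, of t p] by (simp flip: abs_mult)
    finally show ?thesis by (simp add: exp_minus field_simps)
  qed
  have "\<exists>k. continuous_on UNIV k \<and>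
      (\<forall>t p. dflow t p (e2 p - k p *\<^sub>R X p) = g t p *\<^sub>R (e2 (\<phi> t p) - k (\<phi> t p) *\<^sub>R X (\<phi> t p)))"
    by (rule ex_invariant_correction[OF fr' e2 K, of "-1"]) (simp_all add: backward[simplified])
  then obtain k where k: "continuous_on UNIV k"
    "\<And>t p. dflow t p (e2 p - k p *\<^sub>R X p) = g t p *\<^sub>R (e2 (\<phi> t p) - k (\<phi> t p) *\<^sub>R X (\<phi> t p))"
    by blast
  define u where "u p = e1 p - h p *\<^sub>R X p" for p
  define v where "v p = e2 p - k p *\<^sub>R X p" for p
  have du: "dflow t p (u p) = f t p *\<^sub>R u (\<phi> t p)" and dv: "dflow t p (v p) = g t p *\<^sub>R v (\<phi> t p)" for t p
    unfolding u_def v_def by (rule h(2) k(2))+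
  have f0: "f t p \<noteq> 0" for t p using multiplier_minus[OF fr e1, of "- t" "p"] multiplier_minus[OF fr e1, of t "\<phi> t p"] by auto
  have g0: "g t p \<noteq> 0" for t p using multiplier_minus[OF fr' e2, of t "\<phi> t p"] by auto
  have cu: "continuous_vector_field_on A UNIV u" "continuous_vector_field_on A UNIV v"
    using continuous_vector_field_combination[OF open_UNIV c(2) c(1) continuous_on_const[of _ 1] continuous_on_minus[OF h(1)]]
      continuous_vector_field_combination[OF open_UNIV c(3) c(1) continuous_on_const[of _ 1] continuous_on_minus[OF k(1)]]
    unfolding u_def[abs_def] v_def[abs_def] by simp_all
  have basis: "tangent_basis p (u p) (v p) (X p)" for p
    unfolding tangent_basis_def
  proof (intro conjI ballI)
    show "u p \<in> tangent_space A p" "v p \<in> tangent_space A p" "X p \<in> tangent_space A p"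
      using cu X_tangent unfolding continuous_vector_field_on_def by auto
    fix z assume "z \<in> tangent_space A p"
    then obtain x a b where "z = x *\<^sub>R X p + a *\<^sub>R e1 p + b *\<^sub>R e2 p"
      using bas unfolding tangent_basis_def by blast
    then have "z = a *\<^sub>R u p + b *\<^sub>R v p + (x + a * h p + b * k p) *\<^sub>R X p"
      by (simp add: u_def v_def scaleR_diff_right scaleR_add_left)
    then show "\<exists>x a b. z = x *\<^sub>R u p + a *\<^sub>R v p + b *\<^sub>R X p" by blast
  qed
  have fruv: "frame u v X" using cu c(1) basis unfolding frame_def by blast
  note b1 = coord_basis[OF basis] coord_basis[OF tangent_basis_rotate[OF basis]]
    coord_basis[OF tangent_basis_rotate[OF tangent_basis_rotate[OF basis]]]
  define N where "N p z = \<bar>coord p (u p) (v p) (X p) z\<bar> + \<bar>coord p (v p) (X p) (u p) z\<bar>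
    + \<bar>coord p (X p) (u p) (v p) z\<bar>" for p z
  have Nu: "N p (r *\<^sub>R u p) = \<bar>r\<bar>" "N p (r *\<^sub>R v p) = \<bar>r\<bar>" for p r
    unfolding N_def by (simp_all add: linear_cmul[OF coord_linear] b1)
  have nz: "u p \<noteq> 0" "v p \<noteq> 0" for p using Nu[of p 1] unfolding N_def by (auto simp: linear_0[OF coord_linear])
  show ?thesis
    unfolding anosov_def
  proof (intro exI conjI allI ballI impI)
    show "continuous_line_bundle A (\<lambda>p. span {u p})" "continuous_line_bundle A (\<lambda>p. span {v p})"
      unfolding continuous_line_bundle_def using cu nz by blast+
    show "invariant_field A \<phi> (\<lambda>p. span {u p})" by (rule invariant_line[OF du f0])
    show "invariant_field A \<phi> (\<lambda>p. span {v p})" by (rule invariant_line[OF dv g0])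
    fix p
    show "tangent_space A p = span {u p} + span {v p} + span {X p}"
    proof (intro set_eqI iffI)
      fix z assume "z \<in> tangent_space A p"
      then obtain x a b where "z = x *\<^sub>R u p + a *\<^sub>R v p + b *\<^sub>R X p"
        using basis unfolding tangent_basis_def by blast
      moreover have "x *\<^sub>R u p + a *\<^sub>R v p + b *\<^sub>R X p \<in> span {u p} + span {v p} + span {X p}"
        by (intro set_plus_intro span_scale span_base singletonI)
      ultimately show "z \<in> span {u p} + span {v p} + span {X p}" by simp
    next
      fix z assume "z \<in> span {u p} + span {v p} + span {X p}"
      then obtain x a b where "z = x *\<^sub>R u p + a *\<^sub>R v p + b *\<^sub>R X p"
        unfolding span_singleton by (auto elim!: set_plus_elim)
      then show "z \<in> tangent_space A p"
        using basis[of p] unfolding tangent_basis_def by (auto intro!: tangent_space_intros)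
    qed
    fix z1 z2 z3 assume "z1 \<in> span {u p}" "z2 \<in> span {v p}" "z3 \<in> span {X p}" and sum: "z1 + z2 + z3 = 0"
    then obtain r1 r2 r3 where r: "z1 = r1 *\<^sub>R u p" "z2 = r2 *\<^sub>R v p" "z3 = r3 *\<^sub>R X p"
      unfolding span_singleton by blast
    then have "r1 *\<^sub>R u p + r2 *\<^sub>R v p + r3 *\<^sub>R X p = 0 *\<^sub>R u p + 0 *\<^sub>R v p + 0 *\<^sub>R X p" using sum by simp
    from tangent_basis_unique[OF basis this] show "z1 = 0" "z2 = 0" "z3 = 0" unfolding r by simp_all
  next
    show "0 < K" by (rule K)
    show "continuous_norm A N"
      using continuous_norm_of_frame[OF fruv] unfolding N_def[abs_def] .
    fix t :: real and p z assume t: "0 \<le> t"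
    show "N (\<phi> t p) (dflow t p z) \<le> exp (- K * t) * N p z" if zu: "z \<in> span {u p}"
    proof -
      obtain r where z: "z = r *\<^sub>R u p" using zu unfolding span_singleton by blast
      have "N (\<phi> t p) (dflow t p z) = \<bar>r * f t p\<bar>"
        unfolding z linear_cmul[OF dflow_linear] du by (simp add: Nu)
      then show ?thesis
        unfolding z Nu using mult_left_mono[OF f[OF t, of p], of "\<bar>r\<bar>"] by (simp add: abs_mult mult.commute)
    qed
    show "exp (K * t) * N p z \<le> N (\<phi> t p) (dflow t p z)" if zu: "z \<in> span {v p}"
    proof -
      obtain r where z: "z = r *\<^sub>R v p" using zu unfolding span_singleton by blast
      have "N (\<phi> t p) (dflow t p z) = \<bar>r * g t p\<bar>"
        unfolding z linear_cmul[OF dflow_linear] dv by (simp add: Nu)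
      then show ?thesis
        unfolding z Nu using mult_left_mono[OF g[OF t, of p], of "\<bar>r\<bar>"] by (simp add: abs_mult mult.commute)
    qed
  qed
qed

end

section \<open>Flows that preserve a volume form\<close>

lemma linear_form_combination:
  assumes f: "linear_form_on V f" and V: "subspace V" and "u \<in> V" "v \<in> V" "w \<in> V"
  shows "f (x *\<^sub>R u + a *\<^sub>R v + b *\<^sub>R w) = x * f u + a * f v + b * f w"
proof -
  have uv: "x *\<^sub>R u + a *\<^sub>R v \<in> V" using assms by (simp add: subspace_add subspace_scale)
  have "f (1 *\<^sub>R (x *\<^sub>R u + a *\<^sub>R v) + b *\<^sub>R w) = 1 * f (x *\<^sub>R u + a *\<^sub>R v) + b * f w"
    using f uv assms(5) unfolding linear_form_on_def by blast
  moreover have "f (x *\<^sub>R u + a *\<^sub>R v) = x * f u + a * f v"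
    using f assms(3,4) unfolding linear_form_on_def by blast
  ultimately show ?thesis by simp
qed

lemma alternating_3_formD:
  assumes "alternating_3_form_on V \<omega>" "u \<in> V" "v \<in> V"
  shows "linear_form_on V (\<lambda>w. \<omega> w u v)" "linear_form_on V (\<lambda>w. \<omega> u w v)" "linear_form_on V (\<lambda>w. \<omega> u v w)"
    and "\<omega> u u v = 0" "\<omega> u v u = 0" "\<omega> v u u = 0"
  using assms unfolding alternating_3_form_on_def by blast+

lemma alternating_3_form_swap:
  assumes \<omega>: "alternating_3_form_on V \<omega>" and V: "subspace V" and m: "u \<in> V" "v \<in> V" "w \<in> V"
  shows "\<omega> v u w = - \<omega> u v w" "\<omega> u w v = - \<omega> u v w"
proof -
  note [simp] = alternating_3_formD(4-6)[OF \<omega>] m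
  have uv: "u + v \<in> V" and vw: "v + w \<in> V" using subspace_add[OF V] m by blast+
  have "\<omega> (u + v) (u + v) w = 0" using uv m(3) alternating_3_formD(4)[OF \<omega>] by blast
  moreover have "\<omega> (u + v) (u + v) w = \<omega> u (u + v) w + \<omega> v (u + v) w"
    using linear_form_combination[OF alternating_3_formD(1)[OF \<omega> uv m(3)] V m(1,2,1), of 1 1 0] by simp
  moreover have "\<omega> u (u + v) w = \<omega> u u w + \<omega> u v w"
    using linear_form_combination[OF alternating_3_formD(2)[OF \<omega> m(1,3)] V m(1,2,1), of 1 1 0] by simp
  moreover have "\<omega> v (u + v) w = \<omega> v u w + \<omega> v v w"
    using linear_form_combination[OF alternating_3_formD(2)[OF \<omega> m(2,3)] V m(1,2,1), of 1 1 0] by simp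
  ultimately show "\<omega> v u w = - \<omega> u v w" by simp
  have "\<omega> u (v + w) (v + w) = 0" using vw m(1) alternating_3_formD(6)[OF \<omega>] by blast
  moreover have "\<omega> u (v + w) (v + w) = \<omega> u v (v + w) + \<omega> u w (v + w)"
    using linear_form_combination[OF alternating_3_formD(2)[OF \<omega> m(1) vw] V m(2,3,1), of 1 1 0] by simp
  moreover have "\<omega> u v (v + w) = \<omega> u v v + \<omega> u v w"
    using linear_form_combination[OF alternating_3_formD(3)[OF \<omega> m(1,2)] V m(2,3,1), of 1 1 0] by simp
  moreover have "\<omega> u w (v + w) = \<omega> u w v + \<omega> u w w"
    using linear_form_combination[OF alternating_3_formD(3)[OF \<omega> m(1,3)] V m(2,3,1), of 1 1 0] by simp
  ultimately show "\<omega> u w v = - \<omega> u v w" by simp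
qed

lemma alternating_3_form_zero_on_span:
  assumes \<omega>: "alternating_3_form_on V \<omega>" and V: "subspace V" and m: "u \<in> V" "v \<in> V" "w \<in> V"
    and span: "\<And>z. z \<in> V \<Longrightarrow> \<exists>x a b. z = x *\<^sub>R u + a *\<^sub>R v + b *\<^sub>R w"
    and 0: "\<omega> u v w = 0" and z: "z1 \<in> V" "z2 \<in> V" "z3 \<in> V"
  shows "\<omega> z1 z2 z3 = 0"
proof -
  note sw = alternating_3_form_swap[OF \<omega> V]
  have p1: "\<omega> v u w = 0" and p2: "\<omega> u w v = 0" using sw[OF m] 0 by simp_all
  have p3: "\<omega> v w u = 0" using sw(2)[OF m(2,1,3)] p1 by simp
  have p4: "\<omega> w u v = 0" using sw(1)[OF m(1,3,2)] p2 by simp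
  have p5: "\<omega> w v u = 0" using sw(1)[OF m(2,3,1)] p3 by simp
  note perm = p1 p2 p3 p4 p5
  have basis: "\<omega> b1 b2 b3 = 0" if "b1 \<in> {u, v, w}" "b2 \<in> {u, v, w}" "b3 \<in> {u, v, w}" for b1 b2 b3
    using that perm 0 alternating_3_formD(4-6)[OF \<omega>] m by auto
  have 3: "\<omega> b1 b2 z = 0" if "b1 \<in> {u, v, w}" "b2 \<in> {u, v, w}" "z \<in> V" for b1 b2 z
  proof -
    have "b1 \<in> V" "b2 \<in> V" using that m by auto
    moreover obtain x a b where "z = x *\<^sub>R u + a *\<^sub>R v + b *\<^sub>R w" using span \<open>z \<in> V\<close> by blast
    ultimately show ?thesis
      using linear_form_combination[OF alternating_3_formD(3)[OF \<omega>] V m, of b1 b2 x a b] that basis by simp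
  qed
  have 2: "\<omega> b1 y z = 0" if "b1 \<in> {u, v, w}" "y \<in> V" "z \<in> V" for b1 y z
  proof -
    have "b1 \<in> V" using that m by auto
    moreover obtain x a b where "y = x *\<^sub>R u + a *\<^sub>R v + b *\<^sub>R w" using span \<open>y \<in> V\<close> by blast
    ultimately show ?thesis
      using linear_form_combination[OF alternating_3_formD(2)[OF \<omega>] V m, of b1 z x a b] that 3 by simp
  qed
  obtain x a b where "z1 = x *\<^sub>R u + a *\<^sub>R v + b *\<^sub>R w" using span z by blast
  then show ?thesis
    using linear_form_combination[OF alternating_3_formD(1)[OF \<omega> z(2,3)] V m, of x a b] z 2 by simp
qed

context smooth_atlas
begin

text \<open>Forms are only known to be continuous or differentiable on coordinate fields, so they are expanded
  in these.\<close>

lemma linear_form_coord_vec_expand: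
  assumes f: "linear_form_on (tangent_space A p) f" and c: "c \<in> A" "p \<in> cdom c" and v: "v \<in> tangent_space A p"
  shows "f v = (\<Sum>i\<in>Basis. (v c \<bullet> i) * f (coord_vec A c p i))"
proof -
  have "linear (\<lambda>h. f (coord_vec A c p h))"
  proof (rule linearI)
    have lin: "f (a *\<^sub>R x + b *\<^sub>R y) = a * f x + b * f y"
      if "x \<in> tangent_space A p" "y \<in> tangent_space A p" for x y a b
      using f that unfolding linear_form_on_def by blast
    note cv = coord_vec_in_tangent_space[OF c]
    show "f (coord_vec A c p (h + k)) = f (coord_vec A c p h) + f (coord_vec A c p k)" for h k
      using lin[OF cv cv, of 1 h 1 k] by (simp add: linear_add[OF coord_vec_linear[OF c]])
    show "f (coord_vec A c p (r *\<^sub>R h)) = r *\<^sub>R f (coord_vec A c p h)" for r h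
      using lin[OF cv cv, of r h 0 h] by (simp add: linear_cmul[OF coord_vec_linear[OF c]])
  qed
  from linear_functional_expand[OF this, of "v c"] show ?thesis
    unfolding coord_vec_component[OF v c] .
qed

lemma continuous_on_volume_form:
  assumes \<omega>: "C0_volume_form A \<omega>"
    and Y: "continuous_vector_field_on A UNIV Y1" "continuous_vector_field_on A UNIV Y2"
      "continuous_vector_field_on A UNIV Y3"
  shows "continuous_on UNIV (\<lambda>p. \<omega> p (Y1 p) (Y2 p) (Y3 p))"
proof (rule continuous_at_imp_continuous_on, rule ballI)
  fix p
  let ?c = "chart_at A p"
  note c = chart_at_in[of p]
  have cY: "continuous_on (cdom ?c) (\<lambda>q. Y q ?c)" if "continuous_vector_field_on A UNIV Y" for Y
    using that c unfolding continuous_vector_field_on_def by simp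
  have Yt: "Y1 q \<in> tangent_space A q" "Y2 q \<in> tangent_space A q" "Y3 q \<in> tangent_space A q" for q
    using Y unfolding continuous_vector_field_on_def by auto
  let ?e = "\<lambda>q i. coord_vec A ?c q i"
  have "\<omega> q (Y1 q) (Y2 q) (Y3 q) = (\<Sum>i\<in>Basis. (Y1 q ?c \<bullet> i) * (\<Sum>j\<in>Basis. (Y2 q ?c \<bullet> j) *
      (\<Sum>k\<in>Basis. (Y3 q ?c \<bullet> k) * \<omega> q (?e q i) (?e q j) (?e q k))))" if q: "q \<in> cdom ?c" for q
  proof -
    have alt: "alternating_3_form_on (tangent_space A q) (\<omega> q)"
      using \<omega> unfolding C0_volume_form_def by blast
    note ct = coord_vec_in_tangent_space[OF c q] and ex = linear_form_coord_vec_expand[OF _ c q]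
    show ?thesis
      unfolding ex[OF alternating_3_formD(1)[OF alt Yt(2,3)] Yt(1)]
        ex[OF alternating_3_formD(2)[OF alt ct Yt(3)] Yt(2)] ex[OF alternating_3_formD(3)[OF alt ct ct] Yt(3)] ..
  qed
  moreover have *: "continuous_on (cdom ?c) (\<lambda>q. \<omega> q (?e q i) (?e q j) (?e q k))" for i j k
    using \<omega> c unfolding C0_volume_form_def by blast
  have "continuous_on (cdom ?c) (\<lambda>q. \<Sum>i\<in>Basis. (Y1 q ?c \<bullet> i) * (\<Sum>j\<in>Basis. (Y2 q ?c \<bullet> j) *
      (\<Sum>k\<in>Basis. (Y3 q ?c \<bullet> k) * \<omega> q (?e q i) (?e q j) (?e q k))))"
    by (intro continuous_intros cY Y *)
  ultimately have "continuous_on (cdom ?c) (\<lambda>q. \<omega> q (Y1 q) (Y2 q) (Y3 q))"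
    by (simp cong: continuous_on_cong_simp)
  then show "isCont (\<lambda>p. \<omega> p (Y1 p) (Y2 p) (Y3 p)) p"
    using in_chart_at[of p] by (simp add: continuous_on_eq_continuous_at[OF open_cdom[OF c]])
qed

lemma continuous_on_quotient_norm:
  assumes N: "continuous_quotient_norm A X N" and Y: "continuous_vector_field_on A UNIV Y"
  shows "continuous_on UNIV (\<lambda>p. N p (qclass X p (Y p)))"
proof (rule continuous_at_imp_continuous_on, rule ballI)
  fix p
  let ?c = "chart_at A p"
  note c = chart_at_in[of p]
  have 1: "continuous_on (cdom ?c \<times> UNIV) (\<lambda>(p, h). N p (qclass X p (coord_vec A ?c p h)))"
    using N c unfolding continuous_quotient_norm_def by blast
  have cY: "continuous_on (cdom ?c) (\<lambda>q. (q, Y q ?c))"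
    using Y c unfolding continuous_vector_field_on_def by (simp add: continuous_on_Pair continuous_on_id)
  have "continuous_on (cdom ?c) (\<lambda>q. case (q, Y q ?c) of (p, h) \<Rightarrow> N p (qclass X p (coord_vec A ?c p h)))"
    by (rule continuous_on_compose2[OF 1 cY]) auto
  moreover have "coord_vec A ?c q (Y q ?c) = Y q" if "q \<in> cdom ?c" for q
    using Y c that unfolding continuous_vector_field_on_def by (simp add: coord_vec_component)
  ultimately have "continuous_on (cdom ?c) (\<lambda>q. N q (qclass X q (Y q)))"
    by (simp cong: continuous_on_cong_simp)
  then show "isCont (\<lambda>p. N p (qclass X p (Y p))) p"
    using in_chart_at[of p] by (simp add: continuous_on_eq_continuous_at[OF open_cdom[OF c]])
qed

end

context closed_manifold_flow
begin

lemma dflow_qclass: "dflow t p ` qclass X p v = qclass X (\<phi> t p) (dflow t p v)"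
proof (intro set_eqI iffI)
  fix w
  have eq: "dflow t p (v + k *\<^sub>R X p) = dflow t p v + k *\<^sub>R X (\<phi> t p)" for k
    by (simp add: linear_add[OF dflow_linear] linear_cmul[OF dflow_linear] dflow_X)
  show "w \<in> qclass X (\<phi> t p) (dflow t p v)" if "w \<in> dflow t p ` qclass X p v"
    using that eq unfolding mem_qclass by (auto simp: mem_qclass)
  show "w \<in> dflow t p ` qclass X p v" if w: "w \<in> qclass X (\<phi> t p) (dflow t p v)"
  proof -
    obtain k where "w = dflow t p (v + k *\<^sub>R X p)" using w unfolding mem_qclass eq by blast
    moreover have "v + k *\<^sub>R X p \<in> qclass X p v" unfolding mem_qclass by blast
    ultimately show ?thesis by blast
  qed
qed

text \<open>The preserved volume form induces an invariant area form on the quotient by \<open>X\<close>. In generators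
  \<open>e\<^sub>1, e\<^sub>2\<close> of the two lines that have equal length and span area one, the product of the two
  expansion rates is one in absolute value, and domination bounds their ratio below by \<open>exp (C t)\<close>;
  hence the rates are at most \<open>exp (- C t / 2)\<close> and at least \<open>exp (C t / 2)\<close>.\<close>

lemma anosov_if_volume_preserving:
  assumes X0: "\<And>p. X p \<noteq> 0" and pa: "projectively_anosov_splitting A X \<phi> Es Eu"
    and ors: "transversely_orientable A (plane_over Es)" and oru: "transversely_orientable A (plane_over Eu)"
    and \<omega>: "C0_volume_form A \<omega>" and pres: "preserves_3_form A \<phi> \<omega>"
  shows "anosov A X \<phi>"
proof -
  note pa' = pa[unfolded projectively_anosov_splitting_def]
  have Es: "continuous_quotient_line_bundle A X Es" by (rule pa'[THEN conjunct1])
  have Eu: "continuous_quotient_line_bundle A X Eu" by (rule pa'[THEN conjunct2, THEN conjunct1])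
  have inv: "quotient_pushforward A (\<phi> t) p ` Es p = Es (\<phi> t p)"
      "quotient_pushforward A (\<phi> t) p ` Eu p = Eu (\<phi> t p)" for t p
    using pa'[THEN conjunct2, THEN conjunct2, THEN conjunct1] by simp_all
  have split: "quotient_space A X p = Es p + Eu p" for p
    using pa'[THEN conjunct2, THEN conjunct2, THEN conjunct2, THEN conjunct1] by simp
  obtain C N where C: "0 < C" and CN: "continuous_quotient_norm A X N \<and> (\<forall>t\<ge>0. \<forall>p.
      \<forall>u \<in> Es p - {qclass X p 0}. \<forall>v \<in> Eu p - {qclass X p 0}.
        N (\<phi> t p) (quotient_pushforward A (\<phi> t) p v) / N (\<phi> t p) (quotient_pushforward A (\<phi> t) p u)
          \<ge> exp (C * t) * (N p v / N p u))"
    using pa'[THEN conjunct2, THEN conjunct2, THEN conjunct2, THEN conjunct2] by (elim exE conjE) blast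
  note N = CN[THEN conjunct1] and dom = CN[THEN conjunct2, rule_format]
  obtain d1 where d1: "continuous_vector_field_on A UNIV d1" "\<And>p. Es p = {qclass X p (a *\<^sub>R d1 p) | a. True}"
    using ex_global_lift[OF X0 Es Eu split oru] by blast
  have split': "quotient_space A X p = Eu p + Es p" for p
    using split[of p] by (simp add: add.commute)
  obtain d2 where d2: "continuous_vector_field_on A UNIV d2" "\<And>p. Eu p = {qclass X p (a *\<^sub>R d2 p) | a. True}"
    using ex_global_lift[OF X0 Eu Es split' ors] by blast
  have dt: "d1 p \<in> tangent_space A p" "d2 p \<in> tangent_space A p" for p
    using d1(1) d2(1) unfolding continuous_vector_field_on_def by blast+
  have bd: "tangent_basis p (X p) (d1 p) (d2 p)" for p
    by (rule tangent_basis_of_splitting[OF d1(2) d2(2) split X_tangent dt])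
  have alt: "alternating_3_form_on (tangent_space A p) (\<omega> p)" for p
    using \<omega> unfolding C0_volume_form_def by blast
  note sub = subspace_tangent_space
  define \<rho> where "\<rho> p = \<bar>\<omega> p (X p) (d1 p) (d2 p)\<bar>" for p
  have \<rho>: "0 < \<rho> p" for p
  proof (rule ccontr)
    assume "\<not> 0 < \<rho> p"
    then have 0: "\<omega> p (X p) (d1 p) (d2 p) = 0" unfolding \<rho>_def by simp
    have sp: "\<exists>x a b. z = x *\<^sub>R X p + a *\<^sub>R d1 p + b *\<^sub>R d2 p" if "z \<in> tangent_space A p" for z
      using bd that unfolding tangent_basis_def by blast
    obtain z1 z2 z3 where z: "z1 \<in> tangent_space A p" "z2 \<in> tangent_space A p" "z3 \<in> tangent_space A p"
      "\<omega> p z1 z2 z3 \<noteq> 0"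
      using \<omega> unfolding C0_volume_form_def by blast
    then show False
      using alternating_3_form_zero_on_span[OF alt sub X_tangent dt sp 0 z(1-3)] by blast
  qed
  define n1 where "n1 p = N p (qclass X p (d1 p))" for p
  define n2 where "n2 p = N p (qclass X p (d2 p))" for p
  have Nscale: "N p (qclass X p (r *\<^sub>R v)) = \<bar>r\<bar> * N p (qclass X p v)" if "v \<in> tangent_space A p" for p r v
    using N that unfolding continuous_quotient_norm_def by blast
  have nonzero: "qclass X p (r *\<^sub>R d1 p) \<noteq> qclass X p 0" "qclass X p (r *\<^sub>R d2 p) \<noteq> qclass X p 0"
    if "r \<noteq> 0" for p r
    using qclass_nonzero[of p X "d1 p" "d2 p" r, OF bd that]
      qclass_nonzero[of p X "d2 p" "d1 p" r, OF tangent_basis_swap[OF bd] that] by simp_all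
  have Npos: "0 < N p (qclass X p v)" if "v \<in> tangent_space A p" "qclass X p v \<noteq> qclass X p 0" for p v
  proof -
    have "qclass X p v \<in> quotient_space A X p" using that(1) unfolding quotient_space_def by blast
    then have "0 \<le> N p (qclass X p v)" "N p (qclass X p v) \<noteq> 0"
      using N that(2) unfolding continuous_quotient_norm_def by blast+
    then show ?thesis by simp
  qed
  have n: "0 < n1 p" "0 < n2 p" for p
    unfolding n1_def n2_def using Npos[OF dt(1)] Npos[OF dt(2)] nonzero[of 1 p] by auto
  \<comment> \<open>The solution of \<open>c1 c2 \<rho> = 1\<close> (area one) and \<open>c1 n1 = c2 n2\<close> (equal length).\<close>
  define c1 where "c1 p = sqrt (n2 p / (n1 p * \<rho> p))" for p
  define c2 where "c2 p = sqrt (n1 p / (n2 p * \<rho> p))" for p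
  have c: "0 < c1 p" "0 < c2 p" for p unfolding c1_def c2_def using n \<rho> by simp_all
  have c\<rho>: "c1 p * c2 p * \<rho> p = 1" for p
  proof -
    have "c1 p * c2 p = sqrt (1 / (\<rho> p)\<^sup>2)"
      unfolding c1_def c2_def real_sqrt_mult[symmetric] using n[of p] \<rho>[of p]
      by (simp add: field_simps power2_eq_square)
    also have "\<dots> = 1 / \<rho> p" using \<rho>[of p] by (simp add: real_sqrt_divide)
    finally show ?thesis using \<rho>[of p] by simp
  qed
  have cn: "c1 p * n1 p = c2 p * n2 p" for p
  proof -
    have "c1 p * n1 p = sqrt (n2 p / (n1 p * \<rho> p)) * sqrt ((n1 p)\<^sup>2)" unfolding c1_def using n[of p] by simp
    also have "\<dots> = sqrt (n1 p * n2 p / \<rho> p)"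
      unfolding real_sqrt_mult[symmetric] using n[of p] \<rho>[of p] by (simp add: field_simps power2_eq_square)
    also have "\<dots> = sqrt (n1 p / (n2 p * \<rho> p)) * sqrt ((n2 p)\<^sup>2)"
      unfolding real_sqrt_mult[symmetric] using n[of p] \<rho>[of p] by (simp add: field_simps power2_eq_square)
    also have "\<dots> = c2 p * n2 p" unfolding c2_def using n[of p] by simp
    finally show ?thesis .
  qed
  have cont: "continuous_on UNIV n1" "continuous_on UNIV n2" "continuous_on UNIV \<rho>"
    unfolding n1_def n2_def \<rho>_def
    by (intro continuous_on_quotient_norm[OF N] d1 d2 continuous_on_rabs
        continuous_on_volume_form[OF \<omega> continuous_X])+
  have cc: "continuous_on UNIV c1" "continuous_on UNIV c2"
    unfolding c1_def c2_def using n \<rho> cont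
    by (intro continuous_on_real_sqrt continuous_on_divide continuous_on_mult;
        simp add: less_imp_neq[THEN not_sym])+
  define e1 where "e1 p = c1 p *\<^sub>R d1 p" for p
  define e2 where "e2 p = c2 p *\<^sub>R d2 p" for p
  have ce: "continuous_vector_field_on A UNIV e1" "continuous_vector_field_on A UNIV e2"
    using continuous_vector_field_combination[OF open_UNIV d1(1) d1(1) cc(1) continuous_on_const[of _ 0]]
      continuous_vector_field_combination[OF open_UNIV d2(1) d2(1) cc(2) continuous_on_const[of _ 0]]
    unfolding e1_def[abs_def] e2_def[abs_def] by simp_all
  have et: "e1 p \<in> tangent_space A p" "e2 p \<in> tangent_space A p" for p
    unfolding e1_def e2_def by (intro tangent_space_intros dt)+
  have E: "Es p = {qclass X p (a *\<^sub>R e1 p) | a. True}" "Eu p = {qclass X p (a *\<^sub>R e2 p) | a. True}" for p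
  proof -
    have "\<exists>b. qclass X p (a *\<^sub>R d1 p) = qclass X p (b *\<^sub>R e1 p)" for a
      unfolding e1_def using c(1)[of p] by (intro exI[of _ "a / c1 p"]) simp
    moreover have "\<exists>b. qclass X p (a *\<^sub>R d2 p) = qclass X p (b *\<^sub>R e2 p)" for a
      unfolding e2_def using c(2)[of p] by (intro exI[of _ "a / c2 p"]) simp
    ultimately show "Es p = {qclass X p (a *\<^sub>R e1 p) | a. True}" "Eu p = {qclass X p (a *\<^sub>R e2 p) | a. True}"
      unfolding d1(2) d2(2) e1_def e2_def by (auto simp del: scaleR_scaleR) (auto intro: exI)
  qed
  have bas: "tangent_basis p (X p) (e1 p) (e2 p)" for p
    by (rule tangent_basis_of_splitting[OF E split X_tangent et])
  have fr: "frame X e1 e2" using continuous_X ce bas unfolding frame_def by blast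
  have \<omega>e: "\<bar>\<omega> p (X p) (e1 p) (e2 p)\<bar> = 1" for p
  proof -
    have "\<omega> p (X p) (e1 p) (e2 p) = c1 p * \<omega> p (X p) (d1 p) (e2 p)"
      unfolding e1_def using linear_form_combination[OF alternating_3_formD(2)[OF alt X_tangent et(2)] sub dt(1) dt(1) dt(1), of p "c1 p" 0 0]
      by simp
    also have "\<omega> p (X p) (d1 p) (e2 p) = c2 p * \<omega> p (X p) (d1 p) (d2 p)"
      unfolding e2_def using linear_form_combination[OF alternating_3_formD(3)[OF alt X_tangent dt(1)] sub dt(2) dt(2) dt(2), of p "c2 p" 0 0]
      by simp
    finally show ?thesis using c\<rho>[of p] c[of p] by (simp add: abs_mult \<rho>_def)
  qed
  define m where "m p = N p (qclass X p (e1 p))" for p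
  have m2: "m p = N p (qclass X p (e2 p))" for p
    unfolding m_def e1_def e2_def using cn[of p] c[of p] by (simp add: Nscale dt n1_def n2_def)
  have ne: "qclass X p (e1 p) \<noteq> qclass X p 0" "qclass X p (e2 p) \<noteq> qclass X p 0" for p
    unfolding e1_def e2_def using nonzero c[of p] by auto
  have m: "0 < m p" for p unfolding m_def by (rule Npos[OF et(1) ne(1)])
  have img: "\<exists>r k. dflow t p (e1 p) = r *\<^sub>R e1 (\<phi> t p) + k *\<^sub>R X (\<phi> t p)"
    "\<exists>r k. dflow t p (e2 p) = r *\<^sub>R e2 (\<phi> t p) + k *\<^sub>R X (\<phi> t p)" for t p
  proof -
    have "qclass X p (1 *\<^sub>R e1 p) \<in> Es p" "qclass X p (1 *\<^sub>R e2 p) \<in> Eu p" unfolding E by blast+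
    then have "qclass X (\<phi> t p) (dflow t p (e1 p)) \<in> Es (\<phi> t p)" "qclass X (\<phi> t p) (dflow t p (e2 p)) \<in> Eu (\<phi> t p)"
      unfolding inv[symmetric] dflow_qclass[symmetric] quotient_pushforward_def by auto
    then obtain r s where "qclass X (\<phi> t p) (r *\<^sub>R e1 (\<phi> t p)) = qclass X (\<phi> t p) (dflow t p (e1 p))"
      "qclass X (\<phi> t p) (s *\<^sub>R e2 (\<phi> t p)) = qclass X (\<phi> t p) (dflow t p (e2 p))"
      unfolding E by auto
    then show "\<exists>r k. dflow t p (e1 p) = r *\<^sub>R e1 (\<phi> t p) + k *\<^sub>R X (\<phi> t p)"
      "\<exists>r k. dflow t p (e2 p) = r *\<^sub>R e2 (\<phi> t p) + k *\<^sub>R X (\<phi> t p)"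
      unfolding qclass_eq_iff by blast+
  qed
  obtain f a where f: "\<And>t p. dflow t p (e1 p) = f t p *\<^sub>R e1 (\<phi> t p) + a t p *\<^sub>R X (\<phi> t p)"
    using img(1) by metis
  obtain g b where g: "\<And>t p. dflow t p (e2 p) = g t p *\<^sub>R e2 (\<phi> t p) + b t p *\<^sub>R X (\<phi> t p)"
    using img(2) by metis
  have fg: "\<bar>f t p\<bar> * \<bar>g t p\<bar> = 1" for t p
  proof -
    let ?q = "\<phi> t p"
    have "\<omega> p (X p) (e1 p) (e2 p) = \<omega> ?q (dflow t p (X p)) (dflow t p (e1 p)) (dflow t p (e2 p))"
      using pres X_tangent et unfolding preserves_3_form_def by simp
    also have "\<dots> = f t p * \<omega> ?q (X ?q) (e1 ?q) (dflow t p (e2 p))"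
      using linear_form_combination[OF alternating_3_formD(2)[OF alt X_tangent dflow_tangent[OF et(2)]] sub
          et(1) X_tangent X_tangent, of t p "f t p" "a t p" 0]
        alternating_3_formD(4)[OF alt X_tangent dflow_tangent[OF et(2)]]
      by (simp add: dflow_X f)
    also have "\<omega> ?q (X ?q) (e1 ?q) (dflow t p (e2 p)) = g t p * \<omega> ?q (X ?q) (e1 ?q) (e2 ?q)"
      using linear_form_combination[OF alternating_3_formD(3)[OF alt X_tangent et(1)] sub
          et(2) X_tangent X_tangent, of "\<phi> t p" "g t p" "b t p" 0]
        alternating_3_formD(5)[OF alt X_tangent et(1)]
      by (simp add: g)
    finally have "\<bar>\<omega> p (X p) (e1 p) (e2 p)\<bar> = \<bar>f t p\<bar> * \<bar>g t p\<bar> * \<bar>\<omega> ?q (X ?q) (e1 ?q) (e2 ?q)\<bar>"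
      by (simp add: abs_mult)
    then show ?thesis by (simp add: \<omega>e)
  qed
  have ratio: "exp (C * t) * \<bar>f t p\<bar> \<le> \<bar>g t p\<bar>" if t: "0 \<le> t" for t p
  proof -
    have "qclass X p (1 *\<^sub>R e1 p) \<in> Es p" "qclass X p (1 *\<^sub>R e2 p) \<in> Eu p" unfolding E by blast+
    then have "exp (C * t) * (N p (qclass X p (e2 p)) / N p (qclass X p (e1 p))) \<le>
        N (\<phi> t p) (qclass X (\<phi> t p) (dflow t p (e2 p))) / N (\<phi> t p) (qclass X (\<phi> t p) (dflow t p (e1 p)))"
      using dom[OF t, of "qclass X p (e1 p)" p "qclass X p (e2 p)"] ne
      by (simp add: quotient_pushforward_def dflow_qclass)
    moreover have "qclass X (\<phi> t p) (dflow t p (e1 p)) = qclass X (\<phi> t p) (f t p *\<^sub>R e1 (\<phi> t p))"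
      "qclass X (\<phi> t p) (dflow t p (e2 p)) = qclass X (\<phi> t p) (g t p *\<^sub>R e2 (\<phi> t p))"
      using f[of t p] g[of t p] qclass_eq_iff by metis+
    ultimately have "exp (C * t) \<le> \<bar>g t p\<bar> / \<bar>f t p\<bar>"
      using m[of p] m[of "\<phi> t p"] by (simp add: Nscale et m_def[symmetric] m2[symmetric])
    moreover have "0 < \<bar>f t p\<bar>" using fg[of t p] by (metis abs_ge_zero less_eq_real_def mult_zero_left zero_neq_one)
    ultimately show ?thesis by (simp add: pos_le_divide_eq)
  qed
  have sq: "exp (C / 2 * t) * exp (C / 2 * t) = exp (C * t)" for t
    by (simp flip: exp_add)
  have growth: "exp (C / 2 * t) \<le> \<bar>g t p\<bar>" if t: "0 \<le> t" for t p
  proof -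
    have "(exp (C / 2 * t))\<^sup>2 = exp (C * t) * (\<bar>f t p\<bar> * \<bar>g t p\<bar>)"
      unfolding fg by (simp only: power2_eq_square sq mult_1_right)
    also have "\<dots> \<le> \<bar>g t p\<bar>\<^sup>2"
      using mult_right_mono[OF ratio[OF t, of p], of "\<bar>g t p\<bar>"] by (simp only: power2_eq_square mult.assoc abs_ge_zero)
    finally show ?thesis by (rule power2_le_imp_le) simp
  qed
  show ?thesis
  proof (rule anosov_if_hyperbolic_frame[where f = f and g = g and a = a and b = b, OF fr _ f g])
    show "0 < C / 2" using C by simp
    fix t :: real and p assume t: "0 \<le> t"
    show "exp (C / 2 * t) \<le> \<bar>g t p\<bar>" by (rule growth[OF t])
    have "\<bar>f t p\<bar> * exp (C / 2 * t) \<le> \<bar>f t p\<bar> * \<bar>g t p\<bar>" by (intro mult_left_mono growth t) simp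
    then show "\<bar>f t p\<bar> \<le> exp (- (C / 2) * t)" unfolding fg by (simp add: exp_minus field_simps)
  qed
qed

end

section \<open>Flows that preserve a contact structure\<close>

lemma alternating_wedge_1_2:
  assumes \<alpha>: "linear_form_on V \<alpha>"
    and \<beta>: "\<And>u. u \<in> V \<Longrightarrow> linear_form_on V (\<beta> u)" and skew: "\<And>u v. \<beta> u v = - \<beta> v u"
  shows "alternating_3_form_on V (wedge_1_2 \<alpha> \<beta>)"
proof -
  have a: "\<alpha> (a *\<^sub>R x + b *\<^sub>R y) = a * \<alpha> x + b * \<alpha> y" if "x \<in> V" "y \<in> V" for a b x y
    using \<alpha> that unfolding linear_form_on_def by blast
  have b: "\<beta> u (a *\<^sub>R x + b *\<^sub>R y) = a * \<beta> u x + b * \<beta> u y" if "u \<in> V" "x \<in> V" "y \<in> V" for u a b x y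
    using \<beta>[OF that(1)] that(2,3) unfolding linear_form_on_def by blast
  have b': "\<beta> (a *\<^sub>R x + b *\<^sub>R y) u = a * \<beta> x u + b * \<beta> y u" if "u \<in> V" "x \<in> V" "y \<in> V" for u a b x y
    using b[OF that, of a b] skew[of _ u] by simp
  have 0: "\<beta> u u = 0" for u using skew[of u u] by simp
  show ?thesis
    unfolding alternating_3_form_on_def
  proof (intro conjI ballI)
    fix u v assume uv: "u \<in> V" "v \<in> V"
    show "linear_form_on V (\<lambda>w. wedge_1_2 \<alpha> \<beta> w u v)"
      unfolding linear_form_on_def wedge_1_2_def using uv by (simp add: a b' algebra_simps)
    show "linear_form_on V (\<lambda>w. wedge_1_2 \<alpha> \<beta> u w v)"
      unfolding linear_form_on_def wedge_1_2_def using uv by (simp add: a b b' algebra_simps)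
    show "linear_form_on V (\<lambda>w. wedge_1_2 \<alpha> \<beta> u v w)"
      unfolding linear_form_on_def wedge_1_2_def using uv by (simp add: a b algebra_simps)
    show "wedge_1_2 \<alpha> \<beta> u u v = 0" "wedge_1_2 \<alpha> \<beta> v u u = 0"
      unfolding wedge_1_2_def by (simp_all add: 0)
    show "wedge_1_2 \<alpha> \<beta> u v u = 0"
      unfolding wedge_1_2_def using skew[of u v] by (simp add: 0)
  qed
qed

context smooth_atlas
begin

definition form_coeff :: "('m \<Rightarrow> 'm tvec \<Rightarrow> real) \<Rightarrow> 'm chart \<Rightarrow> real^3 \<Rightarrow> real^3 \<Rightarrow> real" where
  "form_coeff \<alpha> c x h = \<alpha> (cinv c x) (coord_vec A c (cinv c x) h)"

definition chart_exterior_derivative ::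
  "('m \<Rightarrow> 'm tvec \<Rightarrow> real) \<Rightarrow> 'm chart \<Rightarrow> 'm \<Rightarrow> 'm tvec \<Rightarrow> 'm tvec \<Rightarrow> real" where
  "chart_exterior_derivative \<alpha> c p u v =
     frechet_derivative (\<lambda>x. form_coeff \<alpha> c x (v c)) (at (cmap c p)) (u c)
     - frechet_derivative (\<lambda>x. form_coeff \<alpha> c x (u c)) (at (cmap c p)) (v c)"

lemma exterior_derivative_chart_at:
  "exterior_derivative A \<alpha> p u v = chart_exterior_derivative \<alpha> (chart_at A p) p u v"
  unfolding exterior_derivative_def chart_exterior_derivative_def form_coeff_def Let_def ..

lemma C1_form_coeff:
  assumes "C1_one_form A \<alpha>" "c \<in> A"
  shows "Ck_on 1 (\<lambda>x. form_coeff \<alpha> c x h) (cimg c)"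
  using assms unfolding C1_one_form_def form_coeff_def by blast

lemma form_coeff_cmap:
  assumes "c \<in> A" "p \<in> cdom c"
  shows "form_coeff \<alpha> c (cmap c p) h = \<alpha> p (coord_vec A c p h)"
  using assms by (simp add: form_coeff_def cinv_cmap)

lemma form_coeff_linear:
  assumes "C1_one_form A \<alpha>" and c: "c \<in> A" "x \<in> cimg c"
  shows "linear (form_coeff \<alpha> c x)"
proof (rule linearI)
  note p = c(1) cinv_in_cdom[OF c]
  have lin: "\<alpha> (cinv c x) (a *\<^sub>R v + b *\<^sub>R w) = a * \<alpha> (cinv c x) v + b * \<alpha> (cinv c x) w"
    if "v \<in> tangent_space A (cinv c x)" "w \<in> tangent_space A (cinv c x)" for v w a b
    using assms(1) that unfolding C1_one_form_def linear_form_on_def by blast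
  note cv = coord_vec_in_tangent_space[OF p]
  show "form_coeff \<alpha> c x (h + k) = form_coeff \<alpha> c x h + form_coeff \<alpha> c x k" for h k
    using lin[OF cv cv, of 1 h 1 k] by (simp add: form_coeff_def linear_add[OF coord_vec_linear[OF p]])
  show "form_coeff \<alpha> c x (r *\<^sub>R h) = r *\<^sub>R form_coeff \<alpha> c x h" for r h
    using lin[OF cv cv, of r h 0 h] by (simp add: form_coeff_def linear_cmul[OF coord_vec_linear[OF p]])
qed

text \<open>In charts the invariance of \<open>\<alpha>\<close> under \<open>g\<close> says that one coordinate expression of \<open>\<alpha>\<close> is the pull-back
  of another under the \<open>C\<^sup>1\<close> map that represents \<open>g\<close>. With the identity for \<open>g\<close> and two charts at one
  point, the conclusion is that the exterior derivative does not depend on the chart.\<close>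

lemma chart_exterior_derivative_natural:
  assumes \<alpha>: "C1_one_form A \<alpha>" and g: "\<And>p. C1_near g p"
    and inv: "\<And>p v. v \<in> tangent_space A p \<Longrightarrow> \<alpha> (g p) (pushforward A g p v) = \<alpha> p v"
    and c: "c \<in> A" "p \<in> cdom c" and c': "c' \<in> A" "g p \<in> cdom c'"
    and u: "u \<in> tangent_space A p" and v: "v \<in> tangent_space A p"
  shows "chart_exterior_derivative \<alpha> c' (g p) (pushforward A g p u) (pushforward A g p v)
    = chart_exterior_derivative \<alpha> c p u v"
proof -
  obtain U where U: "open U" "p \<in> U" "U \<subseteq> cdom c" "g ` U \<subseteq> cdom c'"
    "Ck_on 1 (cmap c' \<circ> g \<circ> cinv c) (cmap c ` U)"
    using C1_near_in_charts[OF g c c'] by metis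
  let ?F = "cmap c' \<circ> g \<circ> cinv c" and ?x = "cmap c p"
  have Fx: "?F ?x = cmap c' (g p)" by (simp add: cinv_cmap c)
  have FS: "?F ` (cmap c ` U) \<subseteq> cimg c'" using U(3,4) by (auto simp: cinv_cmap c subset_iff image_subset_iff)
  have d: "((\<lambda>x. form_coeff \<alpha> c x k) has_derivative frechet_derivative (\<lambda>x. form_coeff \<alpha> c x k) (at ?x)) (at ?x)" for k
    using c by (intro C1_on_has_derivative[OF open_cimg C1_form_coeff[OF \<alpha>]]) auto
  have d': "((\<lambda>x. form_coeff \<alpha> c' x k) has_derivative
      frechet_derivative (\<lambda>x. form_coeff \<alpha> c' x k) (at (?F ?x))) (at (?F ?x))" for k
    unfolding Fx using c' by (intro C1_on_has_derivative[OF open_cimg C1_form_coeff[OF \<alpha>]]) auto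
  have pull: "form_coeff \<alpha> c x h = form_coeff \<alpha> c' (?F x) (frechet_derivative ?F (at x) h)"
    if x: "x \<in> cmap c ` U" for x h
  proof -
    obtain q where q: "q \<in> U" "x = cmap c q" using x by blast
    have qc: "q \<in> cdom c" and gq: "g q \<in> cdom c'" using q(1) U(3,4) by auto
    have t: "coord_vec A c q h \<in> tangent_space A q" by (rule coord_vec_in_tangent_space[OF c(1) qc])
    have "pushforward A g q (coord_vec A c q h) = coord_vec A c' (g q) (frechet_derivative ?F (at x) h)"
    proof (rule tangent_eqI[OF pushforward_in_tangent_space[OF g t] coord_vec_in_tangent_space[OF c'(1) gq] c'(1) gq])
      show "pushforward A g q (coord_vec A c q h) c' = coord_vec A c' (g q) (frechet_derivative ?F (at x) h) c'"
        unfolding pushforward_apply[OF g t c(1) qc c'(1) gq] coord_vec_self[OF c'(1) gq] coord_vec_self[OF c(1) qc] q(2) ..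
    qed
    moreover have "?F x = cmap c' (g q)" using qc by (simp add: q(2) cinv_cmap c)
    ultimately show ?thesis
      using inv[OF t] by (simp add: q(2) form_coeff_cmap[OF c(1) qc] form_coeff_cmap[OF c'(1) gq])
  qed
  have push: "pushforward A g p w c' = frechet_derivative ?F (at ?x) (w c)" if "w \<in> tangent_space A p" for w
    by (rule pushforward_apply[OF g that c c'])
  show ?thesis
    unfolding chart_exterior_derivative_def push[OF u] push[OF v] Fx[symmetric]
    by (rule exterior_derivative_pullback_C1[where S = "cmap c ` U" and T = "cimg c'" and a = "form_coeff \<alpha> c'"
          and b = "form_coeff \<alpha> c" and F = ?F and A = "\<lambda>h k. frechet_derivative (\<lambda>x. form_coeff \<alpha> c' x k) (at (?F ?x)) h"
          and B = "\<lambda>h k. frechet_derivative (\<lambda>x. form_coeff \<alpha> c x k) (at ?x) h", symmetric])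
      (use open_cmap_image[OF c(1) U(1,3)] open_cimg[OF c'(1)] U(2,5) d d' pull FS
        form_coeff_linear[OF \<alpha> c'(1)] in \<open>simp_all\<close>)
qed

lemma exterior_derivative_in_chart:
  assumes \<alpha>: "C1_one_form A \<alpha>" and c: "c \<in> A" "p \<in> cdom c"
    and uv: "u \<in> tangent_space A p" "v \<in> tangent_space A p"
  shows "exterior_derivative A \<alpha> p u v = chart_exterior_derivative \<alpha> c p u v"
  using chart_exterior_derivative_natural[OF \<alpha> C1_near_id, of c p "chart_at A p" u v] c uv chart_at_in in_chart_at
  by (simp add: exterior_derivative_chart_at pushforward_id)

lemma exterior_derivative_natural:
  assumes \<alpha>: "C1_one_form A \<alpha>" and g: "\<And>p. C1_near g p"
    and inv: "\<And>p v. v \<in> tangent_space A p \<Longrightarrow> \<alpha> (g p) (pushforward A g p v) = \<alpha> p v"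
    and uv: "u \<in> tangent_space A p" "v \<in> tangent_space A p"
  shows "exterior_derivative A \<alpha> (g p) (pushforward A g p u) (pushforward A g p v) = exterior_derivative A \<alpha> p u v"
  unfolding exterior_derivative_chart_at
  by (rule chart_exterior_derivative_natural[where \<alpha> = \<alpha> and g = g, OF \<alpha> g inv chart_at_in in_chart_at chart_at_in in_chart_at uv])

lemma exterior_derivative_linear:
  assumes \<alpha>: "C1_one_form A \<alpha>"
  shows "linear_form_on (tangent_space A p) (exterior_derivative A \<alpha> p u)"
  unfolding linear_form_on_def
proof (intro ballI allI)
  fix v w a b
  let ?c = "chart_at A p"
  let ?f = "\<lambda>k x. form_coeff \<alpha> ?c x k" and ?x = "cmap ?c p"
  have x: "?x \<in> cimg ?c" using in_chart_at by blast
  have d: "(?f k has_derivative frechet_derivative (?f k) (at ?x)) (at ?x)" for k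
    using x by (rule C1_on_has_derivative[OF open_cimg[OF chart_at_in] C1_form_coeff[OF \<alpha> chart_at_in]])
  have der: "(?f (a *\<^sub>R v ?c + b *\<^sub>R w ?c) has_derivative
      (\<lambda>h. a * frechet_derivative (?f (v ?c)) (at ?x) h + b * frechet_derivative (?f (w ?c)) (at ?x) h)) (at ?x)"
  proof (rule has_derivative_transform_within_open[OF _ open_cimg[OF chart_at_in] x])
    show "((\<lambda>x. a * ?f (v ?c) x + b * ?f (w ?c) x) has_derivative
        (\<lambda>h. a * frechet_derivative (?f (v ?c)) (at ?x) h + b * frechet_derivative (?f (w ?c)) (at ?x) h)) (at ?x)"
      by (intro has_derivative_add has_derivative_mult_right d)
    show "a * ?f (v ?c) y + b * ?f (w ?c) y = ?f (a *\<^sub>R v ?c + b *\<^sub>R w ?c) y" if "y \<in> cimg ?c" for y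
      using form_coeff_linear[OF \<alpha> chart_at_in that] by (simp add: linear_add linear_cmul)
  qed
  have "frechet_derivative (?f (a *\<^sub>R v ?c + b *\<^sub>R w ?c)) (at ?x) (u ?c)
      = a * frechet_derivative (?f (v ?c)) (at ?x) (u ?c) + b * frechet_derivative (?f (w ?c)) (at ?x) (u ?c)"
    unfolding frechet_derivative_at[OF der, symmetric] ..
  moreover have "frechet_derivative (?f (u ?c)) (at ?x) (a *\<^sub>R v ?c + b *\<^sub>R w ?c)
      = a * frechet_derivative (?f (u ?c)) (at ?x) (v ?c) + b * frechet_derivative (?f (u ?c)) (at ?x) (w ?c)"
    using has_derivative_linear[OF d] by (simp add: linear_add linear_cmul)
  ultimately show "exterior_derivative A \<alpha> p u (a *\<^sub>R v + b *\<^sub>R w)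
      = a * exterior_derivative A \<alpha> p u v + b * exterior_derivative A \<alpha> p u w"
    by (simp add: exterior_derivative_chart_at chart_exterior_derivative_def algebra_simps)
qed

lemma exterior_derivative_skew: "exterior_derivative A \<alpha> p u v = - exterior_derivative A \<alpha> p v u"
  by (simp add: exterior_derivative_chart_at chart_exterior_derivative_def)

lemma C0_volume_form_wedge:
  assumes \<alpha>: "C1_one_form A \<alpha>"
    and nz: "\<And>p. \<exists>u\<in>tangent_space A p. \<exists>v\<in>tangent_space A p. \<exists>w\<in>tangent_space A p.
           wedge_1_2 (\<alpha> p) (exterior_derivative A \<alpha> p) u v w \<noteq> 0"
  shows "C0_volume_form A (\<lambda>p. wedge_1_2 (\<alpha> p) (exterior_derivative A \<alpha> p))"
proof -
  have lf: "linear_form_on (tangent_space A q) (\<alpha> q)" for q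
    using \<alpha> unfolding C1_one_form_def by blast
  have alt: "alternating_3_form_on (tangent_space A p) (wedge_1_2 (\<alpha> p) (exterior_derivative A \<alpha> p))" for p
    by (rule alternating_wedge_1_2[OF lf exterior_derivative_linear[OF \<alpha>] exterior_derivative_skew])
  have "continuous_on (cdom c) (\<lambda>p. wedge_1_2 (\<alpha> p) (exterior_derivative A \<alpha> p)
      (coord_vec A c p h) (coord_vec A c p k) (coord_vec A c p l))" if c: "c \<in> A" for c h k l
  proof -
    let ?a = "\<lambda>h p. form_coeff \<alpha> c (cmap c p) h"
    let ?D = "\<lambda>h k p. frechet_derivative (\<lambda>x. form_coeff \<alpha> c x k) (at (cmap c p)) h"
    have ca: "continuous_on (cdom c) (?a h)" for h
      by (rule continuous_on_compose2[OF C1_on_continuous_on[OF open_cimg[OF c] C1_form_coeff[OF \<alpha> c]]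
            continuous_on_cmap[OF c]]) simp
    have cD: "continuous_on (cdom c) (?D h k)" for h k
      by (rule continuous_on_compose2[OF C1_onD(2)[OF open_cimg[OF c] C1_form_coeff[OF \<alpha> c]]
            continuous_on_cmap[OF c]]) simp
    have "continuous_on (cdom c) (\<lambda>p. ?a h p * (?D k l p - ?D l k p) - ?a k p * (?D h l p - ?D l h p)
        + ?a l p * (?D h k p - ?D k h p))"
      by (intro continuous_on_add continuous_on_diff continuous_on_mult ca cD)
    then show ?thesis
    proof (rule continuous_on_eq)
      fix p assume p: "p \<in> cdom c"
      note cv = coord_vec_in_tangent_space[OF c p]
      show "?a h p * (?D k l p - ?D l k p) - ?a k p * (?D h l p - ?D l h p) + ?a l p * (?D h k p - ?D k h p)
          = wedge_1_2 (\<alpha> p) (exterior_derivative A \<alpha> p) (coord_vec A c p h) (coord_vec A c p k) (coord_vec A c p l)"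
        unfolding wedge_1_2_def exterior_derivative_in_chart[OF \<alpha> c p cv cv] chart_exterior_derivative_def
          coord_vec_self[OF c p] form_coeff_cmap[OF c p] ..
    qed
  qed
  then show ?thesis unfolding C0_volume_form_def using alt nz by blast
qed

text \<open>In \<open>s \<alpha> \<and> d(s \<alpha>)\<close> the term with \<open>\<alpha> \<and> ds \<and> \<alpha>\<close> vanishes.\<close>

lemma wedge_exterior_derivative_scale:
  assumes \<alpha>: "C1_one_form A \<alpha>" and s: "(\<lambda>x. s (cinv (chart_at A p) x)) differentiable at (cmap (chart_at A p) p)"
    and t: "u \<in> tangent_space A p" "v \<in> tangent_space A p" "w \<in> tangent_space A p"
  shows "wedge_1_2 (\<lambda>z. s p * \<alpha> p z) (exterior_derivative A (\<lambda>q z. s q * \<alpha> q z) p) u v w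
    = (s p)\<^sup>2 * wedge_1_2 (\<alpha> p) (exterior_derivative A \<alpha> p) u v w"
proof -
  let ?c = "chart_at A p" and ?\<beta> = "\<lambda>q z. s q * \<alpha> q z"
  let ?x = "cmap ?c p" and ?S = "\<lambda>x. s (cinv (chart_at A p) x)" and ?f = "\<lambda>k x. form_coeff \<alpha> (chart_at A p) x k"
  note c = chart_at_in[of p] in_chart_at[of p]
  have x: "?x \<in> cimg ?c" using c by blast
  have d: "(?f k has_derivative frechet_derivative (?f k) (at ?x)) (at ?x)" for k
    using x by (rule C1_on_has_derivative[OF open_cimg[OF c(1)] C1_form_coeff[OF \<alpha> c(1)]])
  define S' where "S' = frechet_derivative ?S (at ?x)"
  have S': "(?S has_derivative S') (at ?x)" using s unfolding S'_def by (simp add: frechet_derivative_works)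
  have \<beta>: "form_coeff ?\<beta> ?c x k = ?S x * ?f k x" for x k by (simp add: form_coeff_def)
  have "((\<lambda>x. form_coeff ?\<beta> ?c x k) has_derivative
      (\<lambda>h. s p * frechet_derivative (?f k) (at ?x) h + S' h * ?f k ?x)) (at ?x)" for k
    unfolding \<beta> using has_derivative_mult[OF S' d, of k] by (simp add: cinv_cmap c)
  from frechet_derivative_at[OF this]
  have D\<beta>: "frechet_derivative (\<lambda>x. form_coeff ?\<beta> ?c x k) (at ?x) h
      = s p * frechet_derivative (?f k) (at ?x) h + S' h * ?f k ?x" for k h
    by metis
  have f: "?f (z ?c) ?x = \<alpha> p z" if "z \<in> tangent_space A p" for z
    by (simp add: form_coeff_cmap[OF c] coord_vec_component[OF that c])
  have E: "exterior_derivative A ?\<beta> p y z = s p * exterior_derivative A \<alpha> p y z + S' (y ?c) * \<alpha> p z - S' (z ?c) * \<alpha> p y"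
    if "y \<in> tangent_space A p" "z \<in> tangent_space A p" for y z
    unfolding exterior_derivative_chart_at chart_exterior_derivative_def D\<beta> f[OF that(1)] f[OF that(2)]
    by (simp add: algebra_simps)
  show ?thesis
    unfolding wedge_1_2_def E[OF t(1,2)] E[OF t(2,3)] E[OF t(1,3)]
    by (simp add: algebra_simps power2_eq_square)
qed

end

context closed_manifold_flow
begin

text \<open>The multiple \<open>\<beta>\<close> of the contact form that is one on \<open>X\<close> is invariant under the flow, because its
  kernel and \<open>X\<close> are, and then so is \<open>\<beta> \<and> d\<beta>\<close>. The form \<open>\<beta>\<close> is \<open>C\<^sup>1\<close> because \<open>X\<close> is.\<close>

lemma ex_invariant_volume_form_if_contact:
  assumes \<xi>: "contact_structure A \<xi>" and transverse: "\<And>p. X p \<notin> \<xi> p" and inv: "invariant_field A \<phi> \<xi>"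
  shows "\<exists>\<omega>. C0_volume_form A \<omega> \<and> preserves_3_form A \<phi> \<omega>"
proof -
  obtain \<alpha> where \<alpha>: "C1_one_form A \<alpha>"
    and nz: "\<And>p. \<exists>u\<in>tangent_space A p. \<exists>v\<in>tangent_space A p. \<exists>w\<in>tangent_space A p.
           wedge_1_2 (\<alpha> p) (exterior_derivative A \<alpha> p) u v w \<noteq> 0"
    and ker: "\<And>p. \<xi> p = {v \<in> tangent_space A p. \<alpha> p v = 0}"
    using \<xi> unfolding contact_structure_def by (elim exE conjE) blast
  have lf: "linear_form_on (tangent_space A p) (\<alpha> p)" for p
    using \<alpha> unfolding C1_one_form_def by blast
  have lin: "\<alpha> p (a *\<^sub>R v + b *\<^sub>R w) = a * \<alpha> p v + b * \<alpha> p w"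
    if "v \<in> tangent_space A p" "w \<in> tangent_space A p" for p v w a b
    using lf that unfolding linear_form_on_def by blast
  define s where "s p = inverse (\<alpha> p (X p))" for p
  have X0: "\<alpha> p (X p) \<noteq> 0" for p using transverse[of p] X_tangent unfolding ker by blast
  have s: "Ck_on 1 (\<lambda>x. s (cinv c x)) (cimg c)" if c: "c \<in> A" for c
  proof (rule C1_on_cong[OF open_cimg[OF c]])
    let ?R = "\<lambda>x. \<Sum>i\<in>Basis. (local_rep c X x \<bullet> i) * form_coeff \<alpha> c x i"
    have R: "?R x = \<alpha> (cinv c x) (X (cinv c x))" if x: "x \<in> cimg c" for x
      using linear_form_coord_vec_expand[OF lf c cinv_in_cdom[OF c x] X_tangent]
      by (simp add: form_coeff_def local_rep_def)
    show "Ck_on 1 (\<lambda>x. inverse (?R x)) (cimg c)"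
      by (intro C1_on_inverse C1_on_sum C1_on_mult C1_on_inner_left open_cimg c C1_local_rep_X C1_form_coeff \<alpha>)
        (use R X0 in auto)
    show "inverse (?R x) = s (cinv c x)" if "x \<in> cimg c" for x
      unfolding R[OF that] s_def ..
  qed
  define \<beta> where "\<beta> p v = s p * \<alpha> p v" for p v
  have \<beta>: "C1_one_form A \<beta>"
    unfolding C1_one_form_def
  proof (intro conjI allI ballI)
    show "linear_form_on (tangent_space A p) (\<beta> p)" for p
      unfolding linear_form_on_def \<beta>_def by (simp add: lin distrib_left mult.left_commute)
    show "Ck_on 1 (\<lambda>x. \<beta> (cinv c x) (coord_vec A c (cinv c x) h)) (cimg c)" if c: "c \<in> A" for c h
      unfolding \<beta>_def using C1_on_mult[OF open_cimg[OF c] s[OF c] C1_form_coeff[OF \<alpha> c]]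
      unfolding form_coeff_def .
  qed
  have \<beta>_inv: "\<beta> (\<phi> t p) (dflow t p v) = \<beta> p v" if v: "v \<in> tangent_space A p" for t p v
  proof -
    let ?w = "1 *\<^sub>R v + (- \<beta> p v) *\<^sub>R X p"
    have "?w \<in> tangent_space A p" by (intro tangent_space_intros v X_tangent)
    moreover have "\<alpha> p ?w = 0"
      using X0[of p] by (subst lin[OF v X_tangent]) (simp add: \<beta>_def s_def)
    ultimately have "?w \<in> \<xi> p" unfolding ker by blast
    then have "dflow t p ?w \<in> \<xi> (\<phi> t p)" using inv unfolding invariant_field_def by blast
    moreover have "dflow t p ?w = 1 *\<^sub>R dflow t p v + (- \<beta> p v) *\<^sub>R X (\<phi> t p)"
      by (simp only: linear_add[OF dflow_linear] linear_cmul[OF dflow_linear] dflow_X)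
    ultimately have "\<alpha> (\<phi> t p) (1 *\<^sub>R dflow t p v + (- \<beta> p v) *\<^sub>R X (\<phi> t p)) = 0"
      unfolding ker by simp
    then have "\<alpha> (\<phi> t p) (dflow t p v) = \<beta> p v * \<alpha> (\<phi> t p) (X (\<phi> t p))"
      unfolding lin[OF dflow_tangent[OF v] X_tangent] by simp
    then show ?thesis unfolding \<beta>_def[of "\<phi> t p"] s_def[of "\<phi> t p"] using X0[of "\<phi> t p"] by simp
  qed
  let ?\<omega> = "\<lambda>p. wedge_1_2 (\<beta> p) (exterior_derivative A \<beta> p)"
  have "C0_volume_form A ?\<omega>"
  proof (rule C0_volume_form_wedge[OF \<beta>])
    fix p
    obtain u v w where t: "u \<in> tangent_space A p" "v \<in> tangent_space A p" "w \<in> tangent_space A p"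
      and n: "wedge_1_2 (\<alpha> p) (exterior_derivative A \<alpha> p) u v w \<noteq> 0" using nz[of p] by blast
    have "(\<lambda>x. s (cinv (chart_at A p) x)) differentiable at (cmap (chart_at A p) p)"
      by (rule C1_onD(1)[OF open_cimg[OF chart_at_in] s[OF chart_at_in]]) (use in_chart_at in blast)
    then have "?\<omega> p u v w = (s p)\<^sup>2 * wedge_1_2 (\<alpha> p) (exterior_derivative A \<alpha> p) u v w"
      unfolding \<beta>_def[abs_def] by (rule wedge_exterior_derivative_scale[OF \<alpha> _ t])
    then have "?\<omega> p u v w \<noteq> 0" using n X0[of p] by (simp add: s_def)
    then show "\<exists>u\<in>tangent_space A p. \<exists>v\<in>tangent_space A p. \<exists>w\<in>tangent_space A p. ?\<omega> p u v w \<noteq> 0"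
      using t by blast
  qed
  moreover have "preserves_3_form A \<phi> ?\<omega>"
    unfolding preserves_3_form_def
  proof (intro allI ballI)
    fix t p u v w assume m: "u \<in> tangent_space A p" "v \<in> tangent_space A p" "w \<in> tangent_space A p"
    have ext: "exterior_derivative A \<beta> (\<phi> t p) (dflow t p y) (dflow t p z) = exterior_derivative A \<beta> p y z"
      if "y \<in> tangent_space A p" "z \<in> tangent_space A p" for y z
      by (rule exterior_derivative_natural[where \<alpha> = \<beta> and g = "\<phi> t", OF \<beta> flow_C1_near \<beta>_inv that])
    show "?\<omega> (\<phi> t p) (dflow t p u) (dflow t p v) (dflow t p w) = ?\<omega> p u v w"
      unfolding wedge_1_2_def \<beta>_inv[OF m(1)] \<beta>_inv[OF m(2)] \<beta>_inv[OF m(3)]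
        ext[OF m(1,2)] ext[OF m(2,3)] ext[OF m(1,3)] ..
  qed
  ultimately show ?thesis by (intro exI[of _ ?\<omega>] conjI)
qed

end

theorem corollary1p3:
  fixes A :: "('m::t2_space) chart set"
    and X :: "'m \<Rightarrow> 'm tvec"
    and \<phi> :: "real \<Rightarrow> 'm \<Rightarrow> 'm"
    and Es Eu :: "'m \<Rightarrow> 'm tvec set set"
  assumes "closed_connected_oriented_3_manifold A"
    and "C1_plus_vector_field A X"
    and "\<forall>p. X p \<noteq> 0"
    and "flow_generated_by A X \<phi>"
    and "projectively_anosov_splitting A X \<phi> Es Eu"
    and "transversely_orientable A (plane_over Es)"
    and "transversely_orientable A (plane_over Eu)"
  shows "((\<exists>\<omega>. C0_volume_form A \<omega> \<and> preserves_3_form A \<phi> \<omega>) \<longrightarrow> anosov A X \<phi>) \<and>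
         ((\<exists>\<xi>. contact_structure A \<xi> \<and> (\<forall>p. X p \<notin> \<xi> p) \<and> invariant_field A \<phi> \<xi>)
            \<longrightarrow> anosov A X \<phi>)"
proof -
  interpret closed_manifold_flow A X \<phi>
    by unfold_locales
      (use assms in \<open>auto simp: closed_connected_oriented_3_manifold_def\<close>)
  have vol: "anosov A X \<phi>" if "C0_volume_form A \<omega>" "preserves_3_form A \<phi> \<omega>" for \<omega>
    using anosov_if_volume_preserving[OF _ assms(5-7) that] assms(3) by blast
  show ?thesis
  proof (intro conjI impI)
    assume "\<exists>\<omega>. C0_volume_form A \<omega> \<and> preserves_3_form A \<phi> \<omega>"
    then obtain \<omega> where "C0_volume_form A \<omega>" "preserves_3_form A \<phi> \<omega>" by blast
    then show "anosov A X \<phi>" by (rule vol)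
  next
    assume "\<exists>\<xi>. contact_structure A \<xi> \<and> (\<forall>p. X p \<notin> \<xi> p) \<and> invariant_field A \<phi> \<xi>"
    then obtain \<xi> where "contact_structure A \<xi>" "\<And>p. X p \<notin> \<xi> p" "invariant_field A \<phi> \<xi>"
      by (elim exE conjE) simp
    from ex_invariant_volume_form_if_contact[OF this]
    obtain \<omega> where "C0_volume_form A \<omega>" "preserves_3_form A \<phi> \<omega>" by blast
    then show "anosov A X \<phi>" by (rule vol)
  qed
qed

end
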